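(* Let $\phi(x)=\pi^{-d/4}e^{-|x|^2/2}$, $x\in\mathbf R^d$, for $r\in\mathbf R_+^d$ let $\chi_r$ be the characteristic function of $\overline{D_r(0)}$, let $s>1$, and let $f\in\mathscr S'(\mathbf R^d)$. Then the following conditions are equivalent: (1) $f\in\mathcal H_{\flat_1}(\mathbf R^d)$; (2) $f=V_\phi^*F$ for some $F\in\mathcal E_s'(\mathbf R^{2d})$; (3) $f=V_\phi^*F$ for some $F\in\mathscr E'(\mathbf R^{2d})\cap L^\infty(\mathbf R^{2d})$; (4) $f=V_\phi^*F$ for some $F\in\mathscr E'(\mathbf R^{2d})\cap L^\infty(\mathbf R^{2d})$ which satisfies $$F(x,\xi)=F_0(x-i\xi)\,e^{-i\langle x,\xi\rangle}\chi(x,\xi)$$ for some $r\in\mathbf R_+^d$, $\chi=\chi_r$ and $F_0\in A(\overline{D_r(0)})$.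
   Context: Notation: $\mathbf R_+=(0,\infty)$, $\mathbf N=\{0,1,2,\dots\}$. $D_r(0)=\{z\in\mathbf C^d: |z_j|<r_j,\ j=1,\dots,d\}$; functions on $\mathbf C^d$ are regarded as functions on $\mathbf R^{2d}$ via $z=x+i\xi$. $A(\overline{D_r(0)})$ is the set of functions analytic in an open neighbourhood of $\overline{D_r(0)}$. $\langle x,\xi\rangle=\sum_jx_j\xi_j$. $g\lesssim h$ means $g\le Ch$ with $C>0$ independent of the variable. Hermite functions: $h_\alpha(x)=\pi^{-d/4}(-1)^{|\alpha|}(2^{|\alpha|}\alpha!)^{-1/2}e^{|x|^2/2}\partial^\alpha e^{-|x|^2}$, $\alpha\in\mathbf N^d$, an orthonormal basis of $L^2(\mathbf R^d)$; $c_h(f,\alpha)=(f,h_\alpha)_{L^2}$. $\mathcal H_{\flat_1}(\mathbf R^d)$ is the set of $f\in L^2(\mathbf R^d)$ with $|c_h(f,\alpha)|\lesssim r^\alpha\alpha!^{-1/2}$ for some $r\in\mathbf R_+^d$. The short-time Fourier transform is $V_\phi f(x,\xi)=\langle f,\overline{\phi(\cdot-x)}e^{-i\langle\cdot,\xi\rangle}\rangle$, and $V_\phi^*$ is its adjoint; for compactly supported (Gevrey) distributions $F$ on $\mathbf R^{2d}$ it is given by $(V_\phi^*F)(x)=\langle F,\ (y,\eta)\mapsto\phi(x-y)e^{i\langle x,\eta\rangle}\rangle$, which for $F\in L^\infty\cap\mathscr E'$ is $\iint F(y,\eta)\phi(x-y)e^{i\langle x,\eta\rangle}\,dy\,d\eta$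 (constant normalising factors are immaterial here). $\mathscr E'$ denotes compactly supported distributions. $\mathcal E_s(\mathbf R^{n})$ is the space of Gevrey functions of order $s$: all $g\in C^\infty(\mathbf R^n)$ such that for every compact $K$ there is $h>0$ with $\sup_{x\in K,\alpha}|\partial^\alpha g(x)|/(h^{|\alpha|}\alpha!^s)<\infty$. $\mathcal E_s'(\mathbf R^n)$ is its dual: linear functionals $u$ for which there is a compact $K$ such that for every $h>0$ there is $C_h$ with $|\langle u,g\rangle|\le C_h\sup_{x\in K,\alpha}|\partial^\alpha g(x)|/(h^{|\alpha|}\alpha!^s)$ for all $g\in\mathcal E_s(\mathbf R^n)$. *)

theory Defs
  imports "HOL-Analysis.Analysis"
begin

section \<open>Multi-indices and partial derivatives\<close>

text \<open>
  A multi-index on a Euclidean space is a function on the space of which only the values at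
  the basis vectors matter.  All notions below depend only on these values.
\<close>

definition mi_length :: "('a::euclidean_space \<Rightarrow> nat) \<Rightarrow> nat" where
  "mi_length \<alpha> = (\<Sum>b\<in>Basis. \<alpha> b)"

definition mi_fact :: "('a::euclidean_space \<Rightarrow> nat) \<Rightarrow> real" where
  "mi_fact \<alpha> = (\<Prod>b\<in>Basis. fact (\<alpha> b))"

definition mi_power :: "'a::euclidean_space \<Rightarrow> ('a \<Rightarrow> nat) \<Rightarrow> real" where
  "mi_power x \<alpha> = (\<Prod>b\<in>Basis. (x \<bullet> b) ^ \<alpha> b)"

primrec iter_partial ::
    "'a::euclidean_space list \<Rightarrow> ('a \<Rightarrow> 'b::real_normed_vector) \<Rightarrow> 'a \<Rightarrow> 'b" where
  "iter_partial [] g = g"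
| "iter_partial (b # bs) g =
     (\<lambda>x. vector_derivative (\<lambda>t. iter_partial bs g (x + t *\<^sub>R b)) (at 0))"

definition smooth :: "('a::euclidean_space \<Rightarrow> 'b::real_normed_vector) \<Rightarrow> bool" where
  "smooth g \<longleftrightarrow> (\<forall>bs. set bs \<subseteq> Basis \<longrightarrow> iter_partial bs g differentiable_on UNIV)"

text \<open>
  The derivative of order \<open>\<alpha>\<close>: some fixed ordering of the differentiations is chosen;
  for smooth functions the result does not depend on it.
\<close>

definition mi_deriv ::
    "('a::euclidean_space \<Rightarrow> nat) \<Rightarrow> ('a \<Rightarrow> 'b::real_normed_vector) \<Rightarrow> 'a \<Rightarrow> 'b" where
  "mi_deriv \<alpha> g =
     iter_partial (SOME bs. set bs \<subseteq> Basis \<and> (\<forall>b\<in>Basis. count_list bs b = \<alpha> b)) g"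


section \<open>Test functions and distributions\<close>

text \<open>
  Distributions are functions on all of \<open>'a \<Rightarrow> complex\<close>; only their values on the respective
  space of test functions are meaningful.  The pairings are bilinear.
\<close>

definition linear_functional_on :: "('a \<Rightarrow> complex) set \<Rightarrow> (('a \<Rightarrow> complex) \<Rightarrow> complex) \<Rightarrow> bool" where
  "linear_functional_on V u \<longleftrightarrow>
     (\<forall>g\<in>V. \<forall>k\<in>V. u (\<lambda>x. g x + k x) = u g + u k) \<and>
     (\<forall>c. \<forall>g\<in>V. u (\<lambda>x. c * g x) = c * u g)"

definition schwartz_norm :: "nat \<Rightarrow> ('a::euclidean_space \<Rightarrow> complex) \<Rightarrow> ennreal" where
  "schwartz_norm N g =
     (SUP x. SUP \<alpha>\<in>{\<alpha>. mi_length \<alpha> \<le> N}. SUP \<beta>\<in>{\<beta>. mi_length \<beta> \<le> N}.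
        ennreal (\<bar>mi_power x \<alpha>\<bar> * cmod (mi_deriv \<beta> g x)))"

definition schwartz :: "('a::euclidean_space \<Rightarrow> complex) set" where
  "schwartz = {g. smooth g \<and> (\<forall>N. schwartz_norm N g < \<infinity>)}"

definition tempered_distributions :: "(('a::euclidean_space \<Rightarrow> complex) \<Rightarrow> complex) set" where
  "tempered_distributions = {u. linear_functional_on schwartz u \<and>
     (\<exists>N. \<exists>C>0. \<forall>g\<in>schwartz. ennreal (cmod (u g)) \<le> ennreal C * schwartz_norm N g)}"

definition gevrey_norm ::
    "real \<Rightarrow> real \<Rightarrow> 'a::euclidean_space set \<Rightarrow> ('a \<Rightarrow> complex) \<Rightarrow> ennreal" where
  "gevrey_norm s h K g =
     (SUP x\<in>K. SUP \<alpha>. ennreal (cmod (mi_deriv \<alpha> g x) / (h ^ mi_length \<alpha> * mi_fact \<alpha> powr s)))"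

definition gevrey :: "real \<Rightarrow> ('a::euclidean_space \<Rightarrow> complex) set" where
  "gevrey s = {g. smooth g \<and> (\<forall>K. compact K \<longrightarrow> (\<exists>h>0. gevrey_norm s h K g < \<infinity>))}"

text \<open>The bound below is void for those \<open>g\<close> and \<open>h\<close> for which the supremum is infinite.\<close>

definition gevrey_dual :: "real \<Rightarrow> (('a::euclidean_space \<Rightarrow> complex) \<Rightarrow> complex) set" where
  "gevrey_dual s = {u. linear_functional_on (gevrey s) u \<and>
     (\<exists>K. compact K \<and> (\<forall>h>0. \<exists>C>0. \<forall>g\<in>gevrey s.
        ennreal (cmod (u g)) \<le> ennreal C * gevrey_norm s h K g))}"

definition regular :: "('a::euclidean_space \<Rightarrow> complex) \<Rightarrow> ('a \<Rightarrow> complex) \<Rightarrow> complex" where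
  "regular F g = (\<integral>x. F x * g x \<partial>lborel)"

text \<open>
  Equality in the space of tempered distributions of \<open>u\<close> and the function \<open>F\<close>.  Integrability is
  demanded because non-integrable functions have integral 0 by convention.
\<close>

definition tempered_eq ::
    "(('a::euclidean_space \<Rightarrow> complex) \<Rightarrow> complex) \<Rightarrow> ('a \<Rightarrow> complex) \<Rightarrow> bool" where
  "tempered_eq u F \<longleftrightarrow>
     (\<forall>g\<in>schwartz. integrable lborel (\<lambda>x. F x * g x) \<and> u g = regular F g)"


section \<open>Compactly supported bounded functions\<close>

text \<open>
  Elements of Lebesgue spaces are represented by Borel measurable functions.  The support is that
  of the associated distribution: the complement of the largest open set where \<open>F\<close> vanishes
  almost everywhere.
\<close>

definition ess_support :: "('a::euclidean_space \<Rightarrow> complex) \<Rightarrow> 'a set" where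
  "ess_support F = - \<Union>{U. open U \<and> (AE x in lborel. x \<in> U \<longrightarrow> F x = 0)}"

definition Linf_compact :: "('a::euclidean_space \<Rightarrow> complex) set" where
  "Linf_compact = {F. F \<in> borel_measurable lborel \<and>
     (\<exists>C. AE x in lborel. cmod (F x) \<le> C) \<and> compact (ess_support F)}"


section \<open>Hermite functions\<close>

definition hermite :: "('a::euclidean_space \<Rightarrow> nat) \<Rightarrow> 'a \<Rightarrow> real" where
  "hermite \<alpha> x =
     pi powr (- (real DIM('a) / 4)) * (-1) ^ mi_length \<alpha> *
     (2 ^ mi_length \<alpha> * mi_fact \<alpha>) powr (- (1 / 2)) *
     exp ((norm x)\<^sup>2 / 2) * mi_deriv \<alpha> (\<lambda>y. exp (- (norm y)\<^sup>2)) x"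

definition L2 :: "('a::euclidean_space \<Rightarrow> complex) set" where
  "L2 = {f. f \<in> borel_measurable lborel \<and> integrable lborel (\<lambda>x. (cmod (f x))\<^sup>2)}"

definition hermite_coeff ::
    "('a::euclidean_space \<Rightarrow> complex) \<Rightarrow> ('a \<Rightarrow> nat) \<Rightarrow> complex" where
  "hermite_coeff f \<alpha> = (\<integral>x. f x * cnj (complex_of_real (hermite \<alpha> x)) \<partial>lborel)"

definition H_flat1 :: "('a::euclidean_space \<Rightarrow> complex) set" where
  "H_flat1 = {f \<in> L2. \<exists>r. (\<forall>b\<in>Basis. 0 < r \<bullet> b) \<and>
     (\<exists>C>0. \<forall>\<alpha>. cmod (hermite_coeff f \<alpha>) \<le> C * (mi_power r \<alpha> * mi_fact \<alpha> powr (- (1 / 2))))}"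


section \<open>The adjoint short-time Fourier transform\<close>

definition gaussian :: "'a::euclidean_space \<Rightarrow> complex" where
  "gaussian x = complex_of_real (pi powr (- (real DIM('a) / 4)) * exp (- (norm x)\<^sup>2 / 2))"

text \<open>
  The normalising constant is omitted.  Applied to \<^term>\<open>regular F\<close> this is the integral of
  \<open>F(y,\<eta>) \<phi>(x - y) exp(i\<langle>x,\<eta>\<rangle>)\<close> with respect to \<open>(y,\<eta>)\<close>.
\<close>

definition stft_adjoint ::
    "('a::euclidean_space \<Rightarrow> complex) \<Rightarrow> (('a \<times> 'a \<Rightarrow> complex) \<Rightarrow> complex) \<Rightarrow> 'a \<Rightarrow> complex" where
  "stft_adjoint \<phi> F x = F (\<lambda>(y, \<eta>). \<phi> (x - y) * exp (\<i> * complex_of_real (x \<bullet> \<eta>)))"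


section \<open>Analytic functions of several complex variables\<close>

definition polydisc :: "real ^ 'n::finite \<Rightarrow> (complex ^ 'n) set" where
  "polydisc r = {z. \<forall>j. cmod (z $ j) < r $ j}"

definition cpair :: "real ^ 'n::finite \<Rightarrow> real ^ 'n \<Rightarrow> complex ^ 'n" where
  "cpair x \<xi> = (\<chi> j. complex_of_real (x $ j) + \<i> * complex_of_real (\<xi> $ j))"

text \<open>Analytic in an open neighbourhood of \<open>S\<close>: complex differentiable at each point of it.\<close>

definition analytic_near :: "(complex ^ 'n::finite) set \<Rightarrow> (complex ^ 'n \<Rightarrow> complex) set" where
  "analytic_near S = {F. \<exists>U. open U \<and> S \<subseteq> U \<and>
     (\<forall>z\<in>U. \<exists>L. (F has_derivative L) (at z) \<and> (\<forall>c v. L (c *s v) = c * L v))}"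

end

theory Submission
  imports Defs "HOL-Complex_Analysis.Complex_Analysis" "HOL-Probability.Probability"
begin

text \<open>
  With \<open>z = y + i\<eta>\<close> the kernel \<open>\<phi>(x - y) exp(i\<langle>x,\<eta>\<rangle>)\<close> equals
  \<open>\<Sum>\<^sub>\<alpha> h\<^sub>\<alpha>(x) g\<^sub>\<alpha>(y,\<eta>)\<close> with
  \<open>g\<^sub>\<alpha> = z\<^sup>\<alpha> (2^|\<alpha>| \<alpha>!)^(-1/2) exp(\<langle>z,z\<rangle>/4 - |y|\<^sup>2/2)\<close>, by the generating function of the
  Hermite functions.  Cauchy's estimates show that a Gevrey functional \<open>u\<close> is bounded on restrictions of
  entire functions by a supremum over a bounded complex neighbourhood.  Hence \<open>u\<close> may be applied
  termwise, the transform of \<open>u\<close> has Hermite coefficients \<open>u(g\<^sub>\<alpha>)\<close>, and these decay like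
  \<open>R^|\<alpha>| \<alpha>!^(-1/2)\<close>.

  Conversely, let the coefficients \<open>c\<^sub>\<alpha>\<close> decay in this way.  By completeness of the Hermite functions it
  suffices to find a density with \<open>\<integral> F g\<^sub>\<alpha> = c\<^sub>\<alpha>\<close>.  For \<open>F\<^sub>0(w) = exp(-\<langle>w,w\<rangle>/8) H(w)\<close> the integrand is
  \<open>H(cnj z) z\<^sup>\<alpha> exp(-\<langle>z,z\<rangle>/8) exp(-|z|\<^sup>2/4)\<close> on the polydisc, up to the normalisation.  Since different
  monomials are orthogonal there, the Taylor coefficients of \<open>H\<close> are obtained by undoing the
  multiplication by \<open>exp(-\<langle>z,z\<rangle>/8)\<close>, and \<open>H\<close> converges beyond the polydisc if its radius is large
  compared with \<open>R\<close>.
\<close>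

section \<open>Gevrey functionals on restrictions of entire functions\<close>

text \<open>The constant 1/8 comes from splitting a phase. The prescribed factor exp(-i<y,\<eta>>)
  turns the exponent of g_\<alpha> into -|z|^2/4 - i<y,\<eta>>/2, and the remaining phase equals
  (<w,w> - <z,z>)/8 with w the conjugate of z. Only the part in w can be cancelled, because F_0 is a
  function of w alone; the part in z stays and couples the index \<alpha> to the indices \<alpha> +
  2\<gamma>. The rest of the weight depends on the moduli |z_j| only, which is what makes monomials
  orthogonal on a polydisc. Division by the diagonal moments gains (r/2)^(-2|\<beta>|), which is
  quadratic in 1/r. The Taylor series of H therefore converges up to radius r^2/(4R), and this
  exceeds r as soon as r > 4R. In the other direction the expansion of the kernel has to converge
  for complex y and \<eta> too, with one summable majorant; this is why the generating function is
  proved for arbitrary complex z.\<close>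

text \<open>\<open>smooth\<close> asks for total differentiability, while entire functions are
  handled below one coordinate at a time. The increment is split into steps along the basis vectors,
  and each step is treated by the mean value inequality and the continuity of one partial
  derivative.\<close>

lemma C1_partials_imp_differentiable:
  fixes g :: "'a::euclidean_space \<Rightarrow> 'b::real_normed_vector"
  assumes der: "\<And>x b. b \<in> Basis \<Longrightarrow> ((\<lambda>t. g (x + t *\<^sub>R b)) has_vector_derivative g' b x) (at 0)"
    and cont: "\<And>b. b \<in> Basis \<Longrightarrow> continuous_on UNIV (g' b)"
  shows "g differentiable (at x)"
proof -
  have der': "((\<lambda>t. g (y + t *\<^sub>R b)) has_vector_derivative g' b (y + t *\<^sub>R b)) (at t)"
    if "b \<in> Basis" for y b t
  proof -
    have "((\<lambda>s. g ((y + t *\<^sub>R b) + s *\<^sub>R b)) has_vector_derivative g' b (y + t *\<^sub>R b)) (at (t - t))"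
      using der[OF that] by simp
    moreover have "((\<lambda>s. s - t) has_vector_derivative 1) (at t)"
      by (auto intro!: derivative_eq_intros)
    ultimately have "((\<lambda>s. g ((y + t *\<^sub>R b) + s *\<^sub>R b)) \<circ> (\<lambda>s. s - t) has_vector_derivative 1 *\<^sub>R g' b (y + t *\<^sub>R b)) (at t)"
      using vector_diff_chain_at[where f="\<lambda>s. s - t" and f'=1 and x=t] by blast
    then show ?thesis by (simp add: o_def algebra_simps)
  qed
  \<comment> \<open>Induction on the set \<open>B\<close> of directions in which the increment may
    move; each direction contributes one \<open>e\<close> to the error.\<close>
  have main: "\<exists>\<delta>>0. \<forall>h. norm h < \<delta> \<and> (\<forall>b\<in>Basis - B. h \<bullet> b = 0) \<longrightarrow>
      norm (g (x + h) - g x - (\<Sum>b\<in>B. (h \<bullet> b) *\<^sub>R g' b x)) \<le> real (card B) * e * norm h"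
    if "finite B" "B \<subseteq> Basis" "e > 0" for B e
    using that
  proof (induction B rule: finite_induct)
    case empty
    show ?case by (intro exI[of _ 1]) (auto simp: euclidean_all_zero_iff)
  next
    case (insert c B)
    then have c: "c \<in> Basis" and B: "B \<subseteq> Basis" by auto
    obtain d1 where d1: "d1 > 0" "\<And>h. norm h < d1 \<Longrightarrow> (\<forall>b\<in>Basis - B. h \<bullet> b = 0) \<Longrightarrow>
      norm (g (x + h) - g x - (\<Sum>b\<in>B. (h \<bullet> b) *\<^sub>R g' b x)) \<le> real (card B) * e * norm h"
      using insert by blast
    obtain d2 where d2: "d2 > 0" "\<And>y. dist y x < d2 \<Longrightarrow> dist (g' c y) (g' c x) < e"
      using cont[OF c] \<open>e > 0\<close> unfolding continuous_on_iff by (metis UNIV_I)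
    show ?case
    proof (intro exI[of _ "min d1 d2"] conjI allI impI)
      show "min d1 d2 > 0" using d1 d2 by auto
      fix h :: 'a assume h: "norm h < min d1 d2 \<and> (\<forall>b\<in>Basis - insert c B. h \<bullet> b = 0)"
      define k where "k = h - (h \<bullet> c) *\<^sub>R c"
      have kb: "k \<bullet> b = (if b = c then 0 else h \<bullet> b)" if "b \<in> Basis" for b
        using that c by (auto simp: k_def inner_diff_left inner_Basis)
      have nk: "norm (k + s *\<^sub>R c) \<le> norm h" if "\<bar>s\<bar> \<le> \<bar>h \<bullet> c\<bar>" for s
      proof (rule norm_le_componentwise)
        fix b :: 'a assume b: "b \<in> Basis"
        show "\<bar>(k + s *\<^sub>R c) \<bullet> b\<bar> \<le> \<bar>h \<bullet> b\<bar>"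
          using kb[OF b] b c that by (auto simp: inner_add_left inner_Basis)
      qed
      have kz: "norm k \<le> norm h" using nk[of 0] by simp
      have 1: "norm (g (x + k) - g x - (\<Sum>b\<in>B. (k \<bullet> b) *\<^sub>R g' b x)) \<le> real (card B) * e * norm k"
        using h kz kb by (intro d1(2)) auto
      have sum: "(\<Sum>b\<in>B. (k \<bullet> b) *\<^sub>R g' b x) = (\<Sum>b\<in>B. (h \<bullet> b) *\<^sub>R g' b x)"
        using kb B insert.hyps by (intro sum.cong) (auto simp: subset_iff)
      \<comment> \<open>Subtracting the linear part makes the derivative of \<open>\<phi>\<close>
        smaller than \<open>e\<close> on the whole segment, so the mean value inequality bounds the
        error of this one step.\<close>
      define \<phi> where "\<phi> t = g (x + k + t *\<^sub>R c) - t *\<^sub>R g' c x" for t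
      have "norm (\<phi> (h \<bullet> c) - \<phi> 0) \<le> e * norm (h \<bullet> c - 0)"
      proof (rule differentiable_bound[where S="closed_segment 0 (h \<bullet> c)"
          and f'="\<lambda>t s. s *\<^sub>R (g' c (x + k + t *\<^sub>R c) - g' c x)"])
        fix t assume t: "t \<in> closed_segment 0 (h \<bullet> c)"
        show "(\<phi> has_derivative (\<lambda>s. s *\<^sub>R (g' c (x + k + t *\<^sub>R c) - g' c x))) (at t within closed_segment 0 (h \<bullet> c))"
          unfolding \<phi>_def has_vector_derivative_def[symmetric]
          by (rule has_vector_derivative_at_within) (auto intro!: derivative_eq_intros der' c)
        have "\<bar>t\<bar> \<le> \<bar>h \<bullet> c\<bar>" using t by (auto simp: closed_segment_eq_real_ivl split: if_splits)
        then have "norm (k + t *\<^sub>R c) < d2" using nk[of t] h by simp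
        then have "dist (x + k + t *\<^sub>R c) x < d2" by (simp add: dist_norm add.assoc)
        from d2(2)[OF this] have "norm (g' c (x + k + t *\<^sub>R c) - g' c x) \<le> e"
          by (simp add: dist_norm)
        from mult_right_mono[OF this abs_ge_zero]
        show "onorm (\<lambda>s. s *\<^sub>R (g' c (x + k + t *\<^sub>R c) - g' c x)) \<le> e"
          by (intro onorm_le) (simp only: norm_scaleR real_norm_def mult.commute)
      qed auto
      then have "norm (\<phi> (h \<bullet> c) - \<phi> 0) \<le> e * norm h"
        using mult_left_mono[OF Basis_le_norm[OF c, of h], of e] \<open>e > 0\<close>
        by (simp only: diff_zero real_norm_def) linarith
      moreover have "\<phi> (h \<bullet> c) - \<phi> 0 = g (x + h) - g (x + k) - (h \<bullet> c) *\<^sub>R g' c x"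
        by (simp add: \<phi>_def k_def algebra_simps)
      ultimately have 2: "norm (g (x + h) - g (x + k) - (h \<bullet> c) *\<^sub>R g' c x) \<le> e * norm h" by simp
      have "g (x + h) - g x - (\<Sum>b\<in>insert c B. (h \<bullet> b) *\<^sub>R g' b x) =
         (g (x + h) - g (x + k) - (h \<bullet> c) *\<^sub>R g' c x) +
         (g (x + k) - g x - (\<Sum>b\<in>B. (k \<bullet> b) *\<^sub>R g' b x))"
        using insert.hyps sum by (simp add: algebra_simps)
      also have "norm \<dots> \<le> e * norm h + real (card B) * e * norm k"
        by (intro norm_triangle_mono 1 2)
      also have "\<dots> \<le> e * norm h + real (card B) * e * norm h"
        using kz \<open>e > 0\<close> by (intro add_left_mono mult_left_mono) auto
      finally show "norm (g (x + h) - g x - (\<Sum>b\<in>insert c B. (h \<bullet> b) *\<^sub>R g' b x))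
          \<le> real (card (insert c B)) * e * norm h"
        using insert.hyps by (simp add: algebra_simps)
    qed
  qed
  have "(g has_derivative (\<lambda>h. \<Sum>b\<in>Basis. (h \<bullet> b) *\<^sub>R g' b x)) (at x)"
    unfolding has_derivative_at_alt
  proof (intro conjI allI impI)
    show "bounded_linear (\<lambda>h. \<Sum>b\<in>Basis. (h \<bullet> b) *\<^sub>R g' b x)"
      by (intro bounded_linear_intros)
    fix e :: real assume e: "e > 0"
    then have e': "e / real (DIM('a)) > 0" by simp
    from main[OF finite_Basis subset_refl this] obtain \<delta> where \<delta>: "\<delta> > 0"
      "\<And>h. norm h < \<delta> \<Longrightarrow> norm (g (x + h) - g x - (\<Sum>b\<in>Basis. (h \<bullet> b) *\<^sub>R g' b x))
         \<le> real DIM('a) * (e / real (DIM('a))) * norm h" by auto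
    show "\<exists>d>0. \<forall>y. norm (y - x) < d \<longrightarrow>
        norm (g y - g x - (\<Sum>b\<in>Basis. ((y - x) \<bullet> b) *\<^sub>R g' b x)) \<le> e * norm (y - x)"
      using \<delta>(1) \<delta>(2)[of "y - x" for y] by (intro exI[of _ \<delta>]) auto
  qed
  then show ?thesis unfolding differentiable_def by blast
qed

section \<open>Entire functions of several complex variables\<close>

text \<open>
  The complexification of \<open>'a\<close> is encoded as \<open>'a \<times> 'a\<close>, real parts first;
  \<open>cshift p w b\<close> is \<open>p + w b\<close>.
\<close>

definition cshift :: "'a::euclidean_space \<times> 'a \<Rightarrow> complex \<Rightarrow> 'a \<Rightarrow> 'a \<times> 'a" where
  "cshift p w b = p + (Re w *\<^sub>R b, Im w *\<^sub>R b)"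

text \<open>By Osgood's lemma these are exactly the entire functions on the complexification, one
  complex variable for each basis vector. Both clauses can be checked directly for explicit
  functions and survive sums, products and exponentials.\<close>

definition sep_entire :: "('a::euclidean_space \<times> 'a \<Rightarrow> complex) \<Rightarrow> bool" where
  "sep_entire G \<longleftrightarrow> continuous_on UNIV G \<and>
     (\<forall>p. \<forall>b\<in>Basis. (\<lambda>w. G (cshift p w b)) holomorphic_on UNIV)"

definition cpartial :: "'a::euclidean_space \<Rightarrow> ('a \<times> 'a \<Rightarrow> complex) \<Rightarrow> 'a \<times> 'a \<Rightarrow> complex" where
  "cpartial b G p = deriv (\<lambda>w. G (cshift p w b)) 0"

lemma cshift_0 [simp]: "cshift p 0 b = p"
  by (simp add: cshift_def zero_prod_def[symmetric])

lemma cshift_cshift: "cshift (cshift p v b) w b = cshift p (v + w) b"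
  by (simp add: cshift_def algebra_simps)

lemma continuous_on_cshift [continuous_intros]:
  "continuous_on S f \<Longrightarrow> continuous_on S g \<Longrightarrow> continuous_on S (\<lambda>x. cshift (f x) (g x) b)"
  unfolding cshift_def by (intro continuous_intros)

lemma has_field_derivative_cshift:
  assumes "sep_entire G" "b \<in> Basis"
  shows "((\<lambda>w. G (cshift p w b)) has_field_derivative cpartial b G (cshift p w b)) (at w)"
proof -
  have "(\<lambda>v. G (cshift (cshift p w b) v b)) holomorphic_on UNIV"
    using assms unfolding sep_entire_def by blast
  then have "((\<lambda>v. G (cshift (cshift p w b) v b)) has_field_derivative cpartial b G (cshift p w b)) (at 0)"
    unfolding cpartial_def by (rule holomorphic_derivI) auto
  then have "((\<lambda>v. G (cshift p (v + w) b)) has_field_derivative cpartial b G (cshift p w b)) (at 0)"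
    by (simp add: cshift_cshift add.commute)
  then show ?thesis using DERIV_shift[of "\<lambda>v. G (cshift p v b)" _ 0 w] by simp
qed

text \<open>Cauchy's formula on the unit circle. The velocity of the path cancels the prefactor and
  one power of the denominator. What remains is a parameter integral over a fixed compact interval
  that involves \<open>G\<close> but none of its derivatives, so continuity and holomorphy in
  \<open>p\<close> can be read off.\<close>

lemma cpartial_integral:
  assumes "sep_entire G" "b \<in> Basis"
  shows "cpartial b G p = integral (cbox 0 1)
           (\<lambda>t. G (cshift p (circlepath 0 1 t) b) / circlepath 0 1 t)"
proof -
  let ?f = "\<lambda>w. G (cshift p w b)"
  have hol: "?f holomorphic_on UNIV" using assms unfolding sep_entire_def by blast
  have "(?f has_field_derivative (1/(2 * of_real pi * \<i>) *
          contour_integral (circlepath 0 1) (\<lambda>u. ?f u / (u - 0)^2))) (at 0)"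
    by (rule Cauchy_derivative_integral_circlepath(2))
      (auto intro!: holomorphic_on_imp_continuous_on holomorphic_on_subset[OF hol])
  then have "cpartial b G p = 1/(2 * of_real pi * \<i>) *
          contour_integral (circlepath 0 1) (\<lambda>u. ?f u / u^2)"
    unfolding cpartial_def by (simp add: DERIV_imp_deriv)
  also have "contour_integral (circlepath 0 1) (\<lambda>u. ?f u / u^2) =
     integral {0..1} (\<lambda>t. (2 * of_real pi * \<i>) * (?f (circlepath 0 1 t) / circlepath 0 1 t))"
    unfolding contour_integral_integral vector_derivative_circlepath
    by (intro integral_cong) (simp add: circlepath power2_eq_square field_simps)
  also have "\<dots> = (2 * of_real pi * \<i>) * integral {0..1} (\<lambda>t. ?f (circlepath 0 1 t) / circlepath 0 1 t)"
    by (rule integral_mult_right)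
  finally show ?thesis by (simp add: box_real)
qed

lemma circlepath_nz: "circlepath 0 1 t \<noteq> 0"
  by (simp add: circlepath)

lemma continuous_on_circlepath [continuous_intros]:
  "continuous_on S f \<Longrightarrow> continuous_on S (\<lambda>x. circlepath 0 1 (f x))"
  unfolding circlepath by (intro continuous_intros)

lemma continuous_on_sep_entire:
  assumes "sep_entire G" and "continuous_on S f"
  shows "continuous_on S (\<lambda>x. G (f x))"
  using assms unfolding sep_entire_def by (auto intro: continuous_on_compose2)

lemma continuous_cpartial:
  assumes "sep_entire G" "b \<in> Basis"
  shows "continuous_on UNIV (cpartial b G)"
proof -
  have "continuous_on UNIV (\<lambda>p. integral (cbox 0 1)
           (\<lambda>t. G (cshift p (circlepath 0 1 t) b) / circlepath 0 1 t))"
    by (rule integral_continuous_on_param)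
      (simp add: split_beta circlepath_nz, intro continuous_intros continuous_on_sep_entire[OF assms(1)], auto simp: circlepath_nz)
  then show ?thesis using cpartial_integral[OF assms] by presburger
qed

text \<open>
  By Cauchy's integral formula joint continuity passes to the partial derivatives, so that no
  theory of holomorphic functions of several variables is needed.
\<close>

lemma sep_entire_cpartial:
  assumes G: "sep_entire G" and b: "b \<in> Basis"
  shows "sep_entire (cpartial b G)"
  unfolding sep_entire_def
proof (intro conjI allI ballI)
  show "continuous_on UNIV (cpartial b G)" by (rule continuous_cpartial[OF assms])
  fix p and c :: 'a assume c: "c \<in> Basis"
  \<comment> \<open>Differentiation under the integral happens along \<open>c\<close>, so the shift
    along \<open>c\<close> has to be brought to the outside of the shift along the circle.\<close>
  have comm: "cshift (cshift p v c) w b = cshift (cshift p w b) v c" for v w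
    by (simp add: cshift_def algebra_simps)
  have "(\<lambda>v. integral (cbox 0 1) (\<lambda>t. G (cshift (cshift p v c) (circlepath 0 1 t) b) / circlepath 0 1 t))
     holomorphic_on UNIV"
  proof (rule leibniz_rule_holomorphic)
    fix v and t :: real
    show "((\<lambda>v. G (cshift (cshift p v c) (circlepath 0 1 t) b) / circlepath 0 1 t) has_field_derivative
       cpartial c G (cshift (cshift p (circlepath 0 1 t) b) v c) / circlepath 0 1 t) (at v within UNIV)"
      unfolding comm by (intro DERIV_cdivide has_field_derivative_cshift[OF G c])
  next
    fix v
    show "(\<lambda>t. G (cshift (cshift p v c) (circlepath 0 1 t) b) / circlepath 0 1 t) integrable_on cbox 0 1"
      by (intro integrable_continuous continuous_intros continuous_on_sep_entire[OF G]) (auto simp: circlepath_nz)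
  next
    show "continuous_on (UNIV \<times> cbox 0 1)
     (\<lambda>(v, t). cpartial c G (cshift (cshift p (circlepath 0 1 t) b) v c) / circlepath 0 1 t)"
      unfolding split_beta
      by (intro continuous_intros continuous_on_compose2[OF continuous_cpartial[OF G c]])
        (auto simp: circlepath_nz)
  qed auto
  then show "(\<lambda>v. cpartial b G (cshift p v c)) holomorphic_on UNIV"
    using cpartial_integral[OF assms] by presburger
qed

lemma sep_entire_cpartials:
  "sep_entire G \<Longrightarrow> set bs \<subseteq> Basis \<Longrightarrow> sep_entire (foldr cpartial bs G)"
  by (induction bs) (auto intro: sep_entire_cpartial)

lemma has_vector_derivative_sep_entire:
  assumes "sep_entire G" "b \<in> Basis"
  shows "((\<lambda>t. G (x + t *\<^sub>R b, 0)) has_vector_derivative cpartial b G (x, 0)) (at 0)"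
proof -
  have "((\<lambda>w. G (cshift (x, 0) w b)) has_field_derivative cpartial b G (x,0)) (at (of_real 0))"
    using has_field_derivative_cshift[OF assms, of "(x,0)" 0] by simp
  from has_vector_derivative_real_field[OF this]
  have "((\<lambda>t. G (cshift (x, 0) (of_real t) b)) has_vector_derivative cpartial b G (x,0)) (at 0)"
    by simp
  then show ?thesis by (simp add: cshift_def)
qed

lemma iter_partial_sep_entire:
  assumes "sep_entire G"
  shows "set bs \<subseteq> Basis \<Longrightarrow> iter_partial bs (\<lambda>x. G (x, 0)) = (\<lambda>x. foldr cpartial bs G (x, 0))"
proof (induction bs)
  case (Cons b bs)
  show ?case
    using Cons has_vector_derivative_sep_entire[OF sep_entire_cpartials[OF assms, of bs], of b]
    by (auto intro: vector_derivative_at)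
qed simp

lemma smooth_sep_entire:
  assumes "sep_entire G"
  shows "smooth (\<lambda>x. G (x, 0))"
  unfolding smooth_def differentiable_on_def
proof (intro allI impI ballI)
  fix bs x assume bs: "set bs \<subseteq> (Basis :: 'a set)"
  have "iter_partial bs (\<lambda>x. G (x, 0)) differentiable at x"
    unfolding iter_partial_sep_entire[OF assms bs]
    by (rule C1_partials_imp_differentiable[where g' = "\<lambda>b x. cpartial b (foldr cpartial bs G) (x, 0)"])
      (use bs in \<open>auto intro!: has_vector_derivative_sep_entire sep_entire_cpartials assms
        continuous_on_sep_entire[OF sep_entire_cpartial] continuous_on_Pair continuous_on_id continuous_on_const\<close>)
  then show "iter_partial bs (\<lambda>x. G (x, 0)) differentiable at x within UNIV" by simp
qed

section \<open>Cauchy estimates and Gevrey norms\<close>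

text \<open>Every differentiation uses one circle of radius \<open>\<delta> b\<close>, centred at a
  point reached by the previous circles. Hence the radii of repeated differentiations in the same
  direction add up, and the bound on \<open>G\<close> is required on a polydisc of radii count times
  \<open>\<delta> b\<close>. The \<open>Complex\<close> term is the complex coordinate of
  \<open>q - p\<close> along \<open>b\<close>.\<close>

lemma Cauchy_estimate_cpartials:
  assumes G: "sep_entire G" and \<delta>: "\<And>b. b \<in> Basis \<Longrightarrow> \<delta> b > 0"
    and bs: "set bs \<subseteq> Basis"
    and bound: "\<And>q. (\<forall>b\<in>Basis. cmod (Complex ((fst q - fst p) \<bullet> b) ((snd q - snd p) \<bullet> b)) \<le>
       real (count_list bs b) * \<delta> b) \<Longrightarrow> cmod (G q) \<le> S"
  shows "cmod (foldr cpartial bs G p) \<le> S / (\<Prod>b\<in>Basis. \<delta> b ^ count_list bs b)"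
  using bs bound
proof (induction bs arbitrary: p)
  case Nil
  show ?case using Nil(2)[of p] by (simp add: Complex_eq)
next
  case (Cons c bs)
  let ?D = "foldr cpartial bs G"
  let ?P = "\<Prod>b\<in>Basis. \<delta> b ^ count_list bs b"
  have c: "c \<in> Basis" and bs: "set bs \<subseteq> Basis" using Cons.prems by auto
  have D: "sep_entire ?D" by (rule sep_entire_cpartials[OF G bs])
  then have hol: "(\<lambda>w. ?D (cshift p w c)) holomorphic_on UNIV"
    using c unfolding sep_entire_def by blast
  have "norm ((deriv ^^ 1) (\<lambda>w. ?D (cshift p w c)) 0) \<le> fact 1 * (S / ?P) / \<delta> c ^ 1"
  proof (rule Cauchy_inequality)
    fix w :: complex assume w: "norm (0 - w) = \<delta> c"
    show "cmod (?D (cshift p w c)) \<le> S / ?P"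
    proof (rule Cons.IH[OF bs], rule Cons.prems(2), intro ballI)
      fix q and b :: 'a
      assume q: "\<forall>b\<in>Basis. cmod (Complex ((fst q - fst (cshift p w c)) \<bullet> b) ((snd q - snd (cshift p w c)) \<bullet> b)) \<le>
       real (count_list bs b) * \<delta> b" and b: "b \<in> Basis"
      have "Complex ((fst q - fst p) \<bullet> b) ((snd q - snd p) \<bullet> b) =
        Complex ((fst q - fst (cshift p w c)) \<bullet> b) ((snd q - snd (cshift p w c)) \<bullet> b) + (if b = c then w else 0)"
        using b c by (auto simp: cshift_def complex_eq_iff inner_diff_left inner_add_left inner_Basis)
      then have "cmod (Complex ((fst q - fst p) \<bullet> b) ((snd q - snd p) \<bullet> b)) \<le>
        real (count_list bs b) * \<delta> b + (if b = c then \<delta> c else 0)"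
        using q b w by (auto intro!: norm_triangle_mono)
      then show "cmod (Complex ((fst q - fst p) \<bullet> b) ((snd q - snd p) \<bullet> b)) \<le>
        real (count_list (c # bs) b) * \<delta> b" by (auto simp: algebra_simps split: if_splits)
    qed
  qed (use \<delta>[OF c] in \<open>auto intro!: holomorphic_on_imp_continuous_on holomorphic_on_subset[OF hol]\<close>)
  then have "cmod (cpartial c ?D p) \<le> S / (\<delta> c * ?P)"
    by (simp add: cpartial_def field_simps)
  also have "\<delta> c * ?P = (\<Prod>b\<in>Basis. \<delta> b ^ count_list (c # bs) b)"
  proof -
    have "(\<Prod>b\<in>Basis - {c}. \<delta> b ^ count_list (c # bs) b) = (\<Prod>b\<in>Basis - {c}. \<delta> b ^ count_list bs b)"
      by (intro prod.cong) auto
    then show ?thesis by (simp add: prod.remove[OF finite_Basis c] mult.assoc)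
  qed
  finally show ?case by simp
qed

text \<open>n^n / n! is a single term of the series of exp n, and e \<le> 3. The 3 reappears as the
  radius of the complex neighbourhood.\<close>

lemma power_self_le: "real n ^ n \<le> 3 ^ n * fact n"
proof -
  have "real n ^ n / fact n \<le> exp (real n)"
    using exp_ge_zero sum_le_suminf[OF summable_exp[of "real n"], of "{n}"]
    by (simp add: exp_def divide_inverse scaleR_conv_of_real mult.commute)
  also have "\<dots> = exp 1 ^ n" by (simp add: exp_of_nat_mult[symmetric])
  also have "\<dots> \<le> 3 ^ n" using exp_le by (intro power_mono) auto
  finally show ?thesis by (simp add: field_simps)
qed

text \<open>Shows that the choice made in \<open>mi_deriv\<close> has a candidate, so that
  \<open>mi_deriv\<close> may be replaced by an iterated derivative along an actual list.\<close>

lemma ex_list_counts: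
  fixes \<alpha> :: "'a \<Rightarrow> nat"
  assumes "finite B"
  shows "\<exists>bs. set bs \<subseteq> B \<and> (\<forall>b\<in>B. count_list bs b = \<alpha> b)"
  using assms
proof (induction rule: finite_induct)
  case (insert c B)
  then obtain bs where bs: "set bs \<subseteq> B" "\<forall>b\<in>B. count_list bs b = \<alpha> b" by blast
  have r: "count_list (replicate k c) b = (if b = c then k else 0)" for k b
    by (induction k) auto
  have "count_list bs c = 0" using bs insert.hyps by (auto simp: count_list_0_iff)
  then show ?case using bs insert.hyps
    by (intro exI[of _ "replicate (\<alpha> c) c @ bs"]) (auto simp: r)
qed auto

lemma mi_deriv_eqE:
  fixes \<alpha> :: "'a::euclidean_space \<Rightarrow> nat"
  obtains bs where "set bs \<subseteq> Basis" "\<And>b. b \<in> Basis \<Longrightarrow> count_list bs b = \<alpha> b"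
    "\<And>g. mi_deriv \<alpha> g = (iter_partial bs g :: 'a \<Rightarrow> 'b::real_normed_vector)"
  using someI_ex[OF ex_list_counts[OF finite_Basis, of \<alpha>]] that unfolding mi_deriv_def by blast

lemma mi_fact_ge_1: "mi_fact \<alpha> \<ge> 1"
  unfolding mi_fact_def by (intro prod_ge_1) (auto simp: fact_ge_1)

text \<open>
  Differentiating \<open>n\<close> times in one direction with radius \<open>3/n\<close> each time costs a factor
  \<open>(n/3)^n \<le> n!\<close>, independently of the order of the differentiations.
\<close>

lemma mi_deriv_sep_entire_bound:
  assumes G: "sep_entire G"
    and bound: "\<And>q. (\<forall>b\<in>Basis. cmod (Complex ((fst q - x) \<bullet> b) (snd q \<bullet> b)) \<le> 3) \<Longrightarrow> cmod (G q) \<le> S"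
  shows "cmod (mi_deriv \<alpha> (\<lambda>x. G (x, 0)) x) \<le> S * mi_fact \<alpha>"
proof -
  obtain bs where bs: "set bs \<subseteq> (Basis :: 'a set)" "\<And>b. b \<in> Basis \<Longrightarrow> count_list bs b = \<alpha> b"
    and eq: "\<And>g. mi_deriv \<alpha> g = (iter_partial bs g :: 'a \<Rightarrow> complex)"
    by (rule mi_deriv_eqE[of \<alpha>]) blast
  \<comment> \<open>The value 1 serves directions that are not differentiated: it keeps the radius
    positive, and its power 0 contributes nothing.\<close>
  define \<delta> where "\<delta> b = (if \<alpha> b = 0 then 1 else 3 / real (\<alpha> b))" for b
  have S: "S \<ge> 0" using order_trans[OF norm_ge_zero bound[of "(x, 0)"]] by (simp add: Complex_eq)
  have "cmod (foldr cpartial bs G (x, 0)) \<le> S / (\<Prod>b\<in>Basis. \<delta> b ^ count_list bs b)"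
    by (rule Cauchy_estimate_cpartials[OF G _ bs(1)], simp add: \<delta>_def)
      (rule bound, auto simp: bs(2) \<delta>_def split: if_splits)
  also have "\<dots> = S * (\<Prod>b\<in>Basis. 1 / \<delta> b ^ \<alpha> b)"
    using bs(2) by (simp add: prod_dividef cong: prod.cong)
  also have "\<dots> \<le> S * (\<Prod>b\<in>Basis. fact (\<alpha> b))"
  proof (intro mult_left_mono[OF _ S] prod_mono conjI)
    fix b :: 'a
    show "0 \<le> 1 / \<delta> b ^ \<alpha> b" by (simp add: \<delta>_def)
    show "1 / \<delta> b ^ \<alpha> b \<le> fact (\<alpha> b)"
      using power_self_le[of "\<alpha> b"] by (auto simp: \<delta>_def field_simps)
  qed
  finally show ?thesis
    unfolding eq iter_partial_sep_entire[OF G bs(1)] mi_fact_def .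
qed

text \<open>Cauchy's estimates give \<alpha>! without a geometric factor, and s \<ge> 1 makes
  \<alpha>!^s at least as large. So the single value h = 1 works for all entire functions at
  once.\<close>

lemma gevrey_norm_sep_entire:
  fixes G :: "'a::euclidean_space \<times> 'a \<Rightarrow> complex"
  assumes G: "sep_entire G" and s: "s \<ge> 1"
    and bound: "\<And>q. (\<exists>x\<in>K. \<forall>b\<in>Basis. cmod (Complex ((fst q - x) \<bullet> b) (snd q \<bullet> b)) \<le> 3) \<Longrightarrow> cmod (G q) \<le> S"
  shows "gevrey_norm s 1 K (\<lambda>x. G (x, 0)) \<le> ennreal S"
  unfolding gevrey_norm_def
proof (intro SUP_least ennreal_leI)
  fix x and \<alpha> :: "'a \<Rightarrow> nat" assume x: "x \<in> K"
  have "S \<ge> 0" using x order_trans[OF norm_ge_zero bound[of "(x, 0)"]] by (force simp: Complex_eq)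
  have "mi_fact \<alpha> powr 1 \<le> mi_fact \<alpha> powr s"
    using s mi_fact_ge_1[of \<alpha>] by (intro powr_mono) auto
  then have *: "mi_fact \<alpha> \<le> mi_fact \<alpha> powr s" "mi_fact \<alpha> > 0" using mi_fact_ge_1[of \<alpha>] by auto
  have "cmod (mi_deriv \<alpha> (\<lambda>x. G (x, 0)) x) \<le> S * mi_fact \<alpha>"
    using bound x by (intro mi_deriv_sep_entire_bound[OF G]) blast
  also have "\<dots> \<le> S * mi_fact \<alpha> powr s"
    using * \<open>S \<ge> 0\<close> by (intro mult_left_mono) auto
  finally show "cmod (mi_deriv \<alpha> (\<lambda>x. G (x, 0)) x) / (1 ^ mi_length \<alpha> * mi_fact \<alpha> powr s) \<le> S"
    using * by (simp add: field_simps)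
qed

text \<open>Trades the polydiscs of radius 3 around the points of \<open>K\<close> for one product
  of balls in the real and imaginary parts, on which explicit functions are easily
  estimated.\<close>

lemma polydisc_neighbourhood_bounded:
  fixes K :: "'a::euclidean_space set"
  assumes "compact K"
  obtains M where "M > 0" "\<And>q x. x \<in> K \<Longrightarrow> \<forall>b\<in>Basis. cmod (Complex ((fst q - x) \<bullet> b) (snd q \<bullet> b)) \<le> 3 \<Longrightarrow>
     norm (fst q) \<le> M \<and> norm (snd q) \<le> M"
proof -
  obtain B where B: "B > 0" "\<And>x. x \<in> K \<Longrightarrow> norm x \<le> B"
    using compact_imp_bounded[OF assms] bounded_pos by metis
  have le: "norm y \<le> 3 * real DIM('a)" if "\<And>b. b \<in> Basis \<Longrightarrow> \<bar>y \<bullet> b\<bar> \<le> 3" for y :: 'a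
    using norm_le_l1[of y] sum_mono[of Basis "\<lambda>b. \<bar>y \<bullet> b\<bar>" "\<lambda>_. 3"] that by simp
  show ?thesis
  proof (rule that[of "B + 3 * real DIM('a)"])
    fix q :: "'a \<times> 'a" and x assume x: "x \<in> K" and q: "\<forall>b\<in>Basis. cmod (Complex ((fst q - x) \<bullet> b) (snd q \<bullet> b)) \<le> 3"
    have "\<bar>(fst q - x) \<bullet> b\<bar> \<le> 3" "\<bar>snd q \<bullet> b\<bar> \<le> 3" if "b \<in> Basis" for b
      using bspec[OF q that] abs_Re_le_cmod[of "Complex ((fst q - x) \<bullet> b) (snd q \<bullet> b)"]
        abs_Im_le_cmod[of "Complex ((fst q - x) \<bullet> b) (snd q \<bullet> b)"] by simp_all
    then have "norm (fst q - x) \<le> 3 * real DIM('a)" "norm (snd q) \<le> 3 * real DIM('a)"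
      by (intro le; blast)+
    moreover have "norm (fst q) \<le> norm (fst q - x) + norm x"
      by (metis diff_add_cancel norm_triangle_ineq)
    ultimately show "norm (fst q) \<le> B + 3 * real DIM('a) \<and> norm (snd q) \<le> B + 3 * real DIM('a)"
      using B(1) B(2)[OF x] by linarith
  qed (use B in simp)
qed

lemma gevrey_sep_entire:
  fixes G :: "'a::euclidean_space \<times> 'a \<Rightarrow> complex"
  assumes "sep_entire G" and "s \<ge> 1"
  shows "(\<lambda>x. G (x, 0)) \<in> gevrey s"
  unfolding gevrey_def
proof (intro CollectI conjI allI impI smooth_sep_entire assms)
  fix K :: "'a set" assume "compact K"
  then obtain M where M: "M > 0" "\<And>q x. x \<in> K \<Longrightarrow> \<forall>b\<in>Basis. cmod (Complex ((fst q - x) \<bullet> b) (snd q \<bullet> b)) \<le> 3 \<Longrightarrow>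
     norm (fst q) \<le> M \<and> norm (snd q) \<le> M" by (rule polydisc_neighbourhood_bounded) blast
  have "compact (G ` (cball 0 M \<times> cball 0 M))"
    by (intro compact_continuous_image continuous_on_sep_entire[where f="\<lambda>x. x"] continuous_on_id assms compact_Times) auto
  then obtain S where S: "\<And>q. q \<in> cball 0 M \<times> cball 0 M \<Longrightarrow> cmod (G q) \<le> S"
    using compact_imp_bounded bounded_iff by (metis image_eqI)
  have "gevrey_norm s 1 K (\<lambda>x. G (x, 0)) \<le> ennreal S"
    using M(2) S by (intro gevrey_norm_sep_entire assms) (force simp: mem_Times_iff)
  then have "gevrey_norm s 1 K (\<lambda>x. G (x, 0)) < \<infinity>"
    using ennreal_less_top le_less_trans by force
  then show "\<exists>h>0. gevrey_norm s h K (\<lambda>x. G (x, 0)) < \<infinity>"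
    by (intro exI[of _ 1]) simp
qed

text \<open>The form in which the continuity of \<open>u\<close> is used: no derivatives and no
  Gevrey norm remain, and estimates for \<open>u\<close> become estimates for explicit entire
  functions on a bounded set.\<close>

lemma gevrey_dual_bound_sep_entire:
  fixes u :: "('a::euclidean_space \<Rightarrow> complex) \<Rightarrow> complex"
  assumes "u \<in> gevrey_dual s" and s: "s \<ge> 1"
  obtains M C where "M > 0" "C > 0"
    "\<And>G S. sep_entire G \<Longrightarrow> S \<ge> 0 \<Longrightarrow> (\<And>p. norm (fst p) \<le> M \<Longrightarrow> norm (snd p) \<le> M \<Longrightarrow> cmod (G p) \<le> S) \<Longrightarrow>
       cmod (u (\<lambda>x. G (x, 0))) \<le> C * S"
proof -
  obtain K where "compact K" and K: "\<forall>h>0. \<exists>C>0. \<forall>g\<in>gevrey s.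
        ennreal (cmod (u g)) \<le> ennreal C * gevrey_norm s h K g"
    using assms unfolding gevrey_dual_def by blast
  then obtain M where M: "M > 0" "\<And>q x. x \<in> K \<Longrightarrow> \<forall>b\<in>Basis. cmod (Complex ((fst q - x) \<bullet> b) (snd q \<bullet> b)) \<le> 3 \<Longrightarrow>
     norm (fst q) \<le> M \<and> norm (snd q) \<le> M" using polydisc_neighbourhood_bounded by metis
  obtain C where C: "C > 0" "\<And>g. g \<in> gevrey s \<Longrightarrow> ennreal (cmod (u g)) \<le> ennreal C * gevrey_norm s 1 K g"
    using K zero_less_one by blast
  show ?thesis
  proof (rule that[OF M(1) C(1)])
    fix G :: "'a \<times> 'a \<Rightarrow> complex" and S
    assume G: "sep_entire G" "S \<ge> 0"
      and bd: "\<And>p. norm (fst p) \<le> M \<Longrightarrow> norm (snd p) \<le> M \<Longrightarrow> cmod (G p) \<le> S"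
    have "gevrey_norm s 1 K (\<lambda>x. G (x, 0)) \<le> ennreal S"
      using M(2) bd by (intro gevrey_norm_sep_entire s G) blast
    then have "ennreal (cmod (u (\<lambda>x. G (x, 0)))) \<le> ennreal C * ennreal S"
      using C(2)[OF gevrey_sep_entire[OF G(1) s]] by (meson mult_left_mono order_trans zero_le)
    then show "cmod (u (\<lambda>x. G (x, 0))) \<le> C * S"
      using C(1) G(2) by (simp add: ennreal_mult[symmetric])
  qed
qed

lemma sep_entireI:
  assumes "continuous_on UNIV G"
    "\<And>p b. b \<in> Basis \<Longrightarrow> (\<lambda>w. G (cshift p w b)) holomorphic_on UNIV"
  shows "sep_entire G"
  using assms unfolding sep_entire_def by blast

section \<open>Hermite functions\<close>

text \<open>Multi-indices are all functions from a finite type to nat, that is, a full product set;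
  a product of absolutely convergent series expands over it. Questions about multi-index series
  thereby reduce to one variable.\<close>

lemma has_sum_prod_multi:
  fixes f :: "'n::finite \<Rightarrow> nat \<Rightarrow> complex"
  assumes "\<And>j. (\<lambda>n. norm (f j n)) summable_on UNIV"
  shows "(\<lambda>\<alpha>. norm (\<Prod>j\<in>UNIV. f j (\<alpha> j))) summable_on (UNIV :: ('n \<Rightarrow> nat) set)"
    "((\<lambda>\<alpha>. \<Prod>j\<in>UNIV. f j (\<alpha> j)) has_sum (\<Prod>j\<in>UNIV. infsum (f j) UNIV)) (UNIV :: ('n \<Rightarrow> nat) set)"
proof -
  have U: "PiE (UNIV :: 'n set) (\<lambda>_. UNIV :: nat set) = UNIV"
    by (simp add: PiE_UNIV_domain)
  show 1: "(\<lambda>\<alpha>. norm (\<Prod>j\<in>UNIV. f j (\<alpha> j))) summable_on (UNIV :: ('n \<Rightarrow> nat) set)"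
    using abs_summable_on_prod_PiE[of UNIV "\<lambda>_. UNIV" f] assms
    unfolding abs_summable_equivalent[symmetric] U by simp
  have "infsum (\<lambda>\<alpha>. \<Prod>j\<in>UNIV. f j (\<alpha> j)) (UNIV :: ('n \<Rightarrow> nat) set) = (\<Prod>j\<in>UNIV. infsum (f j) UNIV)"
    using infsum_prod_PiE_abs[of UNIV f "\<lambda>_. UNIV"] assms by (simp add: U)
  then show "((\<lambda>\<alpha>. \<Prod>j\<in>UNIV. f j (\<alpha> j)) has_sum (\<Prod>j\<in>UNIV. infsum (f j) UNIV)) (UNIV :: ('n \<Rightarrow> nat) set)"
    using abs_summable_summable[OF 1] by (metis has_sum_infsum)
qed

lemma prod_Basis_vec: "(\<Prod>b\<in>(Basis :: (real ^ 'n::finite) set). F b) = (\<Prod>j\<in>UNIV. F (axis j 1))"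
proof -
  have B: "(Basis :: (real ^ 'n) set) = (\<lambda>j. axis j 1) ` UNIV"
    by (auto simp: Basis_vec_def)
  have "inj (\<lambda>j. axis j (1::real) :: real ^ 'n)"
    by (auto simp: inj_on_def axis_eq_axis)
  then show ?thesis unfolding B by (subst prod.reindex) (auto simp: o_def)
qed

text \<open>Lebesgue measure is the image of a product measure indexed by basis vectors, whereas the
  integrand is indexed by coordinates; \<open>\<iota>\<close> translates a basis vector back into
  its coordinate.\<close>

lemma integral_prod_vec:
  fixes f :: "'n::finite \<Rightarrow> real \<Rightarrow> 'b::{real_normed_field, banach, second_countable_topology}"
  assumes int: "\<And>j. integrable lborel (f j)"
  shows "integrable lborel (\<lambda>x :: real ^ 'n. \<Prod>j\<in>UNIV. f j (x $ j))"
    "integral\<^sup>L lborel (\<lambda>x :: real ^ 'n. \<Prod>j\<in>UNIV. f j (x $ j)) = (\<Prod>j\<in>UNIV. integral\<^sup>L lborel (f j))"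
proof -
  define \<iota> where "\<iota> = inv (\<lambda>j. axis j 1 :: real ^ 'n)"
  have inj: "inj (\<lambda>j. axis j (1::real) :: real ^ 'n)"
    by (auto simp: inj_on_def axis_eq_axis)
  have \<iota>: "\<iota> (axis j 1) = j" for j
    unfolding \<iota>_def by (rule inv_f_f[OF inj])
  define g where "g b = f (\<iota> b)" for b
  interpret product_sigma_finite "\<lambda>_ :: real ^ 'n. lborel :: real measure" by standard
  have eq: "(\<Prod>j\<in>UNIV. f j (x $ j)) = (\<Prod>b\<in>Basis. g b (x \<bullet> b))" for x :: "real ^ 'n"
    by (simp add: prod_Basis_vec g_def \<iota> inner_axis)
  have m: "(\<lambda>x. \<Sum>b\<in>Basis. x b *\<^sub>R b) \<in> measurable (\<Pi>\<^sub>M b\<in>(Basis::(real ^ 'n) set). (lborel :: real measure)) borel"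
    by measurable
  have [measurable]: "f j \<in> borel_measurable borel" for j using int[of j] by (simp add: borel_measurable_integrable)
  have mg: "(\<lambda>x. \<Prod>b\<in>Basis. g b (x \<bullet> b)) \<in> borel_measurable (borel :: (real ^ 'n) measure)"
    unfolding g_def by measurable
  have eq2: "(\<Prod>b\<in>Basis. g b ((\<Sum>b\<in>Basis. x b *\<^sub>R b) \<bullet> b)) = (\<Prod>b\<in>Basis. g b (x b))"
    for x :: "real ^ 'n \<Rightarrow> real"
    by (intro prod.cong) auto
  have int': "integrable (\<Pi>\<^sub>M b\<in>(Basis::(real ^ 'n) set). lborel) (\<lambda>x. \<Prod>b\<in>Basis. g b (x b))"
    by (rule product_integrable_prod) (auto simp: g_def int)
  show "integrable lborel (\<lambda>x :: real ^ 'n. \<Prod>j\<in>UNIV. f j (x $ j))"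
    unfolding eq lborel_eq[where 'a="real ^ 'n"] using int'
    by (subst integrable_distr_eq[OF m mg]) (simp add: eq2)
  have "integral\<^sup>L lborel (\<lambda>x :: real ^ 'n. \<Prod>j\<in>UNIV. f j (x $ j)) =
      (\<integral>x. (\<Prod>b\<in>Basis. g b (x b)) \<partial>(\<Pi>\<^sub>M b\<in>(Basis::(real ^ 'n) set). lborel))"
    unfolding eq lborel_eq[where 'a="real ^ 'n"]
    by (subst integral_distr[OF m mg]) (simp add: eq2)
  also have "\<dots> = (\<Prod>b\<in>(Basis::(real ^ 'n) set). integral\<^sup>L lborel (g b))"
    by (rule product_integral_prod) (auto simp: g_def int)
  also have "\<dots> = (\<Prod>j\<in>UNIV. integral\<^sup>L lborel (f j))"
    by (simp add: prod_Basis_vec g_def \<iota>)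
  finally show "integral\<^sup>L lborel (\<lambda>x :: real ^ 'n. \<Prod>j\<in>UNIV. f j (x $ j)) = (\<Prod>j\<in>UNIV. integral\<^sup>L lborel (f j))" .
qed

section \<open>Hermite functions of one variable\<close>

text \<open>The polynomial factor of the n-th derivative of exp(-x^2), hence (-1)^n times the usual
  (physicists') Hermite polynomial.\<close>

primrec hpoly :: "nat \<Rightarrow> real poly" where
  "hpoly 0 = 1"
| "hpoly (Suc n) = pderiv (hpoly n) - [:0, 2:] * hpoly n"

definition gauss_deriv :: "nat \<Rightarrow> real \<Rightarrow> real" where
  "gauss_deriv n x = poly (hpoly n) x * exp (- x\<^sup>2)"

lemma DERIV_gauss_deriv: "(gauss_deriv n has_real_derivative gauss_deriv (Suc n) x) (at x)"
  unfolding gauss_deriv_def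
  by (auto intro!: derivative_eq_intros simp: poly_diff algebra_simps)

text \<open>Differentiating the recursion gives a recursion for the derivatives; the sign compared
  with the classical identity is the factor (-1)^n. This is what lowers the second index in the
  orthogonality proof.\<close>

lemma pderiv_hpoly: "pderiv (hpoly (Suc n)) = smult (- 2 * real (Suc n)) (hpoly n)"
proof (induction n)
  case 0
  show ?case by (simp add: pderiv_diff pderiv_mult pderiv_pCons)
next
  case (Suc n)
  have "pderiv (hpoly (Suc (Suc n))) =
      pderiv (pderiv (hpoly (Suc n))) - [:0, 2:] * pderiv (hpoly (Suc n)) - smult 2 (hpoly (Suc n))"
    unfolding hpoly.simps(2)[of "Suc n"] pderiv_diff pderiv_mult
    by (simp add: pderiv_pCons)
  also have "\<dots> = smult (- 2 * real (Suc n)) (hpoly (Suc n)) - smult 2 (hpoly (Suc n))"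
    unfolding Suc.IH by (simp add: pderiv_smult smult_diff_right)
  also have "\<dots> = smult (- 2 * real (Suc (Suc n))) (hpoly (Suc n))"
    unfolding smult_diff_left[symmetric] by (simp add: algebra_simps)
  finally show ?case .
qed

definition gint :: "real poly \<Rightarrow> real" where
  "gint p = (\<integral>x. poly p x * exp (- x\<^sup>2) \<partial>lborel)"

lemma integrable_poly_gauss:
  fixes p :: "real poly"
  shows "integrable lborel (\<lambda>x. poly p x * exp (- x\<^sup>2))"
proof -
  have "integrable lborel (\<lambda>x::real. x ^ k * exp (- x\<^sup>2))" for k
  proof -
    \<comment> \<open>Up to the factor \<open>sqrt pi\<close>, exp(-x^2) is the normal density with
      standard deviation 1/sqrt 2.\<close>
    have "integrable lborel (\<lambda>x. sqrt pi * (normal_density 0 (1 / sqrt 2) x * (x - 0) ^ k))"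
      by (intro integrable_mult_right integrable_normal_moment) simp
    also have "(\<lambda>x. sqrt pi * (normal_density 0 (1 / sqrt 2) x * (x - 0) ^ k)) = (\<lambda>x::real. x ^ k * exp (- x\<^sup>2))"
      by (auto simp: normal_density_def power_divide)
    finally show ?thesis .
  qed
  then have "integrable lborel (\<lambda>x. \<Sum>i\<le>degree p. coeff p i * (x ^ i * exp (- x\<^sup>2)))"
    by (intro Bochner_Integration.integrable_sum integrable_mult_right)
  then show ?thesis by (simp add: poly_altdef sum_distrib_right mult.assoc)
qed

lemma gint_1: "gint 1 = sqrt pi"
proof -
  have "(\<integral>x. sqrt pi * normal_density 0 (1 / sqrt 2) x \<partial>lborel) = sqrt pi"
    by simp
  also have "(\<lambda>x. sqrt pi * normal_density 0 (1 / sqrt 2) x) = (\<lambda>x. poly 1 x * exp (- x\<^sup>2))"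
    by (auto simp: normal_density_def power_divide)
  finally show ?thesis by (simp add: gint_def)
qed

lemma gint_linear: "gint (p - q) = gint p - gint q" "gint (smult c p) = c * gint p" "gint (- p) = - gint p"
proof -
  show "gint (p - q) = gint p - gint q"
    using Bochner_Integration.integral_diff[OF integrable_poly_gauss[of p] integrable_poly_gauss[of q]]
    by (simp add: gint_def left_diff_distrib)
  show "gint (smult c p) = c * gint p" by (simp add: gint_def mult.assoc)
  show "gint (- p) = - gint p" by (simp add: gint_def)
qed

lemma poly_gauss_tendsto:
  fixes p :: "real poly"
  shows "((\<lambda>x. poly p x * exp (- x\<^sup>2)) \<longlongrightarrow> 0) at_top"
proof -
  have mono: "((\<lambda>x::real. x ^ k * exp (- x\<^sup>2)) \<longlongrightarrow> 0) at_top" for k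
  proof -
    have "((\<lambda>x::real. x ^ k / exp x * exp (x - x\<^sup>2)) \<longlongrightarrow> 0 * 0) at_top"
    proof (rule tendsto_mult[OF tendsto_power_div_exp_0])
      show "((\<lambda>x::real. exp (x - x\<^sup>2)) \<longlongrightarrow> 0) at_top" by real_asymp
    qed
    then show ?thesis by (simp add: exp_diff exp_minus field_simps)
  qed
  have "((\<lambda>x::real. \<Sum>i\<le>degree p. coeff p i * (x ^ i * exp (- x\<^sup>2))) \<longlongrightarrow> (\<Sum>i\<le>degree p. coeff p i * 0)) at_top"
    by (intro tendsto_sum tendsto_mult mono tendsto_const)
  then show ?thesis by (simp add: poly_altdef sum_distrib_right mult.assoc)
qed

text \<open>The integrand is the derivative of p(x) exp(-x^2), which vanishes at both
  infinities.\<close>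

lemma gint_total: "gint (pderiv p - [:0, 2:] * p) = 0"
proof -
  let ?F = "\<lambda>p x. poly p x * exp (- x\<^sup>2) :: real"
  let ?q = "pderiv p - [:0, 2:] * p"
  \<comment> \<open>The limit at minus infinity is the limit at plus infinity of the reflected
    polynomial.\<close>
  have bot: "(?F p \<longlongrightarrow> 0) at_bot"
  proof -
    have "((\<lambda>x. ?F (pcompose p [:0, -1:]) (- x)) \<longlongrightarrow> 0) at_bot"
      using filterlim_compose[OF poly_gauss_tendsto filterlim_uminus_at_top_at_bot] by simp
    then show ?thesis by (simp add: poly_pcompose)
  qed
  have "(LBINT x=-\<infinity>..\<infinity>. ?F ?q x) = 0 - 0"
  proof (rule interval_integral_FTC_integrable[where F = "?F p"])
    show "((\<lambda>x. poly p x * exp (- x\<^sup>2)) has_vector_derivative poly ?q x * exp (- x\<^sup>2)) (at x)" for x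
      unfolding has_real_derivative_iff_has_vector_derivative[symmetric]
      by (auto intro!: derivative_eq_intros simp: poly_diff algebra_simps)
    show "isCont (?F ?q) x" for x by (intro continuous_intros)
    show "set_integrable lborel (einterval (- \<infinity>) \<infinity>) (?F ?q)"
      using integrable_poly_gauss[of ?q] by (simp add: set_integrable_def)
    show "((?F p \<circ> real_of_ereal) \<longlongrightarrow> 0) (at_right (- \<infinity>))"
      using bot by (simp add: ereal_tendsto_simps)
    show "((?F p \<circ> real_of_ereal) \<longlongrightarrow> 0) (at_left \<infinity>)"
      using poly_gauss_tendsto by (simp add: ereal_tendsto_simps)
  qed simp
  then show ?thesis
    by (simp add: gint_def interval_lebesgue_integral_def set_lebesgue_integral_def)
qed

text \<open>Integration by parts: the left factor receives the derivative, because
  \<open>hpoly (Suc n)\<close> times the Gaussian is the derivative of \<open>hpoly n\<close> times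
  the Gaussian.\<close>

lemma gint_hpoly_Suc: "gint (q * hpoly (Suc n)) = - gint (pderiv q * hpoly n)"
proof -
  have "q * hpoly (Suc n) = (pderiv (q * hpoly n) - [:0, 2:] * (q * hpoly n)) - pderiv q * hpoly n"
    unfolding hpoly.simps(2) pderiv_mult by (simp add: algebra_simps)
  then have "gint (q * hpoly (Suc n)) = gint (pderiv (q * hpoly n) - [:0, 2:] * (q * hpoly n)) - gint (pderiv q * hpoly n)"
    by (metis gint_linear(1))
  then show ?thesis unfolding gint_total by simp
qed

text \<open>Integration by parts lowers one index and, through \<open>pderiv_hpoly\<close>, the
  other one as well, until one of them is 0. Each round contributes 2(n+1), and the Gaussian
  integral supplies \<open>sqrt pi\<close>.\<close>

lemma gint_hpoly: "gint (hpoly m * hpoly n) = (if m = n then 2 ^ n * fact n * sqrt pi else 0)"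
proof (induction n arbitrary: m)
  case 0
  show ?case
  proof (cases m)
    case (Suc k)
    then have "gint (hpoly m * hpoly 0) = gint (1 * hpoly (Suc k))" by simp
    also have "\<dots> = 0" unfolding gint_hpoly_Suc by (simp add: gint_def)
    finally show ?thesis using Suc by simp
  qed (simp add: gint_1)
next
  case (Suc n)
  show ?case
  proof (cases m)
    case 0
    then show ?thesis unfolding gint_hpoly_Suc by (simp add: gint_def)
  next
    case [simp]: (Suc k)
    show ?thesis unfolding gint_hpoly_Suc Suc pderiv_hpoly mult_smult_left gint_linear Suc.IH
      by (simp add: algebra_simps)
  qed
qed

definition hermite1 :: "nat \<Rightarrow> real \<Rightarrow> real" where
  "hermite1 n x = pi powr (- 1 / 4) * (- 1) ^ n * (2 ^ n * fact n) powr (- 1 / 2) * exp (x\<^sup>2 / 2) * gauss_deriv n x"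

lemma hermite1_orthonormal:
  shows "integrable lborel (\<lambda>x. hermite1 m x * hermite1 n x)"
    "(\<integral>x. hermite1 m x * hermite1 n x \<partial>lborel) = (if m = n then 1 else 0)"
proof -
  define c where "c n = pi powr (- 1 / 4) * (- 1) ^ n * (2 ^ n * fact n :: real) powr (- 1 / 2)" for n
  have e: "exp (x\<^sup>2 / 2) * exp (- x\<^sup>2) * (exp (x\<^sup>2 / 2) * exp (- x\<^sup>2)) = exp (- x\<^sup>2)" for x :: real
    unfolding exp_add[symmetric] by (simp add: field_simps)
  have eq: "hermite1 m x * hermite1 n x = c m * c n * (poly (hpoly m * hpoly n) x * exp (- x\<^sup>2))" for x
  proof -
    have "hermite1 m x * hermite1 n x = c m * c n * poly (hpoly m * hpoly n) x *
       (exp (x\<^sup>2 / 2) * exp (- x\<^sup>2) * (exp (x\<^sup>2 / 2) * exp (- x\<^sup>2)))"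
      by (simp add: hermite1_def gauss_deriv_def c_def)
    then show ?thesis unfolding e by simp
  qed
  show "integrable lborel (\<lambda>x. hermite1 m x * hermite1 n x)"
    unfolding eq by (intro integrable_mult_right integrable_poly_gauss)
  have "(\<integral>x. hermite1 m x * hermite1 n x \<partial>lborel) = c m * c n * gint (hpoly m * hpoly n)"
    unfolding eq gint_def by simp
  also have "\<dots> = (if m = n then 1 else 0)"
  proof -
    have "c n * c n * (2 ^ n * fact n * sqrt pi) = 1"
    proof -
      have "c n * c n = (pi powr (- 1 / 4) * pi powr (- 1 / 4)) *
        ((2 ^ n * fact n) powr (- 1 / 2) * (2 ^ n * fact n) powr (- 1 / 2))"
        by (simp add: c_def power_mult_distrib[symmetric] algebra_simps)
      also have "\<dots> = pi powr (- (1 / 2)) * (2 ^ n * fact n) powr (-1)"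
        unfolding powr_add[symmetric] by simp
      also have "\<dots> = inverse (sqrt pi) * inverse (2 ^ n * fact n)"
        by (simp add: powr_minus powr_half_sqrt)
      finally show ?thesis by (simp add: field_simps)
    qed
    then show ?thesis unfolding gint_hpoly by simp
  qed
  finally show "(\<integral>x. hermite1 m x * hermite1 n x \<partial>lborel) = (if m = n then 1 else 0)" .
qed

text \<open>Identifies the real derivatives with the Taylor coefficients of an entire function, so
  that the generating function follows from the power series theorem.\<close>

lemma higher_deriv_gauss:
  "(deriv ^^ n) (\<lambda>w::complex. exp (- w\<^sup>2)) (of_real x) = of_real (gauss_deriv n x)"
proof (induction n arbitrary: x)
  case 0
  show ?case by (simp add: gauss_deriv_def exp_of_real[symmetric])
next
  case (Suc n)
  let ?E = "\<lambda>w::complex. exp (- w\<^sup>2)"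
  have "?E holomorphic_on UNIV" by (intro holomorphic_intros)
  then have "(deriv ^^ n) ?E holomorphic_on UNIV" by (rule holomorphic_higher_deriv) auto
  then have "((deriv ^^ n) ?E has_field_derivative (deriv ^^ Suc n) ?E (of_real x)) (at (of_real x))"
    by (auto intro: holomorphic_derivI)
  from has_vector_derivative_real_field[OF this]
  have 1: "((\<lambda>x. of_real (gauss_deriv n x)) has_vector_derivative (deriv ^^ Suc n) ?E (of_real x)) (at x)"
    unfolding Suc.IH .
  have "((\<lambda>x. of_real (gauss_deriv n x) :: complex) has_vector_derivative of_real (gauss_deriv (Suc n) x)) (at x)"
    using DERIV_gauss_deriv[of n x] unfolding has_real_derivative_iff_has_vector_derivative
    by (rule bounded_linear.has_vector_derivative[OF bounded_linear_of_real])
  then show ?case by (rule vector_derivative_unique_at[OF 1])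
qed

text \<open>This is the Taylor series of exp(-(x+u)^2) at u = -z/2: the sign (-1)^n and the
  normalisation of \<open>hermite1\<close>, together with the second square root, turn z^n into
  (-z/2)^n / n!.\<close>

lemma hermite1_generating:
  fixes z :: complex and x :: real
  defines "f \<equiv> \<lambda>n. of_real (hermite1 n x) * (z ^ n / of_real (sqrt (2 ^ n * fact n)))"
  shows "(\<lambda>n. norm (f n)) summable_on UNIV"
    "infsum f UNIV = of_real (pi powr (- 1 / 4)) * exp (of_real x * z - z\<^sup>2 / 4 - of_real (x\<^sup>2 / 2))"
proof -
  let ?E = "\<lambda>w::complex. exp (- w\<^sup>2)"
  define C where "C = of_real (pi powr (- 1 / 4)) * exp (of_real (x\<^sup>2 / 2) :: complex)"
  have ser: "(\<lambda>n. of_real (gauss_deriv n x) / fact n * u ^ n) sums ?E (of_real x + u)" for u :: complex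
  proof -
    have "(\<lambda>n. (deriv ^^ n) ?E (of_real x) / fact n * ((of_real x + u) - of_real x) ^ n) sums ?E (of_real x + u)"
      by (rule holomorphic_power_series[where r = "norm u + 1"])
        (auto intro!: holomorphic_intros simp: dist_norm)
    then show ?thesis by (simp add: higher_deriv_gauss)
  qed
  have fn: "f n = C * (of_real (gauss_deriv n x) / fact n * (- z / 2) ^ n)" for n
  proof -
    have "(2 ^ n * fact n :: real) powr (- 1 / 2) = 1 / sqrt (2 ^ n * fact n)"
      by (simp add: powr_minus powr_half_sqrt field_simps)
    then have "of_real (hermite1 n x) = C * (- 1) ^ n * of_real (gauss_deriv n x) / of_real (sqrt (2 ^ n * fact n))"
      by (simp add: hermite1_def C_def exp_of_real[symmetric])
    then have "f n = C * of_real (gauss_deriv n x) * ((- 1) ^ n * z ^ n) /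
        (of_real (sqrt (2 ^ n * fact n)) * of_real (sqrt (2 ^ n * fact n)))"
      by (simp add: f_def)
    also have "of_real (sqrt (2 ^ n * fact n)) * of_real (sqrt (2 ^ n * fact n)) = (2 ^ n * fact n :: complex)"
      unfolding of_real_mult[symmetric] by simp
    also have "(- 1) ^ n * z ^ n = (- z / 2) ^ n * 2 ^ n"
      by (simp add: power_mult_distrib[symmetric])
    finally show ?thesis by simp
  qed
  \<comment> \<open>The series converges at a point of modulus |z| + 1, hence absolutely at -z/2,
    which is closer to 0.\<close>
  have "summable (\<lambda>n. norm (of_real (gauss_deriv n x) / fact n * (- z / 2) ^ n))"
    using ser[of "of_real (norm z + 1)"] norm_ge_zero[of z]
    by (intro powser_insidea[where x = "of_real (norm z + 1)"])
      (auto simp: sums_iff norm_divide simp del: of_real_add norm_ge_zero)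
  then have nf: "summable (\<lambda>n. norm (f n))"
    unfolding fn norm_mult[of C] by (rule summable_mult)
  then show "(\<lambda>n. norm (f n)) summable_on UNIV"
    by (intro norm_summable_imp_summable_on) simp
  have "f sums (C * ?E (of_real x + (- z / 2)))"
    unfolding fn by (intro sums_mult ser)
  then have "(f has_sum (C * ?E (of_real x + (- z / 2)))) UNIV"
    by (intro norm_summable_imp_has_sum nf)
  moreover have "C * ?E (of_real x + (- z / 2)) =
     of_real (pi powr (- 1 / 4)) * exp (of_real x * z - z\<^sup>2 / 4 - of_real (x\<^sup>2 / 2))"
  proof -
    have "of_real (x\<^sup>2 / 2) + - (of_real x + (- z / 2))\<^sup>2 = of_real x * z - z\<^sup>2 / 4 - of_real (x\<^sup>2 / 2)"
      by (simp add: power2_eq_square field_simps)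
    then show ?thesis unfolding C_def mult.assoc exp_add[symmetric] by (rule arg_cong)
  qed
  ultimately show "infsum f UNIV = of_real (pi powr (- 1 / 4)) * exp (of_real x * z - z\<^sup>2 / 4 - of_real (x\<^sup>2 / 2))"
    using infsumI by metis
qed

section \<open>Hermite functions of several variables\<close>

text \<open>Indexed by functions on the coordinates instead of functions on the whole space.
  Distinct indices then mean distinct Hermite functions, which sums over all indices and
  orthogonality require.\<close>

definition hermiten :: "('n::finite \<Rightarrow> nat) \<Rightarrow> real ^ 'n \<Rightarrow> real" where
  "hermiten \<alpha> x = (\<Prod>j\<in>UNIV. hermite1 (\<alpha> j) (x $ j))"

definition herm_norm :: "('n::finite \<Rightarrow> nat) \<Rightarrow> real" where
  "herm_norm \<alpha> = (\<Prod>j\<in>UNIV. sqrt (2 ^ \<alpha> j * fact (\<alpha> j)))"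

definition mpow :: "complex ^ 'n \<Rightarrow> ('n::finite \<Rightarrow> nat) \<Rightarrow> complex" where
  "mpow z \<alpha> = (\<Prod>j\<in>UNIV. z $ j ^ \<alpha> j)"

lemma herm_norm_pos: "herm_norm \<alpha> > 0"
  by (auto simp: herm_norm_def intro!: prod_pos)

lemma hermiten_orthonormal:
  fixes \<alpha> \<beta> :: "'n::finite \<Rightarrow> nat"
  shows "integrable lborel (\<lambda>x. hermiten \<alpha> x * hermiten \<beta> x)"
    "(\<integral>x. hermiten \<alpha> x * hermiten \<beta> x \<partial>lborel) = (if \<alpha> = \<beta> then 1 else 0)"
proof -
  have eq: "hermiten \<alpha> x * hermiten \<beta> x = (\<Prod>j\<in>UNIV. (\<lambda>t. hermite1 (\<alpha> j) t * hermite1 (\<beta> j) t) (x $ j))" for x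
    by (simp add: hermiten_def prod.distrib)
  show "integrable lborel (\<lambda>x. hermiten \<alpha> x * hermiten \<beta> x)"
    unfolding eq by (rule integral_prod_vec(1)) (rule hermite1_orthonormal)
  have "(\<integral>x. hermiten \<alpha> x * hermiten \<beta> x \<partial>lborel) = (\<Prod>j\<in>UNIV. if \<alpha> j = \<beta> j then 1 else 0)"
    unfolding eq by (subst integral_prod_vec(2)) (auto simp: hermite1_orthonormal)
  also have "\<dots> = (if \<alpha> = \<beta> then 1 else 0)"
    by (auto simp: fun_eq_iff intro!: prod_zero)
  finally show "(\<integral>x. hermiten \<alpha> x * hermiten \<beta> x \<partial>lborel) = (if \<alpha> = \<beta> then 1 else 0)" .
qed

lemma hermite1_continuous [continuous_intros]:
  "continuous_on S f \<Longrightarrow> continuous_on S (\<lambda>x. hermite1 n (f x))"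
  unfolding hermite1_def gauss_deriv_def by (auto intro!: continuous_intros)

lemma hermiten_continuous: "continuous_on S (hermiten \<alpha>)"
  unfolding hermiten_def[abs_def] by (intro continuous_intros)

lemma hermiten_generating:
  fixes z :: "complex ^ 'n::finite" and x :: "real ^ 'n"
  defines "f \<equiv> \<lambda>\<alpha>. of_real (hermiten \<alpha> x) * (mpow z \<alpha> / of_real (herm_norm \<alpha>))"
  shows "(\<lambda>\<alpha>. norm (f \<alpha>)) summable_on UNIV"
    "(f has_sum (of_real (pi powr (- (real CARD('n) / 4))) *
       exp (\<Sum>j\<in>UNIV. of_real (x $ j) * z $ j - (z $ j)\<^sup>2 / 4 - of_real ((x $ j)\<^sup>2 / 2)))) UNIV"
proof -
  define g where "g j n = of_real (hermite1 n (x $ j)) * (z $ j ^ n / of_real (sqrt (2 ^ n * fact n)))" for j n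
  have f: "f \<alpha> = (\<Prod>j\<in>UNIV. g j (\<alpha> j))" for \<alpha>
    by (simp add: f_def g_def hermiten_def mpow_def herm_norm_def prod.distrib prod_dividef)
  have g: "(\<lambda>n. norm (g j n)) summable_on UNIV" for j
    unfolding g_def by (rule hermite1_generating)
  show "(\<lambda>\<alpha>. norm (f \<alpha>)) summable_on UNIV"
    unfolding f by (rule has_sum_prod_multi(1)) (rule g)
  have "(f has_sum (\<Prod>j\<in>UNIV. infsum (g j) UNIV)) UNIV"
    unfolding f by (rule has_sum_prod_multi(2)) (rule g)
  also have "(\<Prod>j\<in>UNIV. infsum (g j) UNIV) = of_real (pi powr (- (real CARD('n) / 4))) *
       exp (\<Sum>j\<in>UNIV. of_real (x $ j) * z $ j - (z $ j)\<^sup>2 / 4 - of_real ((x $ j)\<^sup>2 / 2))"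
  proof -
    have "(pi powr (- 1 / 4)) ^ CARD('n) = pi powr (- (real CARD('n) / 4))"
      by (simp add: powr_realpow[symmetric] powr_powr)
    then show ?thesis
      unfolding g_def hermite1_generating(2)
      by (simp add: prod.distrib exp_sum of_real_power[symmetric] del: of_real_power)
  qed
  finally show "(f has_sum (of_real (pi powr (- (real CARD('n) / 4))) *
       exp (\<Sum>j\<in>UNIV. of_real (x $ j) * z $ j - (z $ j)\<^sup>2 / 4 - of_real ((x $ j)\<^sup>2 / 2)))) UNIV" .
qed

text \<open>The Gaussian is a product of functions of single coordinates, so every differentiation
  acts on one factor only. Hence only the counts matter, and the arbitrary list chosen in
  \<open>mi_deriv\<close> is harmless.\<close>

lemma iter_partial_gauss:
  "set bs \<subseteq> Basis \<Longrightarrow> iter_partial bs (\<lambda>y :: 'a::euclidean_space. exp (- (norm y)\<^sup>2)) x =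
     (\<Prod>b\<in>Basis. gauss_deriv (count_list bs b) (x \<bullet> b))"
proof (induction bs arbitrary: x)
  case Nil
  have "(norm x)\<^sup>2 = (\<Sum>b\<in>Basis. (x \<bullet> b)\<^sup>2)"
    unfolding power2_norm_eq_inner by (subst euclidean_inner) (simp add: power2_eq_square)
  then show ?case by (simp add: gauss_deriv_def exp_sum sum_negf[symmetric])
next
  case (Cons c bs)
  then have c: "c \<in> Basis" and bs: "set bs \<subseteq> Basis" by auto
  let ?Q = "\<Prod>b\<in>Basis - {c}. gauss_deriv (count_list bs b) (x \<bullet> b)"
  have "iter_partial bs (\<lambda>y :: 'a. exp (- (norm y)\<^sup>2)) (x + t *\<^sub>R c) =
      gauss_deriv (count_list bs c) (x \<bullet> c + t) * ?Q" for t
  proof -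
    have "(\<Prod>b\<in>Basis - {c}. gauss_deriv (count_list bs b) ((x + t *\<^sub>R c) \<bullet> b)) = ?Q"
      using c by (intro prod.cong) (auto simp: inner_add_left inner_Basis)
    then show ?thesis
      using c unfolding Cons.IH[OF bs] by (simp add: prod.remove[OF finite_Basis c] inner_add_left)
  qed
  moreover have "((\<lambda>t. gauss_deriv (count_list bs c) (x \<bullet> c + t) * ?Q) has_vector_derivative
      gauss_deriv (Suc (count_list bs c)) (x \<bullet> c + 0) * 1 * ?Q) (at 0)"
  proof -
    have "((\<lambda>t. x \<bullet> c + t) has_real_derivative 1) (at 0)"
      by (auto intro!: derivative_eq_intros)
    then show ?thesis
      unfolding has_real_derivative_iff_has_vector_derivative[symmetric]
      by (intro DERIV_cmult_right DERIV_chain2[OF DERIV_gauss_deriv])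
  qed
  ultimately have "iter_partial (c # bs) (\<lambda>y :: 'a. exp (- (norm y)\<^sup>2)) x =
     gauss_deriv (Suc (count_list bs c)) (x \<bullet> c) * ?Q"
    by (simp add: vector_derivative_at)
  also have "?Q = (\<Prod>b\<in>Basis - {c}. gauss_deriv (count_list (c # bs) b) (x \<bullet> b))"
    by (intro prod.cong) auto
  finally show ?case by (simp add: prod.remove[OF finite_Basis c])
qed

lemma hermite_eq_prod: "hermite \<alpha> x = (\<Prod>b\<in>Basis. hermite1 (\<alpha> b) (x \<bullet> b))"
proof -
  obtain bs where bs: "set bs \<subseteq> (Basis :: 'a set)" "\<And>b. b \<in> Basis \<Longrightarrow> count_list bs b = \<alpha> b"
    and eq: "\<And>g. mi_deriv \<alpha> g = (iter_partial bs g :: 'a \<Rightarrow> real)"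
    by (rule mi_deriv_eqE[of \<alpha>]) blast
  have D: "mi_deriv \<alpha> (\<lambda>y. exp (- (norm y)\<^sup>2)) x = (\<Prod>b\<in>Basis. gauss_deriv (\<alpha> b) (x \<bullet> b))"
    unfolding eq iter_partial_gauss[OF bs(1)] using bs(2) by (intro prod.cong) auto
  have N: "(norm x)\<^sup>2 = (\<Sum>b\<in>Basis. (x \<bullet> b)\<^sup>2)"
    unfolding power2_norm_eq_inner by (subst euclidean_inner) (simp add: power2_eq_square)
  have E: "exp ((norm x)\<^sup>2 / 2) = (\<Prod>b\<in>Basis. exp ((x \<bullet> b)\<^sup>2 / 2))"
    unfolding N sum_divide_distrib by (rule exp_sum) simp
  have P: "(2 ^ mi_length \<alpha> * mi_fact \<alpha>) powr (- (1 / 2)) = (\<Prod>b\<in>Basis. (2 ^ \<alpha> b * fact (\<alpha> b)) powr (- (1 / 2)))"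
    unfolding mi_length_def mi_fact_def power_sum prod.distrib[symmetric] by (simp add: prod_powr_distrib)
  have Q: "pi powr (- (real DIM('a) / 4)) = (\<Prod>b\<in>(Basis :: 'a set). pi powr (- 1 / 4))"
    by (simp add: powr_realpow[symmetric] powr_powr)
  have R: "(-1) ^ mi_length \<alpha> = (\<Prod>b\<in>Basis. (-1 :: real) ^ \<alpha> b)"
    unfolding mi_length_def power_sum ..
  show ?thesis
    unfolding hermite_def D E P Q R hermite1_def prod.distrib[symmetric] by simp
qed

lemma hermite_eq_hermiten: "hermite \<alpha> x = hermiten (\<lambda>j. \<alpha> (axis j 1)) x"
  unfolding hermite_eq_prod hermiten_def prod_Basis_vec by (simp add: inner_axis)

section \<open>The adjoint transform as a Hermite series\<close>

lemma sep_entire_const: "sep_entire (\<lambda>p. c)"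
  by (rule sep_entireI) auto

lemma sep_entire_add: "sep_entire F \<Longrightarrow> sep_entire G \<Longrightarrow> sep_entire (\<lambda>p. F p + G p)"
  and sep_entire_diff: "sep_entire F \<Longrightarrow> sep_entire G \<Longrightarrow> sep_entire (\<lambda>p. F p - G p)"
  and sep_entire_mult: "sep_entire F \<Longrightarrow> sep_entire G \<Longrightarrow> sep_entire (\<lambda>p. F p * G p)"
  unfolding sep_entire_def by (auto intro!: continuous_intros holomorphic_intros)

lemma sep_entire_power: "sep_entire F \<Longrightarrow> sep_entire (\<lambda>p. F p ^ n)"
  unfolding sep_entire_def by (auto intro!: continuous_intros holomorphic_intros)

lemma sep_entire_exp: "sep_entire F \<Longrightarrow> sep_entire (\<lambda>p. exp (F p))"
  unfolding sep_entire_def by (auto intro!: continuous_intros holomorphic_intros)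

lemma sep_entire_sum: "(\<And>i. i \<in> I \<Longrightarrow> sep_entire (F i)) \<Longrightarrow> sep_entire (\<lambda>p. \<Sum>i\<in>I. F i p)"
  unfolding sep_entire_def by (auto intro!: continuous_intros holomorphic_intros)

lemma sep_entire_prod: "(\<And>i. i \<in> I \<Longrightarrow> sep_entire (F i)) \<Longrightarrow> sep_entire (\<lambda>p. \<Prod>i\<in>I. F i p)"
  unfolding sep_entire_def by (auto intro!: continuous_intros holomorphic_intros)

lemmas sep_entire_intros = sep_entire_const sep_entire_add sep_entire_diff sep_entire_mult
  sep_entire_power sep_entire_exp sep_entire_sum sep_entire_prod

type_synonym 'n phase = "(real ^ 'n) \<times> (real ^ 'n)"

text \<open>The holomorphic extensions of \<open>y\<close> and of \<open>y + i\<eta>\<close> to complex \<open>y\<close> and \<open>\<eta>\<close>.\<close>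

definition Ycoord :: "'n phase \<times> 'n phase \<Rightarrow> 'n::finite \<Rightarrow> complex" where
  "Ycoord p j = of_real (fst (fst p) $ j) + \<i> * of_real (fst (snd p) $ j)"

definition Zcoord :: "'n phase \<times> 'n phase \<Rightarrow> 'n::finite \<Rightarrow> complex" where
  "Zcoord p j = Ycoord p j + \<i> * (of_real (snd (fst p) $ j) + \<i> * of_real (snd (snd p) $ j))"

lemma sep_entire_coords:
  "sep_entire (\<lambda>p. Ycoord p j)" "sep_entire (\<lambda>p. Zcoord p j)"
proof -
  have Y: "Ycoord (cshift p w b) j = Ycoord p j + w * of_real (fst b $ j)" for p :: "'a phase \<times> 'a phase" and w b
    by (simp add: Ycoord_def cshift_def complex_eq_iff algebra_simps)
  have Z: "Zcoord (cshift p w b) j = Zcoord p j + w * (of_real (fst b $ j) + \<i> * of_real (snd b $ j))"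
    for p :: "'a phase \<times> 'a phase" and w b
    unfolding Zcoord_def Y by (simp add: cshift_def complex_eq_iff algebra_simps)
  show "sep_entire (\<lambda>p. Ycoord p j)"
  proof (rule sep_entireI)
    show "continuous_on UNIV (\<lambda>p. Ycoord p j)" unfolding Ycoord_def by (intro continuous_intros)
  qed (unfold Y, intro holomorphic_intros)
  show "sep_entire (\<lambda>p. Zcoord p j)"
  proof (rule sep_entireI)
    show "continuous_on UNIV (\<lambda>p. Zcoord p j)" unfolding Zcoord_def Ycoord_def by (intro continuous_intros)
  qed (unfold Z, intro holomorphic_intros)
qed

lemma norm_coords_le:
  assumes "norm (fst p) \<le> M" "norm (snd p) \<le> M"
  shows "cmod (Ycoord p j) \<le> 2 * M" "cmod (Zcoord p j) \<le> 4 * M"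
proof -
  have le: "\<bar>fst q $ j\<bar> \<le> M" "\<bar>snd q $ j\<bar> \<le> M" if "norm q \<le> M" for q :: "'a phase"
    using that component_le_norm_cart[of "fst q" j] component_le_norm_cart[of "snd q" j]
      norm_fst_le[of "fst q" "snd q"] norm_snd_le[of "snd q" "fst q"] by auto
  have c: "cmod (of_real a + \<i> * of_real b) \<le> 2 * M" if "\<bar>a\<bar> \<le> M" "\<bar>b\<bar> \<le> M" for a b
    using norm_triangle_mono[of "of_real a" M "\<i> * of_real b" M] that by (simp add: norm_mult)
  show Y: "cmod (Ycoord p j) \<le> 2 * M" unfolding Ycoord_def by (intro c le assms)
  have "cmod (Zcoord p j) \<le> 2 * M + 2 * M" unfolding Zcoord_def
    by (intro norm_triangle_mono Y) (simp only: norm_mult norm_ii mult_1, intro c le assms)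
  then show "cmod (Zcoord p j) \<le> 4 * M" by simp
qed

text \<open>The extensions of \<open>g\<^sub>\<alpha>\<close> and of the kernel.\<close>

definition coeff_fun :: "('n::finite \<Rightarrow> nat) \<Rightarrow> 'n phase \<times> 'n phase \<Rightarrow> complex" where
  "coeff_fun \<alpha> p = (\<Prod>j\<in>UNIV. Zcoord p j ^ \<alpha> j) * of_real (1 / herm_norm \<alpha>) *
     exp (\<Sum>j\<in>UNIV. (Zcoord p j)\<^sup>2 * (1 / 4) - (Ycoord p j)\<^sup>2 * (1 / 2))"

definition kernel_fun :: "real ^ 'n::finite \<Rightarrow> 'n phase \<times> 'n phase \<Rightarrow> complex" where
  "kernel_fun x p = of_real (pi powr (- (real CARD('n) / 4))) *
     exp (\<Sum>j\<in>UNIV. of_real (x $ j) * Zcoord p j - (Ycoord p j)\<^sup>2 * (1 / 2) - of_real ((x $ j)\<^sup>2 / 2))"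

lemma sep_entire_coeff_fun: "sep_entire (coeff_fun \<alpha>)"
  unfolding coeff_fun_def[abs_def] by (intro sep_entire_intros sep_entire_coords)

lemma sep_entire_kernel_fun: "sep_entire (kernel_fun x)"
  unfolding kernel_fun_def[abs_def] by (intro sep_entire_intros sep_entire_coords)

lemma norm_vec_sum: "(norm x)\<^sup>2 = (\<Sum>j\<in>UNIV. (x $ j)\<^sup>2)" for x :: "real ^ 'n::finite"
  unfolding power2_norm_eq_inner inner_vec_def by (simp add: power2_eq_square)

text \<open>Expanding the square gives -|x-y|^2/2 + i<x,\<eta>> = <x,z> - |y|^2/2 - |x|^2/2 with z =
  y + i\<eta>; the real phase space is the slice with second component 0.\<close>

lemma stft_adjoint_gaussian:
  "stft_adjoint gaussian u x = u (\<lambda>q. kernel_fun x (q, 0))"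
proof -
  have "gaussian (x - y) * exp (\<i> * complex_of_real (x \<bullet> \<eta>)) = kernel_fun x ((y, \<eta>), 0)" for y \<eta>
  proof -
    have "complex_of_real (- (norm (x - y))\<^sup>2 / 2) + \<i> * complex_of_real (x \<bullet> \<eta>) =
       (\<Sum>j\<in>UNIV. of_real (x $ j) * (of_real (y $ j) + \<i> * of_real (\<eta> $ j)) - (of_real (y $ j))\<^sup>2 / 2 - of_real ((x $ j)\<^sup>2 / 2))"
      unfolding norm_vec_sum inner_vec_def sum_negf[symmetric] sum_divide_distrib of_real_sum sum_distrib_left
        sum.distrib[symmetric]
      by (intro sum.cong) (auto simp: complex_eq_iff power2_eq_square field_simps)
    moreover have "exp (complex_of_real (- (norm (x - y))\<^sup>2 / 2) + \<i> * complex_of_real (x \<bullet> \<eta>)) =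
      complex_of_real (exp (- (norm (x - y))\<^sup>2 / 2)) * exp (\<i> * complex_of_real (x \<bullet> \<eta>))"
      unfolding exp_add exp_of_real[symmetric] ..
    ultimately show ?thesis
      unfolding gaussian_def kernel_fun_def Zcoord_def Ycoord_def by (simp add: mult.assoc)
  qed
  then show ?thesis by (simp add: stft_adjoint_def case_prod_unfold)
qed

text \<open>The generating function multiplied by exp(<z,z>/4 - <y,y>/2), which replaces the term
  -<z,z>/4 by -<y,y>/2. It holds at complex points \<open>p\<close> too, where remainders have to be
  estimated.\<close>

lemma kernel_fun_has_sum:
  fixes x :: "real ^ 'n::finite"
  shows "((\<lambda>\<alpha>. of_real (hermiten \<alpha> x) * coeff_fun \<alpha> p) has_sum kernel_fun x p) UNIV"
proof -
  let ?E = "exp (\<Sum>j\<in>UNIV. (Zcoord p j)\<^sup>2 * (1 / 4) - (Ycoord p j)\<^sup>2 * (1 / 2))"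
  let ?z = "\<chi> j. Zcoord p j"
  let ?S = "\<Sum>j\<in>UNIV. of_real (x $ j) * ?z $ j - (?z $ j)\<^sup>2 / 4 - of_real ((x $ j)\<^sup>2 / 2)"
  have "((\<lambda>\<alpha>. ?E * (of_real (hermiten \<alpha> x) * (mpow ?z \<alpha> / of_real (herm_norm \<alpha>)))) has_sum
      (?E * (of_real (pi powr (- (real CARD('n) / 4))) * exp ?S))) UNIV"
    by (intro has_sum_cmult_right hermiten_generating)
  moreover have "?E * (of_real (pi powr (- (real CARD('n) / 4))) * exp ?S) = kernel_fun x p"
  proof -
    have "?E * exp ?S = exp (\<Sum>j\<in>UNIV. of_real (x $ j) * Zcoord p j - (Ycoord p j)\<^sup>2 * (1 / 2) - of_real ((x $ j)\<^sup>2 / 2))"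
      unfolding exp_add[symmetric] sum.distrib[symmetric] by (simp add: algebra_simps)
    then show ?thesis unfolding kernel_fun_def by (simp add: algebra_simps)
  qed
  moreover have "?E * (of_real (hermiten \<alpha> x) * (mpow ?z \<alpha> / of_real (herm_norm \<alpha>))) =
     of_real (hermiten \<alpha> x) * coeff_fun \<alpha> p" for \<alpha>
    by (simp only: coeff_fun_def mpow_def vec_lambda_beta divide_inverse of_real_inverse of_real_mult of_real_1 mult_1 mult_ac)
  ultimately show ?thesis by simp
qed

lemma coeff_fun_bound:
  fixes \<alpha> :: "'n::finite \<Rightarrow> nat"
  assumes "norm (fst p) \<le> M" "norm (snd p) \<le> M"
  shows "cmod (coeff_fun \<alpha> p) \<le> exp (real CARD('n) * (6 * M\<^sup>2)) * ((4 * M) ^ (\<Sum>j\<in>UNIV. \<alpha> j) / herm_norm \<alpha>)"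
proof -
  have M: "M \<ge> 0" using assms(1) norm_ge_zero order_trans by blast
  note c = norm_coords_le[OF assms]
  \<comment> \<open>6 M^2 is (4M)^2/4 + (2M)^2/2, with the coordinate bounds 4M and 2M.\<close>
  have "cmod (\<Sum>j\<in>UNIV. (Zcoord p j)\<^sup>2 * (1 / 4) - (Ycoord p j)\<^sup>2 * (1 / 2)) \<le> (\<Sum>j\<in>(UNIV :: 'n set). 6 * M\<^sup>2)"
  proof (rule sum_norm_le)
    fix j :: 'n
    have "(cmod (Zcoord p j))\<^sup>2 \<le> (4 * M)\<^sup>2" "(cmod (Ycoord p j))\<^sup>2 \<le> (2 * M)\<^sup>2"
      by (rule power_mono[OF c(2) norm_ge_zero], rule power_mono[OF c(1) norm_ge_zero])
    moreover have "cmod ((Zcoord p j)\<^sup>2 * (1 / 4) - (Ycoord p j)\<^sup>2 * (1 / 2)) \<le>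
      (cmod (Zcoord p j))\<^sup>2 / 4 + (cmod (Ycoord p j))\<^sup>2 / 2"
      by (rule order_trans[OF norm_triangle_ineq4]) (simp add: norm_mult norm_power norm_divide)
    ultimately show "cmod ((Zcoord p j)\<^sup>2 * (1 / 4) - (Ycoord p j)\<^sup>2 * (1 / 2)) \<le> 6 * M\<^sup>2"
      by (simp add: power_mult_distrib)
  qed
  then have E: "cmod (exp (\<Sum>j\<in>UNIV. (Zcoord p j)\<^sup>2 * (1 / 4) - (Ycoord p j)\<^sup>2 * (1 / 2))) \<le> exp (real CARD('n) * (6 * M\<^sup>2))"
    by (intro order_trans[OF norm_exp]) simp
  have "cmod (\<Prod>j\<in>UNIV. Zcoord p j ^ \<alpha> j) \<le> (\<Prod>j\<in>UNIV. (4 * M) ^ \<alpha> j)"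
    unfolding prod_norm[symmetric] norm_power using c by (intro prod_mono conjI power_mono) auto
  also have "\<dots> = (4 * M) ^ (\<Sum>j\<in>UNIV. \<alpha> j)" by (simp add: power_sum)
  finally have "cmod (\<Prod>j\<in>UNIV. Zcoord p j ^ \<alpha> j) / herm_norm \<alpha> \<le> (4 * M) ^ (\<Sum>j\<in>UNIV. \<alpha> j) / herm_norm \<alpha>"
    using herm_norm_pos[of \<alpha>] by (intro divide_right_mono) auto
  then have "cmod (\<Prod>j\<in>UNIV. Zcoord p j ^ \<alpha> j) / herm_norm \<alpha> *
      cmod (exp (\<Sum>j\<in>UNIV. (Zcoord p j)\<^sup>2 * (1 / 4) - (Ycoord p j)\<^sup>2 * (1 / 2)))
    \<le> (4 * M) ^ (\<Sum>j\<in>UNIV. \<alpha> j) / herm_norm \<alpha> * exp (real CARD('n) * (6 * M\<^sup>2))"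
    using E M herm_norm_pos[of \<alpha>] by (intro mult_mono) auto
  moreover have "cmod (coeff_fun \<alpha> p) = cmod (\<Prod>j\<in>UNIV. Zcoord p j ^ \<alpha> j) / herm_norm \<alpha> *
      cmod (exp (\<Sum>j\<in>UNIV. (Zcoord p j)\<^sup>2 * (1 / 4) - (Ycoord p j)\<^sup>2 * (1 / 2)))"
    using herm_norm_pos[of \<alpha>] by (simp add: coeff_fun_def norm_mult norm_divide)
  ultimately show ?thesis by (simp add: mult.commute)
qed

text \<open>The linear term is absorbed by |x_j| 4M \<le> x_j^2/4 + 16 M^2, which leaves -x_j^2/4 of
  the Gaussian. The quadratic term in y costs another (2M)^2/2, whence 18 M^2. The surviving
  Gaussian decay makes the transform square integrable.\<close>

lemma kernel_fun_bound:
  fixes x :: "real ^ 'n::finite"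
  assumes "norm (fst p) \<le> M" "norm (snd p) \<le> M"
  shows "cmod (kernel_fun x p) \<le> exp (real CARD('n) * (18 * M\<^sup>2)) * exp (- (norm x)\<^sup>2 / 4)"
proof -
  have M: "M \<ge> 0" using assms(1) norm_ge_zero order_trans by blast
  note c = norm_coords_le[OF assms]
  have "Re (\<Sum>j\<in>UNIV. of_real (x $ j) * Zcoord p j - (Ycoord p j)\<^sup>2 * (1 / 2) - of_real ((x $ j)\<^sup>2 / 2))
     \<le> (\<Sum>j\<in>(UNIV :: 'n set). 18 * M\<^sup>2 - (x $ j)\<^sup>2 / 4)"
    unfolding Re_sum
  proof (rule sum_mono)
    fix j :: 'n
    let ?a = "\<bar>x $ j\<bar>"
    have "Re (of_real (x $ j) * Zcoord p j) \<le> ?a * (4 * M)"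
      by (rule order_trans[OF complex_Re_le_cmod]) (auto simp: norm_mult intro!: mult_left_mono c)
    moreover have "- Re ((Ycoord p j)\<^sup>2) \<le> (2 * M)\<^sup>2"
    proof -
      have "- Re ((Ycoord p j)\<^sup>2) \<le> cmod ((Ycoord p j)\<^sup>2)"
        using abs_Re_le_cmod[of "(Ycoord p j)\<^sup>2"] by linarith
      also have "\<dots> \<le> (2 * M)\<^sup>2" unfolding norm_power using c by (intro power_mono) auto
      finally show ?thesis .
    qed
    moreover have "0 \<le> (?a / 2 - 4 * M)\<^sup>2" by simp
    then have "?a * (4 * M) \<le> ?a\<^sup>2 / 4 + 16 * M\<^sup>2"
      by (simp add: power2_eq_square algebra_simps)
    moreover have "Re (of_real (x $ j) * Zcoord p j - (Ycoord p j)\<^sup>2 * (1 / 2) - of_real ((x $ j)\<^sup>2 / 2)) =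
      Re (of_real (x $ j) * Zcoord p j) - Re ((Ycoord p j)\<^sup>2) / 2 - (x $ j)\<^sup>2 / 2"
      by (simp add: Re_divide_numeral)
    ultimately show "Re (of_real (x $ j) * Zcoord p j - (Ycoord p j)\<^sup>2 * (1 / 2) - of_real ((x $ j)\<^sup>2 / 2))
       \<le> 18 * M\<^sup>2 - (x $ j)\<^sup>2 / 4" by (simp add: power_mult_distrib)
  qed
  also have "\<dots> = real CARD('n) * (18 * M\<^sup>2) + - (norm x)\<^sup>2 / 4"
    unfolding norm_vec_sum by (simp add: sum_subtractf sum_divide_distrib)
  finally have "cmod (exp (\<Sum>j\<in>UNIV. of_real (x $ j) * Zcoord p j - (Ycoord p j)\<^sup>2 * (1 / 2) - of_real ((x $ j)\<^sup>2 / 2)))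
     \<le> exp (real CARD('n) * (18 * M\<^sup>2)) * exp (- (norm x)\<^sup>2 / 4)"
    unfolding norm_exp_eq_Re exp_add[symmetric] by simp
  moreover have "pi powr (- (real CARD('n) / 4)) \<le> 1"
    using powr_mono[of "- (real CARD('n) / 4)" 0 pi] pi_gt3 by simp
  ultimately have "pi powr (- (real CARD('n) / 4)) * cmod (exp (\<Sum>j\<in>UNIV. of_real (x $ j) * Zcoord p j - (Ycoord p j)\<^sup>2 * (1 / 2) - of_real ((x $ j)\<^sup>2 / 2)))
     \<le> 1 * (exp (real CARD('n) * (18 * M\<^sup>2)) * exp (- (norm x)\<^sup>2 / 4))"
    by (intro mult_mono) auto
  then show ?thesis
    unfolding kernel_fun_def norm_mult[of "of_real _"] norm_of_real by simp
qed

section \<open>Termwise application of a Gevrey functional\<close>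

lemma linear_functional_onD:
  assumes "linear_functional_on V u" "g \<in> V"
  shows "k \<in> V \<Longrightarrow> u (\<lambda>x. g x + k x) = u g + u k" "u (\<lambda>x. c * g x) = c * u g"
  using assms unfolding linear_functional_on_def by auto

text \<open>Additivity is known only between members of \<open>V\<close>, so membership of all
  partial sums is a premise; in the application they are entire and therefore Gevrey.\<close>

lemma linear_functional_on_sum:
  assumes lin: "linear_functional_on V u" and "finite A" and 0: "(\<lambda>x. 0) \<in> V"
    and V: "\<And>a. a \<in> A \<Longrightarrow> f a \<in> V"
    and cl: "\<And>B. B \<subseteq> A \<Longrightarrow> (\<lambda>x. \<Sum>a\<in>B. c a * f a x) \<in> V" "\<And>a. a \<in> A \<Longrightarrow> (\<lambda>x. c a * f a x) \<in> V"
  shows "u (\<lambda>x. \<Sum>a\<in>A. c a * f a x) = (\<Sum>a\<in>A. c a * u (f a))"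
  using \<open>finite A\<close> V cl
proof (induction A rule: finite_induct)
  case empty
  have "u (\<lambda>x. 0 * 0) = 0 * u (\<lambda>x. 0)"
    by (rule linear_functional_onD(2)[OF lin 0])
  then show ?case by simp
next
  case (insert a A)
  have "u (\<lambda>x. \<Sum>a\<in>insert a A. c a * f a x) = u (\<lambda>x. c a * f a x + (\<Sum>a\<in>A. c a * f a x))"
    using insert.hyps by simp
  also have "\<dots> = u (\<lambda>x. c a * f a x) + u (\<lambda>x. \<Sum>a\<in>A. c a * f a x)"
    by (rule linear_functional_onD(1)[OF lin]) (use insert.prems in blast)+
  also have "u (\<lambda>x. c a * f a x) = c a * u (f a)"
    by (rule linear_functional_onD(2)[OF lin]) (use insert.prems in blast)
  also have "u (\<lambda>x. \<Sum>a\<in>A. c a * f a x) = (\<Sum>a\<in>A. c a * u (f a))"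
    by (rule insert.IH) (use insert.prems in blast)+
  finally show ?case using insert.hyps by simp
qed

lemma has_sum_Compl:
  fixes f :: "'i \<Rightarrow> 'b::banach"
  assumes "(f has_sum S) UNIV" and "finite A"
  shows "(f has_sum (S - sum f A)) (- A)"
proof -
  have "f summable_on UNIV" using assms(1) by (rule has_sum_imp_summable)
  then have "f summable_on (- A)" by (rule summable_on_subset_banach) simp
  then have 1: "(f has_sum infsum f (- A)) (- A)" by (rule has_sum_infsum)
  have "(f has_sum (sum f A + infsum f (- A))) (A \<union> - A)"
    by (rule has_sum_Un_disjoint[OF has_sum_finite[OF assms(2)] 1]) simp
  then have "(f has_sum (sum f A + infsum f (- A))) UNIV" by simp
  then have "sum f A + infsum f (- A) = S" using assms(1) by (rule has_sum_unique)
  then have "infsum f (- A) = S - sum f A" by (simp add: algebra_simps)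
  then show ?thesis using 1 by simp
qed

text \<open>The remainder of the kernel expansion after finitely many terms is again entire, and on
  the relevant complex set it is bounded by the tail of one summable series. The bound for
  \<open>u\<close> turns this tail into convergence of the images.\<close>

lemma gevrey_dual_stft_adjoint:
  fixes u :: "('n::finite phase \<Rightarrow> complex) \<Rightarrow> complex"
  assumes u: "u \<in> gevrey_dual s" and s: "s \<ge> 1"
  defines "c \<equiv> \<lambda>\<alpha>. u (\<lambda>q. coeff_fun \<alpha> (q, 0))"
  shows "\<exists>C R. C > 0 \<and> R > 0 \<and> (\<forall>\<alpha>. cmod (c \<alpha>) \<le> C * (R ^ (\<Sum>j\<in>UNIV. \<alpha> j) / herm_norm \<alpha>))"
    and "\<exists>C. \<forall>x. cmod (stft_adjoint gaussian u x) \<le> C * exp (- (norm x)\<^sup>2 / 4)"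
    and "((\<lambda>\<alpha>. of_real (hermiten \<alpha> x) * c \<alpha>) has_sum stft_adjoint gaussian u x) UNIV"
proof -
  obtain M C where MC: "M > 0" "C > 0" and
    bd: "\<And>G S. sep_entire G \<Longrightarrow> S \<ge> 0 \<Longrightarrow> (\<And>p. norm (fst p) \<le> M \<Longrightarrow> norm (snd p) \<le> M \<Longrightarrow> cmod (G p) \<le> S) \<Longrightarrow>
       cmod (u (\<lambda>x. G (x, 0))) \<le> C * S"
    using gevrey_dual_bound_sep_entire[OF u s] by metis
  define D where "D = exp (real CARD('n) * (6 * M\<^sup>2))"
  define t where "t \<alpha> = (4 * M) ^ (\<Sum>j\<in>UNIV. \<alpha> j) / herm_norm \<alpha>" for \<alpha> :: "'n \<Rightarrow> nat"
  have t: "t \<alpha> \<ge> 0" for \<alpha> using MC herm_norm_pos[of \<alpha>] by (simp add: t_def)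
  have D: "D > 0" by (simp add: D_def)
  have "cmod (c \<alpha>) \<le> (C * D) * t \<alpha>" for \<alpha>
  proof -
    have "cmod (c \<alpha>) \<le> C * (D * t \<alpha>)"
      unfolding c_def D_def t_def
      by (rule bd[OF sep_entire_coeff_fun]) (use MC coeff_fun_bound herm_norm_pos[of \<alpha>] in \<open>auto simp: less_imp_le\<close>)
    then show ?thesis by (simp add: mult.assoc)
  qed
  then show "\<exists>C R. C > 0 \<and> R > 0 \<and> (\<forall>\<alpha>. cmod (c \<alpha>) \<le> C * (R ^ (\<Sum>j\<in>UNIV. \<alpha> j) / herm_norm \<alpha>))"
    using MC D unfolding t_def by (intro exI[of _ "C * D"] exI[of _ "4 * M"]) auto
  have "cmod (stft_adjoint gaussian u x) \<le> C * exp (real CARD('n) * (18 * M\<^sup>2)) * exp (- (norm x)\<^sup>2 / 4)" for x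
    unfolding stft_adjoint_gaussian mult.assoc
    by (rule bd[OF sep_entire_kernel_fun]) (use kernel_fun_bound in auto)
  then show "\<exists>C. \<forall>x. cmod (stft_adjoint gaussian u x) \<le> C * exp (- (norm x)\<^sup>2 / 4)" by blast
  have lin: "linear_functional_on (gevrey s) u" using u unfolding gevrey_dual_def by blast
  define n where "n \<alpha> = \<bar>hermiten \<alpha> x\<bar> * t \<alpha>" for \<alpha>
  have nsum: "n summable_on UNIV"
  proof -
    \<comment> \<open>The majorant is the generating series at the point with all coordinates 4M,
      the bound for the complex coordinates z_j.\<close>
    have "(\<lambda>\<alpha>. norm (of_real (hermiten \<alpha> x) * (mpow (\<chi> j. of_real (4 * M)) \<alpha> / of_real (herm_norm \<alpha>)))) summable_on UNIV"
      by (rule hermiten_generating(1))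
    moreover have "norm (of_real (hermiten \<alpha> x) * (mpow (\<chi> j. of_real (4 * M)) \<alpha> / of_real (herm_norm \<alpha>))) = n \<alpha>" for \<alpha>
      using MC herm_norm_pos[of \<alpha>]
      by (simp add: n_def t_def mpow_def norm_mult norm_divide norm_power prod_norm[symmetric] power_sum)
    ultimately show ?thesis by simp
  qed
  show "((\<lambda>\<alpha>. of_real (hermiten \<alpha> x) * c \<alpha>) has_sum stft_adjoint gaussian u x) UNIV"
    unfolding has_sum_def
  proof (rule LIM_zero_cancel)
    have lim: "((\<lambda>A. C * (D * (infsum n UNIV - sum n A))) \<longlongrightarrow> C * (D * (infsum n UNIV - infsum n UNIV))) (finite_subsets_at_top UNIV)"
      using has_sum_infsum[OF nsum] unfolding has_sum_def by (intro tendsto_intros)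
    show "((\<lambda>A. (\<Sum>\<alpha>\<in>A. of_real (hermiten \<alpha> x) * c \<alpha>) - stft_adjoint gaussian u x) \<longlongrightarrow> 0) (finite_subsets_at_top UNIV)"
    proof (rule Lim_null_comparison)
      show "((\<lambda>A. C * (D * (infsum n UNIV - sum n A))) \<longlongrightarrow> 0) (finite_subsets_at_top UNIV)"
        using lim by simp
      show "\<forall>\<^sub>F A in finite_subsets_at_top UNIV. norm ((\<Sum>\<alpha>\<in>A. of_real (hermiten \<alpha> x) * c \<alpha>) - stft_adjoint gaussian u x)
           \<le> C * (D * (infsum n UNIV - sum n A))"
      proof (rule eventually_finite_subsets_at_top_weakI)
        fix A :: "('n \<Rightarrow> nat) set" assume A: "finite A"
        \<comment> \<open>The remainder. Being entire it is an admissible test function, although it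
          stands for an infinite sum.\<close>
        define G where "G p = kernel_fun x p - (\<Sum>\<alpha>\<in>A. of_real (hermiten \<alpha> x) * coeff_fun \<alpha> p)" for p
        have G: "sep_entire G" unfolding G_def
          by (intro sep_entire_intros sep_entire_kernel_fun sep_entire_coeff_fun)
        let ?S = "\<lambda>q. \<Sum>\<alpha>\<in>A. of_real (hermiten \<alpha> x) * coeff_fun \<alpha> (q, 0)"
        have S: "?S \<in> gevrey s"
          by (rule gevrey_sep_entire[OF _ s]) (intro sep_entire_intros sep_entire_coeff_fun)
        have G': "(\<lambda>q. G (q, 0)) \<in> gevrey s" by (rule gevrey_sep_entire[OF G s])
        have "stft_adjoint gaussian u x = u (\<lambda>q. G (q, 0) + ?S q)"
          by (simp add: stft_adjoint_gaussian G_def)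
        also have "\<dots> = u (\<lambda>q. G (q, 0)) + u ?S"
          by (rule linear_functional_onD(1)[OF lin G' S])
        also have "u ?S = (\<Sum>\<alpha>\<in>A. of_real (hermiten \<alpha> x) * c \<alpha>)"
          unfolding c_def
          by (rule linear_functional_on_sum[OF lin A];
              rule gevrey_sep_entire[OF _ s]) (intro sep_entire_intros sep_entire_coeff_fun)+
        finally have eq: "(\<Sum>\<alpha>\<in>A. of_real (hermiten \<alpha> x) * c \<alpha>) - stft_adjoint gaussian u x = - u (\<lambda>q. G (q, 0))"
          by simp
        have split: "infsum n UNIV - sum n A = infsum n (- A)"
          using has_sum_Compl[OF has_sum_infsum[OF nsum] A] by (simp add: infsumI)
        have nc: "n summable_on (- A)" using nsum by (rule summable_on_subset_banach) simp
        have "cmod (u (\<lambda>q. G (q, 0))) \<le> C * (D * infsum n (- A))"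
        proof (rule bd[OF G])
          have "infsum n (- A) \<ge> 0" by (rule infsum_nonneg) (simp add: n_def t)
          then show "0 \<le> D * infsum n (- A)" using D by simp
          fix p :: "'n phase \<times> 'n phase" assume p: "norm (fst p) \<le> M" "norm (snd p) \<le> M"
          let ?f = "\<lambda>\<alpha>. of_real (hermiten \<alpha> x) * coeff_fun \<alpha> p"
          have sf: "(?f has_sum G p) (- A)"
            using has_sum_Compl[OF kernel_fun_has_sum[of x p] A] by (simp add: G_def)
          have le: "norm (?f \<alpha>) \<le> D * n \<alpha>" for \<alpha>
          proof -
            have "norm (?f \<alpha>) \<le> \<bar>hermiten \<alpha> x\<bar> * (D * t \<alpha>)"
              unfolding norm_mult norm_of_real D_def t_def by (intro mult_left_mono coeff_fun_bound p) simp
            then show ?thesis by (simp add: n_def mult_ac)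
          qed
          have sDn: "(\<lambda>\<alpha>. D * n \<alpha>) summable_on (- A)" by (intro summable_on_cmult_right nc)
          have "norm (G p) \<le> infsum (\<lambda>\<alpha>. D * n \<alpha>) (- A)"
            by (rule norm_infsum_le[OF sf _ le]) (use sDn in \<open>rule has_sum_infsum\<close>)
          also have "\<dots> = D * infsum n (- A)" by (rule infsum_cmult_right') 
          finally show "cmod (G p) \<le> D * infsum n (- A)" .
        qed
        then show "norm ((\<Sum>\<alpha>\<in>A. of_real (hermiten \<alpha> x) * c \<alpha>) - stft_adjoint gaussian u x)
           \<le> C * (D * (infsum n UNIV - sum n A))"
          unfolding eq split by simp
      qed
    qed
  qed
qed

section \<open>Interchange of sum and integral; functions given by Hermite series\<close>

text \<open>Reduces to series over nat along an enumeration of the index type; infinity of the type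
  makes this enumeration a bijection.\<close>

lemma has_sum_lebesgue_integral:
  fixes f :: "'i::countable \<Rightarrow> 'x \<Rightarrow> 'b::{banach, second_countable_topology}"
  assumes inf: "infinite (UNIV :: 'i set)"
    and int: "\<And>i. integrable M (f i)"
    and sum: "(\<lambda>i. \<integral>x. norm (f i x) \<partial>M) summable_on UNIV"
    and pw: "\<And>x. x \<in> space M \<Longrightarrow> (\<lambda>i. norm (f i x)) summable_on UNIV"
    and g: "\<And>x. x \<in> space M \<Longrightarrow> ((\<lambda>i. f i x) has_sum g x) UNIV"
  shows "integrable M g" "((\<lambda>i. integral\<^sup>L M (f i)) has_sum integral\<^sup>L M g) UNIV"
proof -
  let ?e = "from_nat_into (UNIV :: 'i set)"
  have e: "bij_betw ?e UNIV UNIV" using inf by (intro bij_betw_from_nat_into) auto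
  have s: "summable (\<lambda>n. h (?e n))" if "h summable_on UNIV" for h :: "'i \<Rightarrow> real"
  proof -
    have "(\<lambda>n. h (?e n)) summable_on UNIV" using summable_on_reindex_bij_betw[OF e, of h] that by simp
    then show ?thesis by (rule summable_on_imp_summable)
  qed
  have sums: "(\<lambda>n. f (?e n) x) sums g x" if "x \<in> space M" for x
    using has_sum_reindex_bij_betw[OF e, of "\<lambda>i. f i x"] g[OF that] by (intro has_sum_imp_sums) simp
  have A: "AE x in M. summable (\<lambda>n. norm (f (?e n) x))" using s[OF pw] by auto
  have B: "summable (\<lambda>n. \<integral>x. norm (f (?e n) x) \<partial>M)" by (rule s[OF sum])
  note * = integrable_suminf[of M "\<lambda>n. f (?e n)", OF int A B] integral_suminf[of M "\<lambda>n. f (?e n)", OF int A B]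
  have eq: "(\<Sum>n. f (?e n) x) = g x" if "x \<in> space M" for x
    using sums[OF that] by (rule sums_unique[symmetric])
  show "integrable M g"
    using *(1) eq by (simp cong: Bochner_Integration.integrable_cong)
  have "(\<lambda>i. norm (integral\<^sup>L M (f i))) summable_on UNIV"
    by (rule summable_on_comparison_test[OF sum]) auto
  then have "(\<lambda>i. integral\<^sup>L M (f i)) summable_on UNIV" by (rule abs_summable_summable)
  then have 1: "((\<lambda>i. integral\<^sup>L M (f i)) has_sum infsum (\<lambda>i. integral\<^sup>L M (f i)) UNIV) UNIV"
    by (rule has_sum_infsum)
  then have "((\<lambda>n. integral\<^sup>L M (f (?e n))) has_sum infsum (\<lambda>i. integral\<^sup>L M (f i)) UNIV) UNIV"
    using has_sum_reindex_bij_betw[OF e, of "\<lambda>i. integral\<^sup>L M (f i)"] by simp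
  then have "(\<lambda>n. integral\<^sup>L M (f (?e n))) sums infsum (\<lambda>i. integral\<^sup>L M (f i)) UNIV"
    by (rule has_sum_imp_sums)
  then have "infsum (\<lambda>i. integral\<^sup>L M (f i)) UNIV = integral\<^sup>L M (\<lambda>x. \<Sum>n. f (?e n) x)"
    unfolding *(2) by (rule sums_unique)
  also have "\<dots> = integral\<^sup>L M g" by (intro Bochner_Integration.integral_cong refl eq)
  finally show "((\<lambda>i. integral\<^sup>L M (f i)) has_sum integral\<^sup>L M g) UNIV" using 1 by simp
qed

lemma infinite_multi_indices: "infinite (UNIV :: ('n \<Rightarrow> nat) set)"
proof -
  have "inj (\<lambda>k _. k :: nat)" by (auto simp: inj_on_def fun_eq_iff)
  then show ?thesis using infinite_UNIV_nat by (metis finite_imageD finite_subset subset_UNIV)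
qed

lemma has_sum_imp_borel_measurable:
  fixes f :: "'i::countable \<Rightarrow> 'x \<Rightarrow> complex"
  assumes inf: "infinite (UNIV :: 'i set)"
    and [measurable]: "\<And>i. f i \<in> borel_measurable M"
    and g: "\<And>x. ((\<lambda>i. f i x) has_sum g x) UNIV"
  shows "g \<in> borel_measurable M"
proof -
  let ?e = "from_nat_into (UNIV :: 'i set)"
  have e: "bij_betw ?e UNIV UNIV" using inf by (intro bij_betw_from_nat_into) auto
  have "(\<lambda>n. f (?e n) x) sums g x" for x
    using has_sum_reindex_bij_betw[OF e, of "\<lambda>i. f i x"] g by (intro has_sum_imp_sums) simp
  then have "g = (\<lambda>x. \<Sum>n. f (?e n) x)" by (auto simp: sums_iff)
  also have "\<dots> \<in> borel_measurable M" by measurable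
  finally show ?thesis .
qed

text \<open>2ab \<le> a^2 + b^2 in place of the Cauchy-Schwarz inequality: for normalised Hermite
  functions the bound is uniform in the index, and uniformity is all that is used.\<close>

lemma L2_times_real_integrable:
  fixes f :: "'a::euclidean_space \<Rightarrow> complex" and h :: "'a \<Rightarrow> real"
  assumes f: "f \<in> L2" and h[measurable]: "h \<in> borel_measurable borel" and h2: "integrable lborel (\<lambda>x. h x * h x)"
  shows "integrable lborel (\<lambda>x. f x * of_real (h x))"
    "(\<integral>x. norm (f x * of_real (h x)) \<partial>lborel) \<le> (\<integral>x. (cmod (f x))\<^sup>2 \<partial>lborel) + (\<integral>x. h x * h x \<partial>lborel)"
proof -
  have [measurable]: "f \<in> borel_measurable borel" and f2: "integrable lborel (\<lambda>x. (cmod (f x))\<^sup>2)"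
    using f by (auto simp: L2_def)
  have le: "norm (f x * of_real (h x)) \<le> (cmod (f x))\<^sup>2 + h x * h x" for x
  proof -
    have "0 \<le> (cmod (f x) - \<bar>h x\<bar>)\<^sup>2" by simp
    then have "2 * (cmod (f x) * \<bar>h x\<bar>) \<le> (cmod (f x))\<^sup>2 + h x * h x"
      by (simp add: power2_eq_square algebra_simps)
    moreover have "0 \<le> cmod (f x) * \<bar>h x\<bar>" by simp
    ultimately show ?thesis unfolding norm_mult norm_of_real by linarith
  qed
  have i: "integrable lborel (\<lambda>x. (cmod (f x))\<^sup>2 + h x * h x)" using f2 h2 by simp
  show int: "integrable lborel (\<lambda>x. f x * of_real (h x))"
    by (rule Bochner_Integration.integrable_bound[OF i]) (use le in \<open>auto intro: order_trans\<close>)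
  have "(\<integral>x. norm (f x * of_real (h x)) \<partial>lborel) \<le> (\<integral>x. (cmod (f x))\<^sup>2 + h x * h x \<partial>lborel)"
    by (rule integral_mono) (use le i int in auto)
  also have "\<dots> = (\<integral>x. (cmod (f x))\<^sup>2 \<partial>lborel) + (\<integral>x. h x * h x \<partial>lborel)"
    using f2 h2 by simp
  finally show "(\<integral>x. norm (f x * of_real (h x)) \<partial>lborel) \<le> (\<integral>x. (cmod (f x))\<^sup>2 \<partial>lborel) + (\<integral>x. h x * h x \<partial>lborel)" .
qed

lemma hermiten_measurable [measurable]: "hermiten \<alpha> \<in> borel_measurable borel"
  by (intro borel_measurable_continuous_onI hermiten_continuous)

lemma integrable_gauss_vec:
  assumes "a > 0"
  shows "integrable lborel (\<lambda>x :: real ^ 'n::finite. exp (- a * (norm x)\<^sup>2))"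
proof -
  have "integrable lborel (\<lambda>t::real. exp (- a * t\<^sup>2))"
  proof -
    have "integrable lborel (\<lambda>t. sqrt (pi / a) * normal_density 0 (1 / sqrt (2 * a)) t)"
      using assms by (intro integrable_mult_right integrable_normal_density) simp
    also have "(\<lambda>t. sqrt (pi / a) * normal_density 0 (1 / sqrt (2 * a)) t) = (\<lambda>t. exp (- a * t\<^sup>2))"
      using assms by (auto simp: normal_density_def power_divide real_sqrt_divide real_sqrt_mult field_simps)
    finally show ?thesis .
  qed
  then have "integrable lborel (\<lambda>x :: real ^ 'n. \<Prod>j\<in>UNIV. exp (- a * (x $ j)\<^sup>2))"
    by (rule integral_prod_vec(1))
  then show ?thesis unfolding norm_vec_sum sum_distrib_left by (simp add: exp_sum)
qed

lemma summable_power_over_herm_norm: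
  fixes T :: real
  assumes T: "T > 0"
  shows "(\<lambda>\<alpha> :: 'n::finite \<Rightarrow> nat. T ^ (\<Sum>j\<in>UNIV. \<alpha> j) / herm_norm \<alpha>) summable_on UNIV"
proof -
  let ?a = "\<lambda>n. T ^ n / sqrt (2 ^ n * fact n)"
  have "summable ?a"
  proof (rule summable_ratio_test[of "1 / 2"])
    \<comment> \<open>From here on the ratio T / sqrt(2(n+1)) of consecutive terms is at most
      1/2.\<close>
    fix n assume n: "n \<ge> nat \<lceil>2 * T\<^sup>2\<rceil>"
    then have "2 * T\<^sup>2 \<le> real (Suc n)" by linarith
    then have "sqrt (4 * T\<^sup>2) \<le> sqrt (2 * real (Suc n))" by simp
    then have "2 * T \<le> sqrt (2 * real (Suc n))" using T by (simp add: real_sqrt_mult)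
    moreover have "sqrt (2 ^ Suc n * fact (Suc n)) = sqrt (2 * real (Suc n)) * sqrt (2 ^ n * fact n)"
      by (simp add: real_sqrt_mult[symmetric] algebra_simps)
    moreover have "0 < sqrt (2 * real (Suc n))" "0 < sqrt (2 ^ n * fact n)" by auto
    ultimately have "T / sqrt (2 * real (Suc n)) * ?a n \<le> 1 / 2 * ?a n"
      using T by (intro mult_right_mono) (auto simp: field_simps)
    moreover have "?a (Suc n) = T / sqrt (2 * real (Suc n)) * ?a n"
      unfolding \<open>sqrt (2 ^ Suc n * fact (Suc n)) = _\<close> by simp
    ultimately show "norm (?a (Suc n)) \<le> 1 / 2 * norm (?a n)" using T by simp
  qed simp
  then have "summable (\<lambda>n. norm (norm (of_real (?a n) :: complex)))"
    unfolding norm_of_real using T by simp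
  then have "(\<lambda>n. norm (of_real (?a n) :: complex)) summable_on UNIV"
    by (rule norm_summable_imp_summable_on)
  from has_sum_prod_multi(1)[of "\<lambda>_ n. of_real (?a n)", OF this]
  have "(\<lambda>\<alpha> :: 'n \<Rightarrow> nat. norm (\<Prod>j\<in>UNIV. of_real (?a (\<alpha> j)) :: complex)) summable_on UNIV" .
  moreover have "norm (\<Prod>j\<in>UNIV. of_real (?a (\<alpha> j)) :: complex) = T ^ (\<Sum>j\<in>UNIV. \<alpha> j) / herm_norm \<alpha>" for \<alpha> :: "'n \<Rightarrow> nat"
    unfolding of_real_prod[symmetric] norm_of_real using T
    by (simp add: herm_norm_def prod_dividef power_sum abs_of_nonneg prod_nonneg)
  ultimately show ?thesis by simp
qed

lemma sqrt_prod: "sqrt (prod f A) = (\<Prod>x\<in>A. sqrt (f x))"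
  by (induction A rule: infinite_finite_induct) (auto simp: real_sqrt_mult)

text \<open>The coefficients are absolutely summable, so the series can be integrated termwise
  against a Hermite function, and orthonormality isolates one coefficient. Square integrability
  comes from the pointwise Gaussian bound.\<close>

lemma hermite_series_coefficients:
  fixes c :: "('n::finite \<Rightarrow> nat) \<Rightarrow> complex"
  assumes c: "\<And>\<alpha>. cmod (c \<alpha>) \<le> C * (R ^ (\<Sum>j\<in>UNIV. \<alpha> j) / herm_norm \<alpha>)" and C: "C > 0" and R: "R > 0"
    and f: "\<And>x. ((\<lambda>\<alpha>. of_real (hermiten \<alpha> x) * c \<alpha>) has_sum f x) UNIV"
    and bd: "\<And>x. cmod (f x) \<le> D * exp (- (norm x)\<^sup>2 / 4)"
  shows "f \<in> L2" "(\<integral>x. f x * of_real (hermiten \<beta> x) \<partial>lborel) = c \<beta>" "f \<in> H_flat1"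
proof -
  have [measurable]: "f \<in> borel_measurable borel"
    by (rule has_sum_imp_borel_measurable[OF infinite_multi_indices _ f]) measurable
  have D: "D \<ge> 0" using order_trans[OF norm_ge_zero bd[of 0]] by simp
  have "integrable lborel (\<lambda>x. (cmod (f x))\<^sup>2)"
  proof (rule Bochner_Integration.integrable_bound)
    show "integrable lborel (\<lambda>x :: real ^ 'n. D\<^sup>2 * exp (- (1/2) * (norm x)\<^sup>2))"
      by (intro integrable_mult_right integrable_gauss_vec) simp
    have "(cmod (f x))\<^sup>2 \<le> D\<^sup>2 * exp (- (1/2) * (norm x)\<^sup>2)" for x
    proof -
      have "(cmod (f x))\<^sup>2 \<le> (D * exp (- (norm x)\<^sup>2 / 4))\<^sup>2" by (intro power_mono bd) simp
      also have "\<dots> = D\<^sup>2 * exp (- (1/2) * (norm x)\<^sup>2)"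
        by (simp add: power_mult_distrib exp_double[symmetric])
      finally show ?thesis .
    qed
    then show "AE x in lborel. norm ((cmod (f x))\<^sup>2) \<le> norm (D\<^sup>2 * exp (- (1/2) * (norm x)\<^sup>2))"
      by auto
  qed measurable
  then show L2: "f \<in> L2" by (simp add: L2_def)
  have ns: "(\<lambda>\<alpha>. C * (R ^ (\<Sum>j\<in>UNIV. \<alpha> j) / herm_norm \<alpha>)) summable_on UNIV"
    using R by (intro summable_on_cmult_right summable_power_over_herm_norm)
  have coeff: "(\<integral>x. f x * of_real (hermiten \<beta> x) \<partial>lborel) = c \<beta>" for \<beta>
  proof -
    let ?f = "\<lambda>\<alpha> x. of_real (hermiten \<alpha> x) * c \<alpha> * of_real (hermiten \<beta> x)"
    have eq: "?f \<alpha> x = c \<alpha> * of_real (hermiten \<alpha> x * hermiten \<beta> x)" for \<alpha> x by simp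
    have int: "integrable lborel (?f \<alpha>)" for \<alpha>
      unfolding eq by (intro integrable_mult_right integrable_of_real hermiten_orthonormal)
    have ie: "integral\<^sup>L lborel (?f \<alpha>) = (if \<alpha> = \<beta> then c \<beta> else 0)" for \<alpha>
      unfolding eq integral_mult_right_zero integral_complex_of_real hermiten_orthonormal by simp
    \<comment> \<open>The absolute value of a product of two normalised functions has integral at
      most 1, again by 2ab \<le> a^2 + b^2.\<close>
    have in_le: "(\<integral>x. norm (?f \<alpha> x) \<partial>lborel) \<le> C * (R ^ (\<Sum>j\<in>UNIV. \<alpha> j) / herm_norm \<alpha>) * 1" for \<alpha>
    proof -
      have "(\<integral>x. norm (?f \<alpha> x) \<partial>lborel) = cmod (c \<alpha>) * (\<integral>x. \<bar>hermiten \<alpha> x * hermiten \<beta> x\<bar> \<partial>lborel)"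
        unfolding eq norm_mult norm_of_real by simp
      also have "(\<integral>x. \<bar>hermiten \<alpha> x * hermiten \<beta> x\<bar> \<partial>lborel) \<le>
         (\<integral>x. (hermiten \<alpha> x * hermiten \<alpha> x + hermiten \<beta> x * hermiten \<beta> x) / 2 \<partial>lborel)"
      proof (rule integral_mono)
        fix x
        have "0 \<le> (\<bar>hermiten \<alpha> x\<bar> - \<bar>hermiten \<beta> x\<bar>)\<^sup>2" by simp
        then show "\<bar>hermiten \<alpha> x * hermiten \<beta> x\<bar> \<le> (hermiten \<alpha> x * hermiten \<alpha> x + hermiten \<beta> x * hermiten \<beta> x) / 2"
          by (simp add: power2_eq_square algebra_simps abs_mult)
      qed (auto intro!: integrable_divide Bochner_Integration.integrable_add integrable_abs hermiten_orthonormal)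
      also have "\<dots> = 1" by (simp add: hermiten_orthonormal)
      finally show ?thesis
        using c[of \<alpha>] by (meson mult_mono norm_ge_zero order_trans mult_left_mono mult_right_mono zero_le_one)
    qed
    have "((\<lambda>\<alpha>. integral\<^sup>L lborel (?f \<alpha>)) has_sum (\<integral>x. f x * of_real (hermiten \<beta> x) \<partial>lborel)) UNIV"
    proof (rule has_sum_lebesgue_integral(2)[OF infinite_multi_indices int])
      show "(\<lambda>\<alpha>. \<integral>x. norm (?f \<alpha> x) \<partial>lborel) summable_on UNIV"
        by (rule summable_on_comparison_test[OF ns]) (use in_le in auto)
      fix x
      show "((\<lambda>\<alpha>. ?f \<alpha> x) has_sum (f x * of_real (hermiten \<beta> x))) UNIV"
        by (intro has_sum_cmult_left f)
      have "(\<lambda>\<alpha>. norm (of_real (hermiten \<alpha> x) * c \<alpha>)) summable_on UNIV"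
        by (rule summable_on_iff_abs_summable_on_complex[THEN iffD1, OF has_sum_imp_summable[OF f]])
      then show "(\<lambda>\<alpha>. norm (?f \<alpha> x)) summable_on UNIV"
        unfolding norm_mult[of "_ * _" "of_real _"] by (rule summable_on_cmult_left)
    qed
    moreover have "((\<lambda>\<alpha>. integral\<^sup>L lborel (?f \<alpha>)) has_sum c \<beta>) UNIV"
    proof -
      have "((\<lambda>\<alpha>. if \<alpha> = \<beta> then c \<beta> else 0) has_sum (\<Sum>\<alpha>\<in>{\<beta>}. if \<alpha> = \<beta> then c \<beta> else 0)) UNIV"
        by (rule has_sum_finite_neutralI[where B = "{\<beta>}"]) auto
      then show ?thesis unfolding ie by simp
    qed
    ultimately show ?thesis by (rule has_sum_unique)
  qed
  then show "(\<integral>x. f x * of_real (hermiten \<beta> x) \<partial>lborel) = c \<beta>" .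
  show "f \<in> H_flat1"
    unfolding H_flat1_def
  \<comment> \<open>The radii are all \<open>R\<close>. The factor 2^(|\<alpha>|/2) by which
    \<open>herm_norm\<close> exceeds the square root of \<alpha>! is given away.\<close>
  proof (intro CollectI conjI L2 exI[of _ "\<chi> j. R"] exI[of _ C] allI ballI C)
    fix b :: "real ^ 'n" assume "b \<in> Basis"
    then show "0 < (\<chi> j. R) \<bullet> b" using R by (auto simp: Basis_vec_def inner_axis)
  next
    fix \<alpha> :: "real ^ 'n \<Rightarrow> nat"
    let ?a = "\<lambda>j. \<alpha> (axis j 1)"
    have "hermite_coeff f \<alpha> = c ?a"
      unfolding hermite_coeff_def hermite_eq_hermiten by (simp add: coeff)
    then have "cmod (hermite_coeff f \<alpha>) \<le> C * (R ^ (\<Sum>j\<in>UNIV. ?a j) / herm_norm ?a)" using c by simp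
    also have "\<dots> \<le> C * (mi_power (\<chi> j. R) \<alpha> * mi_fact \<alpha> powr (- (1 / 2)))"
    proof (intro mult_left_mono)
      have p: "mi_power (\<chi> j. R) \<alpha> = R ^ (\<Sum>j\<in>UNIV. ?a j)"
        by (simp add: mi_power_def prod_Basis_vec inner_axis power_sum)
      have "mi_fact \<alpha> powr (- (1 / 2)) = 1 / sqrt (mi_fact \<alpha>)"
        using mi_fact_ge_1[of \<alpha>] unfolding powr_minus_divide by (subst powr_half_sqrt) auto
      moreover have "sqrt (mi_fact \<alpha>) \<le> herm_norm ?a"
        unfolding mi_fact_def prod_Basis_vec sqrt_prod herm_norm_def
        by (intro prod_mono) (simp add: mult_le_cancel_right1)
      moreover have "sqrt (mi_fact \<alpha>) > 0" using mi_fact_ge_1[of \<alpha>] by simp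
      ultimately have "1 / herm_norm ?a \<le> mi_fact \<alpha> powr (- (1 / 2))"
        by (simp add: frac_le)
      from mult_left_mono[OF this, of "R ^ (\<Sum>j\<in>UNIV. ?a j)"] show "R ^ (\<Sum>j\<in>UNIV. ?a j) / herm_norm ?a \<le> mi_power (\<chi> j. R) \<alpha> * mi_fact \<alpha> powr (- (1 / 2))"
        unfolding p using R by simp
    qed (use C in simp)
    finally show "cmod (hermite_coeff f \<alpha>) \<le> C * (mi_power (\<chi> j. R) \<alpha> * mi_fact \<alpha> powr (- (1 / 2)))" .
  qed
qed

section \<open>Completeness of the Hermite functions\<close>

text \<open>In each coordinate the integral is \<open>sqrt (2 * pi)\<close> times the characteristic
  function of the standard normal distribution.\<close>

lemma gauss_fourier:
  fixes v :: "real ^ 'n::finite"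
  shows "(\<integral>\<eta>. exp (\<i> * of_real (v \<bullet> \<eta>)) * of_real (exp (- (norm \<eta>)\<^sup>2 / 2)) \<partial>lborel) =
     of_real (sqrt (2 * pi) ^ CARD('n) * exp (- (norm v)\<^sup>2 / 2))"
proof -
  let ?f = "\<lambda>j t. exp (\<i> * of_real (v $ j * t)) * of_real (exp (- t\<^sup>2 / 2)) :: complex"
  have eq: "?f j t = of_real (sqrt (2 * pi)) * (std_normal_density t *\<^sub>R exp (\<i> * of_real (v $ j * t)))" for j t
    by (simp add: std_normal_density_def scaleR_conv_of_real)
  have int: "integrable lborel (?f j)" for j
  proof (rule Bochner_Integration.integrable_bound)
    show "integrable lborel (\<lambda>t. sqrt (2 * pi) * std_normal_density t)" by simp
    show "AE t in lborel. norm (?f j t) \<le> norm (sqrt (2 * pi) * std_normal_density t)"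
      by (simp add: norm_mult std_normal_density_def)
  qed measurable
  have 1: "integral\<^sup>L lborel (?f j) = of_real (sqrt (2 * pi) * exp (- (v $ j)\<^sup>2 / 2))" for j
  proof -
    have "integral\<^sup>L lborel (?f j) = of_real (sqrt (2 * pi)) * (\<integral>t. std_normal_density t *\<^sub>R exp (\<i> * of_real (v $ j * t)) \<partial>lborel)"
      unfolding eq by (rule integral_mult_right_zero)
    also have "(\<integral>t. std_normal_density t *\<^sub>R exp (\<i> * of_real (v $ j * t)) \<partial>lborel) = char std_normal_distribution (v $ j)"
      unfolding char_def by (subst integral_density) auto
    finally show ?thesis by (simp add: char_std_normal_distribution)
  qed
  have "(\<integral>\<eta>. exp (\<i> * of_real (v \<bullet> \<eta>)) * of_real (exp (- (norm \<eta>)\<^sup>2 / 2)) \<partial>lborel) =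
     integral\<^sup>L lborel (\<lambda>\<eta>. \<Prod>j\<in>UNIV. ?f j (\<eta> $ j))"
    unfolding norm_vec_sum inner_vec_def
    by (simp add: exp_sum prod.distrib sum_distrib_left sum_negf[symmetric] sum_divide_distrib)
  also have "\<dots> = (\<Prod>j\<in>UNIV. of_real (sqrt (2 * pi) * exp (- (v $ j)\<^sup>2 / 2)))"
    unfolding integral_prod_vec(2)[OF int] 1 ..
  also have "\<dots> = of_real (sqrt (2 * pi) ^ CARD('n) * exp (- (norm v)\<^sup>2 / 2))"
    unfolding norm_vec_sum of_real_prod[symmetric]
    by (simp add: exp_sum prod.distrib sum_negf[symmetric] sum_divide_distrib)
  finally show ?thesis .
qed

lemma integrable_pair_mult:
  fixes f g :: "'a::euclidean_space \<Rightarrow> real"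
  assumes f: "integrable lborel f" and g: "integrable lborel g"
  shows "integrable (lborel \<Otimes>\<^sub>M lborel) (\<lambda>(x, y). f x * g y)"
proof -
  have [measurable]: "f \<in> borel_measurable borel" "g \<in> borel_measurable borel"
    using f g by (auto simp: borel_measurable_integrable)
  show ?thesis
    by (rule lborel_pair.Fubini_integrable) (auto simp: abs_mult f g)
qed

lemma integral_affine_vec:
  fixes h :: "'a::euclidean_space \<Rightarrow> real"
  assumes [measurable]: "h \<in> borel_measurable borel" and c: "c > 0"
  shows "integral\<^sup>L lborel h = c ^ DIM('a) * (\<integral>u. h (t + c *\<^sub>R u) \<partial>lborel)"
proof -
  have "integral\<^sup>L lborel h = integral\<^sup>L (density (distr lborel borel (\<lambda>x. t + c *\<^sub>R x)) (\<lambda>_. ennreal (c ^ DIM('a)))) h"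
    using lborel_affine[of c t] c by simp
  also have "\<dots> = (\<integral>x. c ^ DIM('a) * h x \<partial>distr lborel borel (\<lambda>x. t + c *\<^sub>R x))"
    using c by (subst integral_density) auto
  also have "\<dots> = (\<integral>x. c ^ DIM('a) * h (t + c *\<^sub>R x) \<partial>lborel)"
    by (subst integral_distr) auto
  finally show ?thesis by simp
qed

text \<open>Positive and negative part of \<open>g\<close> are densities of two measures that agree
  on boxes. Boxes form a generator stable under intersections, so the measures coincide, and hence
  the two parts agree almost everywhere; at most one of them is nonzero at a point.\<close>

lemma box_integrals_zero_imp_AE_zero:
  fixes g :: "'a::euclidean_space \<Rightarrow> real"
  assumes int: "integrable lborel g"
    and 0: "\<And>a b. (\<integral>x. g x * indicator (box a b) x \<partial>lborel) = 0"
  shows "AE x in lborel. g x = 0"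
proof -
  have [measurable]: "g \<in> borel_measurable borel" using int by (auto simp: borel_measurable_integrable)
  \<comment> \<open>\<open>ennreal\<close> maps negative numbers to 0, so these are the positive and
    the negative part.\<close>
  let ?p = "\<lambda>x. ennreal (g x)" and ?n = "\<lambda>x. ennreal (- g x)"
  have eq: "(\<integral>\<^sup>+x. ?p x * indicator (box a b) x \<partial>lborel) = (\<integral>\<^sup>+x. ?n x * indicator (box a b) x \<partial>lborel)"
    and fin: "(\<integral>\<^sup>+x. ?p x * indicator (box a b) x \<partial>lborel) \<noteq> \<infinity>" for a b
  proof -
    let ?h = "\<lambda>x. g x * indicator (box a b) x"
    have h: "integrable lborel ?h"
      using integrable_mult_indicator[OF _ int, of "box a b"] by (simp add: mult.commute)
    have p: "ennreal (?h x) = ?p x * indicator (box a b) x" "ennreal (- ?h x) = ?n x * indicator (box a b) x" for x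
      by (auto split: split_indicator)
    have f: "(\<integral>\<^sup>+x. ennreal (?h x) \<partial>lborel) \<noteq> \<infinity>" "(\<integral>\<^sup>+x. ennreal (- ?h x) \<partial>lborel) \<noteq> \<infinity>"
      using h unfolding real_integrable_def by auto
    have "enn2real (\<integral>\<^sup>+x. ennreal (?h x) \<partial>lborel) = enn2real (\<integral>\<^sup>+x. ennreal (- ?h x) \<partial>lborel)"
      using 0[of a b] unfolding real_lebesgue_integral_def[OF h] by simp
    from arg_cong[OF this, of ennreal]
    have "(\<integral>\<^sup>+x. ennreal (?h x) \<partial>lborel) = (\<integral>\<^sup>+x. ennreal (- ?h x) \<partial>lborel)"
      using f unfolding infinity_ennreal_def less_top by (simp only: ennreal_enn2real)
    then show "(\<integral>\<^sup>+x. ?p x * indicator (box a b) x \<partial>lborel) = (\<integral>\<^sup>+x. ?n x * indicator (box a b) x \<partial>lborel)"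
      "(\<integral>\<^sup>+x. ?p x * indicator (box a b) x \<partial>lborel) \<noteq> \<infinity>"
      using f unfolding p by auto
  qed
  have "density lborel ?p = density lborel ?n"
  proof (rule measure_eqI_generator_eq)
    let ?E = "range (\<lambda>(a, b). box a b::'a set)"
    show "Int_stable ?E"
      by (auto simp: Int_stable_def box_Int_box)
    show "?E \<subseteq> Pow UNIV" "sets (density lborel ?p) = sigma_sets UNIV ?E" "sets (density lborel ?n) = sigma_sets UNIV ?E"
      by (simp_all add: borel_eq_box)
    let ?A = "\<lambda>n::nat. box (- (real n *\<^sub>R One)) (real n *\<^sub>R One) :: 'a set"
    show "range ?A \<subseteq> ?E" "(\<Union>i. ?A i) = UNIV"
      unfolding UN_box_eq_UNIV by auto
    show "emeasure (density lborel ?p) (?A i) \<noteq> \<infinity>" for i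
      using fin by (subst emeasure_density) auto
    show "emeasure (density lborel ?p) X = emeasure (density lborel ?n) X" if "X \<in> ?E" for X
      using that eq by (auto simp: emeasure_density)
  qed
  then have "AE x in lborel. ?p x = ?n x"
    by (intro sigma_finite_measure.density_unique[OF sigma_finite_lborel]) auto
  then show ?thesis
  proof eventually_elim
    case (elim x)
    then show ?case by (cases "g x \<ge> 0") (auto simp: ennreal_neg)
  qed
qed

text \<open>
  Averaging the vanishing Gaussian convolutions over a box and letting the width tend to zero gives
  the integral over the box, because the frontier of the box is a null set.
\<close>

lemma gaussian_convolution_zero_imp_AE_zero:
  fixes g :: "'a::euclidean_space \<Rightarrow> real"
  assumes int: "integrable lborel g"
    and 0: "\<And>w \<sigma>. \<sigma> > 0 \<Longrightarrow> (\<integral>x. g x * exp (- (norm ((w - x) /\<^sub>R \<sigma>))\<^sup>2 / 2) \<partial>lborel) = 0"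
    and gauss: "integrable lborel (\<lambda>u::'a. exp (- (norm u)\<^sup>2 / 2))"
  shows "AE x in lborel. g x = 0"
proof (rule box_integrals_zero_imp_AE_zero[OF int])
  fix a b :: 'a
  have [measurable]: "g \<in> borel_measurable borel" using int by (auto simp: borel_measurable_integrable)
  let ?\<gamma> = "\<lambda>u::'a. exp (- (norm u)\<^sup>2 / 2)"
  let ?U = "box a b"
  \<comment> \<open>The indicator of the box smoothed at scale 1/(k+1), up to the total mass
    \<open>I\<close>.\<close>
  define Q where "Q k x = (\<integral>u. indicator ?U (x + (1 / real (Suc k)) *\<^sub>R u) * ?\<gamma> u \<partial>lborel)" for k x
  define I where "I = integral\<^sup>L lborel ?\<gamma>"
  \<comment> \<open>Positivity suffices, since \<open>I\<close> is only divided out at the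
    end.\<close>
  have Ipos: "I > 0"
  proof -
    have "I \<ge> 0" unfolding I_def by simp
    moreover have "I \<noteq> 0"
    proof
      assume "I = 0"
      then have "AE u in lborel. ?\<gamma> u = 0"
        unfolding I_def by (subst (asm) integral_nonneg_eq_0_iff_AE[OF gauss]) auto
      then have "AE u in (lborel :: 'a measure). u \<notin> UNIV" by simp
      then have "(UNIV :: 'a set) \<in> null_sets lborel" by (subst AE_iff_null_sets) auto
      then show False using emeasure_lborel_UNIV[where 'a='a] by (simp add: null_sets_def)
    qed
    ultimately show ?thesis by simp
  qed
  have Q0: "(\<integral>x. g x * Q k x \<partial>lborel) = 0" for k
  proof -
    define \<sigma> where "\<sigma> = 1 / real (Suc k)"
    have \<sigma>: "\<sigma> > 0" by (simp add: \<sigma>_def)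
    have Q: "\<sigma> ^ DIM('a) * Q k x = (\<integral>w. indicator ?U w * ?\<gamma> ((w - x) /\<^sub>R \<sigma>) \<partial>lborel)" for x
      unfolding Q_def \<sigma>_def[symmetric]
      using integral_affine_vec[of "\<lambda>w. indicator ?U w * ?\<gamma> ((w - x) /\<^sub>R \<sigma>)" \<sigma> x] \<sigma>
      by simp
    let ?K = "\<lambda>x w. g x * (indicator ?U w * ?\<gamma> ((w - x) /\<^sub>R \<sigma>))"
    have K: "integrable (lborel \<Otimes>\<^sub>M lborel) (case_prod ?K)"
    proof (rule Bochner_Integration.integrable_bound)
      show "integrable (lborel \<Otimes>\<^sub>M lborel) (\<lambda>(x, w). g x * indicator ?U w)"
        by (intro integrable_pair_mult int integrable_real_indicator) (use emeasure_lborel_box_finite[of a b] in auto)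
      show "AE p in lborel \<Otimes>\<^sub>M lborel. norm (case_prod ?K p) \<le> norm (case p of (x, w) \<Rightarrow> g x * indicator ?U w)"
        by (auto simp: abs_mult mult_left_le split: split_indicator)
    qed measurable
    \<comment> \<open>By Fubini the smoothing is moved from the box to \<open>g\<close>, where the
      hypothesis makes the inner integral vanish.\<close>
    have "\<sigma> ^ DIM('a) * (\<integral>x. g x * Q k x \<partial>lborel) = (\<integral>x. (\<integral>w. ?K x w \<partial>lborel) \<partial>lborel)"
      unfolding integral_mult_right_zero Q[symmetric]
      by (subst integral_mult_right_zero[symmetric]) (simp only: mult.left_commute)
    also have "\<dots> = (\<integral>w. (\<integral>x. ?K x w \<partial>lborel) \<partial>lborel)"
      by (rule lborel_pair.Fubini_integral[OF K, symmetric])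
    also have "\<dots> = (\<integral>w. indicator ?U w * (\<integral>x. g x * ?\<gamma> ((w - x) /\<^sub>R \<sigma>) \<partial>lborel) \<partial>lborel)"
      by (subst integral_mult_right_zero[symmetric]) (simp only: mult.left_commute)
    also have "\<dots> = 0" unfolding 0[OF \<sigma>] by simp
    finally show ?thesis using \<sigma> by simp
  qed
  \<comment> \<open>Away from the frontier the indicator is constant near x, so the integrand is
    eventually constant for every fixed u.\<close>
  have Qlim: "(\<lambda>k. Q k x) \<longlonglongrightarrow> indicator ?U x * I" if "x \<notin> frontier ?U" for x
  proof -
    have "(\<lambda>k. Q k x) \<longlonglongrightarrow> (\<integral>u. indicator ?U x * ?\<gamma> u \<partial>lborel)"
      unfolding Q_def
    proof (rule integral_dominated_convergence[where w = ?\<gamma>])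
      show "AE u in lborel. (\<lambda>k. indicator ?U (x + (1 / real (Suc k)) *\<^sub>R u) * ?\<gamma> u) \<longlonglongrightarrow> indicator ?U x * ?\<gamma> u"
      proof (intro AE_I2 tendsto_mult tendsto_const)
        fix u :: 'a
        have t: "(\<lambda>k. x + (1 / real (Suc k)) *\<^sub>R u) \<longlonglongrightarrow> x + 0 *\<^sub>R u"
          by (intro tendsto_intros) real_asymp
        show "(\<lambda>k. indicator ?U (x + (1 / real (Suc k)) *\<^sub>R u) :: real) \<longlonglongrightarrow> indicator ?U x"
        proof (cases "x \<in> ?U")
          case True
          have "\<forall>\<^sub>F k in sequentially. x + (1 / real (Suc k)) *\<^sub>R u \<in> ?U"
            using t True by (intro topological_tendstoD[OF t]) auto
          then show ?thesis using True by (intro tendsto_eventually) (auto elim: eventually_mono)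
        next
          case False
          then have "x \<in> - closure ?U" using that interior_open[OF open_box, of a b] by (auto simp: frontier_def)
          then have "\<forall>\<^sub>F k in sequentially. x + (1 / real (Suc k)) *\<^sub>R u \<in> - closure ?U"
            using t by (intro topological_tendstoD[OF t]) auto
          then have "\<forall>\<^sub>F k in sequentially. x + (1 / real (Suc k)) *\<^sub>R u \<notin> ?U"
            using closure_subset by (auto elim!: eventually_mono)
          then show ?thesis using False by (intro tendsto_eventually) (auto elim: eventually_mono)
        qed
      qed
    qed (use gauss in \<open>auto simp: mult_left_le_one_le split: split_indicator\<close>)
    then show ?thesis by (simp add: I_def)
  qed
  have fr: "AE x in lborel. x \<notin> frontier ?U"
  proof -
    have "frontier ?U \<in> null_sets lborel"
      using negligible_convex_frontier[OF convex_box(2), of a b]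
      by (simp add: negligible_iff_null_sets null_sets_completion_iff)
    then show ?thesis by (rule AE_not_in)
  qed
  have Qm: "Q k \<in> borel_measurable lborel" for k
    unfolding Q_def by measurable
  have Qb: "\<bar>Q k x\<bar> \<le> I" for k x
  proof -
    have "norm (Q k x) \<le> I" unfolding Q_def I_def
      by (rule Bochner_Integration.integral_norm_bound_integral) (auto intro!: Bochner_Integration.integrable_bound[OF gauss] split: split_indicator)
    then show ?thesis by simp
  qed
  have "(\<lambda>k. \<integral>x. g x * Q k x \<partial>lborel) \<longlonglongrightarrow> (\<integral>x. g x * (indicator ?U x * I) \<partial>lborel)"
  proof (rule integral_dominated_convergence[where w = "\<lambda>x. \<bar>g x\<bar> * I"])
    show "AE x in lborel. (\<lambda>k. g x * Q k x) \<longlonglongrightarrow> g x * (indicator ?U x * I)"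
      using fr by eventually_elim (intro tendsto_intros Qlim)
    show "(\<lambda>x. g x * Q k x) \<in> borel_measurable lborel" for k using Qm by measurable
    show "AE x in lborel. norm (g x * Q k x) \<le> \<bar>g x\<bar> * I" for k
      using Qb by (auto simp: abs_mult intro!: mult_left_mono)
    show "integrable lborel (\<lambda>x. \<bar>g x\<bar> * I)" using int by simp
  qed measurable
  then have "(\<integral>x. g x * (indicator ?U x * I) \<partial>lborel) = 0"
    unfolding Q0 by (simp add: LIMSEQ_const_iff)
  then have "(\<integral>x. g x * indicator ?U x \<partial>lborel) * I = 0"
    by (simp add: mult.assoc[symmetric])
  then show "(\<integral>x. g x * indicator ?U x \<partial>lborel) = 0" using Ipos by simp
qed

text \<open>A Gaussian of any width is a superposition of exponentials by
  \<open>gauss_fourier\<close>. Fubini then shows that all Gaussian convolutions of \<open>G\<close>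
  vanish, and real and imaginary part can be treated separately.\<close>

lemma fourier_zero_imp_AE_zero:
  fixes G :: "real ^ 'n::finite \<Rightarrow> complex"
  assumes int: "integrable lborel G"
    and 0: "\<And>\<eta>. (\<integral>x. G x * exp (\<i> * of_real (x \<bullet> \<eta>)) \<partial>lborel) = 0"
  shows "AE x in lborel. G x = 0"
proof -
  have [measurable]: "G \<in> borel_measurable borel" using int by (auto simp: borel_measurable_integrable)
  have gauss: "integrable lborel (\<lambda>u :: real ^ 'n. exp (- (norm u)\<^sup>2 / 2))"
    using integrable_gauss_vec[of "1 / 2"] by simp
  have conv: "(\<integral>x. G x * of_real (exp (- (norm ((w - x) /\<^sub>R \<sigma>))\<^sup>2 / 2)) \<partial>lborel) = 0" if "\<sigma> > 0" for w \<sigma>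
  proof -
    let ?K = "\<lambda>x \<eta>. G x * (exp (\<i> * of_real (((w - x) /\<^sub>R \<sigma>) \<bullet> \<eta>)) * of_real (exp (- (norm \<eta>)\<^sup>2 / 2)))"
    have K: "integrable (lborel \<Otimes>\<^sub>M lborel) (case_prod ?K)"
    proof (rule Bochner_Integration.integrable_bound)
      show "integrable (lborel \<Otimes>\<^sub>M lborel) (\<lambda>(x, \<eta> :: real ^ 'n). norm (G x) * exp (- (norm \<eta>)\<^sup>2 / 2))"
        by (rule integrable_pair_mult[OF integrable_norm[OF int] gauss])
      show "AE p in lborel \<Otimes>\<^sub>M lborel. norm (case_prod ?K p) \<le> norm (case p of (x, \<eta> :: real ^ 'n) \<Rightarrow> norm (G x) * exp (- (norm \<eta>)\<^sup>2 / 2))"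
        by (auto simp: norm_mult)
    qed measurable
    \<comment> \<open>After the factors free of x are taken out, the Fourier integral of
      \<open>G\<close> at -\<eta>/\<sigma> remains.\<close>
    have z: "(\<integral>x. ?K x \<eta> \<partial>lborel) = 0" for \<eta>
    proof -
      have "?K x \<eta> = (exp (\<i> * of_real ((w /\<^sub>R \<sigma>) \<bullet> \<eta>)) * of_real (exp (- (norm \<eta>)\<^sup>2 / 2))) *
        (G x * exp (\<i> * of_real (x \<bullet> (- (\<eta> /\<^sub>R \<sigma>)))))" for x
      proof -
        have E: "\<i> * complex_of_real (((w - x) /\<^sub>R \<sigma>) \<bullet> \<eta>) =
          \<i> * of_real ((w /\<^sub>R \<sigma>) \<bullet> \<eta>) + \<i> * of_real (x \<bullet> (- (\<eta> /\<^sub>R \<sigma>)))"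
          by (simp add: inner_diff_left algebra_simps)
        show ?thesis unfolding E exp_add by (simp only: mult_ac)
      qed
      then have "(\<integral>x. ?K x \<eta> \<partial>lborel) = (exp (\<i> * of_real ((w /\<^sub>R \<sigma>) \<bullet> \<eta>)) * of_real (exp (- (norm \<eta>)\<^sup>2 / 2))) *
        (\<integral>x. G x * exp (\<i> * of_real (x \<bullet> (- (\<eta> /\<^sub>R \<sigma>)))) \<partial>lborel)"
        by (simp only: integral_mult_right_zero)
      then show ?thesis unfolding 0 by simp
    qed
    have "(\<integral>x. G x * of_real (sqrt (2 * pi) ^ CARD('n) * exp (- (norm ((w - x) /\<^sub>R \<sigma>))\<^sup>2 / 2)) \<partial>lborel) =
      (\<integral>x. (\<integral>\<eta>. ?K x \<eta> \<partial>lborel) \<partial>lborel)"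
      by (simp only: integral_mult_right_zero gauss_fourier)
    also have "\<dots> = (\<integral>\<eta>. (\<integral>x. ?K x \<eta> \<partial>lborel) \<partial>lborel)"
      by (rule lborel_pair.Fubini_integral[OF K, symmetric])
    also have "\<dots> = 0" unfolding z by simp
    finally have "of_real (sqrt (2 * pi) ^ CARD('n)) * (\<integral>x. G x * of_real (exp (- (norm ((w - x) /\<^sub>R \<sigma>))\<^sup>2 / 2)) \<partial>lborel) = 0"
      unfolding integral_mult_right_zero[symmetric] by (simp add: mult_ac)
    then show ?thesis by simp
  qed
  have int': "integrable lborel (\<lambda>x. G x * of_real (exp (- (norm ((w - x) /\<^sub>R \<sigma>))\<^sup>2 / 2)))" for w \<sigma>
    by (rule Bochner_Integration.integrable_bound[OF int]) (auto simp: norm_mult mult_left_le)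
  have "AE x in lborel. Re (G x) = 0"
  proof (rule gaussian_convolution_zero_imp_AE_zero[OF _ _ gauss])
    fix w :: "real ^ 'n" and \<sigma> :: real assume "\<sigma> > 0"
    from arg_cong[OF conv[OF this, of w], of Re]
    show "(\<integral>x. Re (G x) * exp (- (norm ((w - x) /\<^sub>R \<sigma>))\<^sup>2 / 2) \<partial>lborel) = 0"
      by (subst (asm) integral_Re[symmetric, OF int']) simp
  qed (use int in simp)
  moreover have "AE x in lborel. Im (G x) = 0"
  proof (rule gaussian_convolution_zero_imp_AE_zero[OF _ _ gauss])
    fix w :: "real ^ 'n" and \<sigma> :: real assume "\<sigma> > 0"
    from arg_cong[OF conv[OF this, of w], of Im]
    show "(\<integral>x. Im (G x) * exp (- (norm ((w - x) /\<^sub>R \<sigma>))\<^sup>2 / 2) \<partial>lborel) = 0"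
      by (subst (asm) integral_Im[symmetric, OF int']) simp
  qed (use int in simp)
  ultimately show ?thesis by eventually_elim (simp add: complex_eq_iff)
qed

text \<open>Integrating the generating function termwise shows that the integral of g(x) exp(<x,z> -
  |x|^2/2) is 0 for all complex z. At z = i\<eta> this is the Fourier transform of the integrable
  function g exp(-|x|^2/2).\<close>

lemma hermiten_complete:
  fixes g :: "real ^ 'n::finite \<Rightarrow> complex"
  assumes g: "g \<in> L2" and 0: "\<And>\<beta>. (\<integral>x. g x * of_real (hermiten \<beta> x) \<partial>lborel) = 0"
  shows "AE x in lborel. g x = 0"
proof -
  have [measurable]: "g \<in> borel_measurable borel" using g by (auto simp: L2_def)
  have zero: "(\<integral>x. g x * exp (\<Sum>j\<in>UNIV. of_real (x $ j) * z $ j - of_real ((x $ j)\<^sup>2 / 2)) \<partial>lborel) = 0"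
    for z :: "complex ^ 'n"
  proof -
    let ?f = "\<lambda>\<alpha> x. g x * of_real (hermiten \<alpha> x) * (mpow z \<alpha> / of_real (herm_norm \<alpha>))"
    let ?E = "\<lambda>x. \<Sum>j\<in>UNIV. of_real (x $ j) * z $ j - (z $ j)\<^sup>2 / 4 - of_real ((x $ j)\<^sup>2 / 2)"
    \<comment> \<open>A bound, independent of \<alpha>, for the integral of |g h_\<alpha>|; the 1 is
      the squared norm of h_\<alpha>.\<close>
    define N where "N = (\<integral>x. (cmod (g x))\<^sup>2 \<partial>lborel) + 1"
    define T where "T = norm z + 1"
    have T: "T > 0" unfolding T_def by (simp add: add_nonneg_pos)
    have mz: "cmod (mpow z \<alpha>) \<le> T ^ (\<Sum>j\<in>UNIV. \<alpha> j)" for \<alpha>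
    proof -
      have "cmod (z $ j) \<le> T" for j
        using Finite_Cartesian_Product.norm_nth_le[of z j] unfolding T_def by linarith
      then have "cmod (mpow z \<alpha>) \<le> (\<Prod>j\<in>UNIV. T ^ \<alpha> j)"
        unfolding mpow_def prod_norm[symmetric] norm_power by (intro prod_mono conjI power_mono) auto
      then show ?thesis by (simp add: power_sum)
    qed
    have "((\<lambda>\<alpha>. integral\<^sup>L lborel (?f \<alpha>)) has_sum
        (\<integral>x. g x * (of_real (pi powr (- (real CARD('n) / 4))) * exp (?E x)) \<partial>lborel)) UNIV"
    proof (rule has_sum_lebesgue_integral(2)[OF infinite_multi_indices])
      show "integrable lborel (?f \<alpha>)" for \<alpha>
        by (intro integrable_mult_left L2_times_real_integrable(1)[OF g] hermiten_orthonormal) measurable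
      show "(\<lambda>\<alpha>. \<integral>x. norm (?f \<alpha> x) \<partial>lborel) summable_on UNIV"
      proof (rule summable_on_comparison_test)
        show "(\<lambda>\<alpha>. N * (T ^ (\<Sum>j\<in>UNIV. \<alpha> j) / herm_norm \<alpha>)) summable_on (UNIV :: ('n \<Rightarrow> nat) set)"
          by (intro summable_on_cmult_right summable_power_over_herm_norm T)
        fix \<alpha> :: "'n \<Rightarrow> nat"
        have "(\<integral>x. norm (?f \<alpha> x) \<partial>lborel) =
          (\<integral>x. norm (g x * of_real (hermiten \<alpha> x)) \<partial>lborel) * (cmod (mpow z \<alpha>) / herm_norm \<alpha>)"
          using herm_norm_pos[of \<alpha>] unfolding norm_mult[of _ "_ / _"] by (simp add: norm_divide)
        also have "\<dots> \<le> N * (T ^ (\<Sum>j\<in>UNIV. \<alpha> j) / herm_norm \<alpha>)"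
        proof (rule mult_mono)
          show "(\<integral>x. norm (g x * of_real (hermiten \<alpha> x)) \<partial>lborel) \<le> N"
            using L2_times_real_integrable(2)[OF g, of "hermiten \<alpha>"] by (simp add: hermiten_orthonormal N_def)
          show "N \<ge> 0" unfolding N_def by (intro add_nonneg_nonneg integral_nonneg) auto
        qed (use mz herm_norm_pos[of \<alpha>] in \<open>auto intro!: divide_right_mono\<close>)
        finally show "(\<integral>x. norm (?f \<alpha> x) \<partial>lborel) \<le> N * (T ^ (\<Sum>j\<in>UNIV. \<alpha> j) / herm_norm \<alpha>)" .
      qed auto
      fix x :: "real ^ 'n"
      show "(\<lambda>\<alpha>. norm (?f \<alpha> x)) summable_on UNIV"
        unfolding mult.assoc norm_mult[of "g x"]
        by (intro summable_on_cmult_right hermiten_generating(1))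
      show "((\<lambda>\<alpha>. ?f \<alpha> x) has_sum g x * (of_real (pi powr (- (real CARD('n) / 4))) * exp (?E x))) UNIV"
        unfolding mult.assoc by (intro has_sum_cmult_right hermiten_generating(2))
    qed
    moreover have "integral\<^sup>L lborel (?f \<alpha>) = 0" for \<alpha> using 0 by simp
    ultimately have "((\<lambda>\<alpha>::'n \<Rightarrow> nat. 0) has_sum
        (\<integral>x. g x * (of_real (pi powr (- (real CARD('n) / 4))) * exp (?E x)) \<partial>lborel)) UNIV" by (simp only:)
    then have "(\<integral>x. g x * (of_real (pi powr (- (real CARD('n) / 4))) * exp (?E x)) \<partial>lborel) = 0"
      using has_sum_unique[OF _ has_sum_0] by blast
    moreover have "g x * (of_real (pi powr (- (real CARD('n) / 4))) * exp (?E x)) =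
      (of_real (pi powr (- (real CARD('n) / 4))) * exp (- (\<Sum>j\<in>UNIV. (z $ j)\<^sup>2 / 4))) *
       (g x * exp (\<Sum>j\<in>UNIV. of_real (x $ j) * z $ j - of_real ((x $ j)\<^sup>2 / 2)))" for x
    proof -
      have E: "?E x = - (\<Sum>j\<in>UNIV. (z $ j)\<^sup>2 / 4) + (\<Sum>j\<in>UNIV. of_real (x $ j) * z $ j - of_real ((x $ j)\<^sup>2 / 2))"
        by (simp add: sum_subtractf)
      show ?thesis unfolding E exp_add by (simp only: mult_ac)
    qed
    ultimately have "(of_real (pi powr (- (real CARD('n) / 4))) * exp (- (\<Sum>j\<in>UNIV. (z $ j)\<^sup>2 / 4))) *
       (\<integral>x. g x * exp (\<Sum>j\<in>UNIV. of_real (x $ j) * z $ j - of_real ((x $ j)\<^sup>2 / 2)) \<partial>lborel) = 0"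
      by (simp only: integral_mult_right_zero)
    then show ?thesis by simp
  qed
  let ?G = "\<lambda>x. g x * of_real (exp (- (norm x)\<^sup>2 / 2))"
  have "AE x in lborel. ?G x = 0"
  proof (rule fourier_zero_imp_AE_zero)
    have eq: "exp (- (norm x)\<^sup>2 / 2) * exp (- (norm x)\<^sup>2 / 2) = exp (- 1 * (norm x)\<^sup>2)" for x :: "real ^ 'n"
      unfolding exp_add[symmetric] by simp
    show "integrable lborel ?G"
      by (rule L2_times_real_integrable(1)[OF g]) (unfold eq, measurable, rule integrable_gauss_vec, simp)
    fix \<eta> :: "real ^ 'n"
    have "?G x * exp (\<i> * of_real (x \<bullet> \<eta>)) =
       g x * exp (\<Sum>j\<in>UNIV. of_real (x $ j) * (\<chi> j. \<i> * of_real (\<eta> $ j)) $ j - of_real ((x $ j)\<^sup>2 / 2))" for x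
    proof -
      have "(\<Sum>j\<in>UNIV. of_real (x $ j) * (\<chi> j. \<i> * of_real (\<eta> $ j)) $ j - of_real ((x $ j)\<^sup>2 / 2)) =
        of_real (- (norm x)\<^sup>2 / 2) + \<i> * of_real (x \<bullet> \<eta>)"
        unfolding norm_vec_sum inner_vec_def
        by (simp add: sum_subtractf sum_distrib_left sum_divide_distrib algebra_simps)
      then show ?thesis by (simp only: exp_add exp_of_real mult.assoc)
    qed
    then show "(\<integral>x. ?G x * exp (\<i> * of_real (x \<bullet> \<eta>)) \<partial>lborel) = 0" by (simp only: zero)
  qed
  then show ?thesis by eventually_elim simp
qed

section \<open>Bounded densities and moments over polydiscs\<close>

lemma gevrey_continuous: "g \<in> gevrey s \<Longrightarrow> continuous_on UNIV g"
proof -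
  assume "g \<in> gevrey s"
  then have "iter_partial [] g differentiable_on UNIV"
    unfolding gevrey_def smooth_def by (metis (mono_tags, lifting) empty_subsetI list.set(1) mem_Collect_eq)
  then show ?thesis by (simp add: differentiable_imp_continuous_on)
qed

lemma mi_deriv_0: "mi_deriv (\<lambda>_. 0) g = g"
proof -
  obtain bs :: "'a list" where bs: "set bs \<subseteq> Basis" "\<And>b. b \<in> Basis \<Longrightarrow> count_list bs b = 0"
    and eq: "\<And>g. mi_deriv (\<lambda>_. 0) g = (iter_partial bs g :: 'a \<Rightarrow> 'b)"
    by (rule mi_deriv_eqE[of "\<lambda>_. 0"]) blast
  have "bs = []"
  proof (cases bs)
    case (Cons b bs')
    then show ?thesis using bs(1) bs(2)[of b] by simp
  qed simp
  then show ?thesis by (simp add: eq)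
qed

text \<open>The complement of the support is a union of possibly uncountably many open sets on which
  \<open>F\<close> vanishes almost everywhere; the Lindelof property leaves countably many of
  them.\<close>

lemma AE_outside_ess_support:
  fixes F :: "'a::euclidean_space \<Rightarrow> complex"
  shows "AE x in lborel. x \<notin> ess_support F \<longrightarrow> F x = 0"
proof -
  define U where "U = {U. open U \<and> (AE x in lborel. x \<in> U \<longrightarrow> F x = 0)}"
  obtain V where V: "V \<subseteq> U" "countable V" "\<Union>V = \<Union>U"
    using Lindelof[of U] unfolding U_def by blast
  have "AE x in lborel. \<forall>W\<in>V. x \<in> W \<longrightarrow> F x = 0"
    using V by (subst AE_ball_countable) (auto simp: U_def)
  then show ?thesis
  proof eventually_elim
    case (elim x)
    then show ?case using V(3) by (auto simp: ess_support_def U_def[symmetric])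
  qed
qed

text \<open>The term of order 0 in the Gevrey norm is the supremum of |g| over the support, whatever
  h is. Hence one constant serves all h.\<close>

lemma regular_in_gevrey_dual:
  fixes F :: "'a::euclidean_space \<Rightarrow> complex"
  assumes F: "F \<in> Linf_compact"
  shows "regular F \<in> gevrey_dual s"
proof -
  let ?K = "ess_support F"
  obtain C where [measurable]: "F \<in> borel_measurable borel" and C: "AE x in lborel. cmod (F x) \<le> C"
    and K: "compact ?K" using F by (auto simp: Linf_compact_def)
  have Km[measurable]: "?K \<in> sets borel" using K by (simp add: borel_compact)
  have fin: "emeasure lborel ?K < \<infinity>" using K by (rule emeasure_compact_finite)
  \<comment> \<open>The summand 1 makes \<open>D\<close> positive even when \<open>F\<close>
    vanishes. The definition of the dual asks for this, and it makes the product with an infinite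
    Gevrey norm infinite.\<close>
  define D where "D = max C 0 * measure lborel ?K + 1"
  have D: "D > 0" unfolding D_def by (intro add_nonneg_pos mult_nonneg_nonneg) auto
  have bd: "integrable lborel (\<lambda>x. F x * g x)" "cmod (regular F g) \<le> D * B"
    if g: "continuous_on UNIV g" and B: "\<And>x. x \<in> ?K \<Longrightarrow> cmod (g x) \<le> B" and B0: "B \<ge> 0" for g B
  proof -
    have [measurable]: "g \<in> borel_measurable borel" using g by (rule borel_measurable_continuous_onI)
    have i: "integrable lborel (\<lambda>x. max C 0 * B * indicator ?K x)"
      using fin by (intro integrable_mult_right integrable_real_indicator) auto
    have le: "AE x in lborel. norm (F x * g x) \<le> max C 0 * B * indicator ?K x"
      using C AE_outside_ess_support[of F]
    proof eventually_elim
      case (elim x)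
      show ?case
      proof (cases "x \<in> ?K")
        case True
        then show ?thesis using elim B[OF True] B0 by (auto simp: norm_mult intro!: mult_mono)
      qed (use elim in auto)
    qed
    show int: "integrable lborel (\<lambda>x. F x * g x)"
      by (rule Bochner_Integration.integrable_bound[OF i]) (use le in \<open>auto elim!: eventually_mono\<close>)
    have "cmod (regular F g) \<le> (\<integral>x. norm (F x * g x) \<partial>lborel)"
      unfolding regular_def by (rule integral_norm_bound)
    also have "\<dots> \<le> (\<integral>x. max C 0 * B * indicator ?K x \<partial>lborel)"
      by (rule integral_mono_AE[OF integrable_norm[OF int] i le])
    also have "\<dots> = max C 0 * B * measure lborel ?K" by simp
    also have "\<dots> \<le> D * B" using B0 by (simp add: D_def algebra_simps)
    finally show "cmod (regular F g) \<le> D * B" .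
  qed
  have bdd: "\<exists>B\<ge>0. \<forall>x\<in>?K. cmod (g x) \<le> B" if "continuous_on UNIV g" for g :: "'a \<Rightarrow> complex"
  proof -
    have "compact (g ` ?K)" using K that by (intro compact_continuous_image) (auto intro: continuous_on_subset)
    then obtain B where "\<forall>y\<in>g ` ?K. norm y \<le> B" using compact_imp_bounded bounded_iff by blast
    then show ?thesis by (intro exI[of _ "max B 0"]) force
  qed
  have int: "integrable lborel (\<lambda>x. F x * g x)" if "g \<in> gevrey s" for g
    using bdd[OF gevrey_continuous[OF that]] bd(1)[OF gevrey_continuous[OF that]] by blast
  have "linear_functional_on (gevrey s) (regular F)"
    unfolding linear_functional_on_def
  proof (intro conjI ballI allI)
    fix g k :: "'a \<Rightarrow> complex" assume "g \<in> gevrey s" "k \<in> gevrey s"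
    then show "regular F (\<lambda>x. g x + k x) = regular F g + regular F k"
      unfolding regular_def distrib_left by (intro Bochner_Integration.integral_add int)
  next
    fix c and g :: "'a \<Rightarrow> complex"
    show "regular F (\<lambda>x. c * g x) = c * regular F g"
      unfolding regular_def mult.left_commute[of _ c] by (rule integral_mult_right_zero)
  qed
  moreover have "ennreal (cmod (regular F g)) \<le> ennreal D * gevrey_norm s h ?K g"
    if g: "g \<in> gevrey s" for g h
  proof (cases "gevrey_norm s h ?K g")
    case (real B)
    have "cmod (g x) \<le> B" if x: "x \<in> ?K" for x
    proof -
      have "ennreal (cmod (mi_deriv (\<lambda>_. 0) g x) / (h ^ mi_length (\<lambda>_ :: 'a. 0) * mi_fact (\<lambda>_ :: 'a. 0) powr s))
         \<le> gevrey_norm s h ?K g"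
        unfolding gevrey_norm_def
        by (rule SUP_upper2[OF x], rule SUP_upper[of "\<lambda>_. 0" UNIV
          "\<lambda>\<alpha>. ennreal (cmod (mi_deriv \<alpha> g x) / (h ^ mi_length \<alpha> * mi_fact \<alpha> powr s))"]) simp
      then have "ennreal (cmod (g x)) \<le> ennreal B"
        unfolding real by (simp add: mi_deriv_0 mi_length_def mi_fact_def)
      then show ?thesis using real by simp
    qed
    then have "cmod (regular F g) \<le> D * B"
      using real by (intro bd gevrey_continuous[OF g])
    then show ?thesis unfolding real using real D by (simp add: ennreal_mult[symmetric])
  next
    case top
    then show ?thesis using D by (simp add: ennreal_mult_top)
  qed
  ultimately show ?thesis using K D unfolding gevrey_dual_def by blast
qed

section \<open>Shears and rotations preserve Lebesgue measure\<close>

text \<open>On every fibre with fixed first component the shear is a translation, so Fubini reduces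
  the claim to translation invariance.\<close>

lemma lborel_shear_snd:
  fixes h :: "'a::euclidean_space \<Rightarrow> 'a"
  assumes [measurable]: "h \<in> borel_measurable borel"
  shows "distr lborel borel (\<lambda>p. (fst p, snd p + h (fst p))) = (lborel :: ('a \<times> 'a) measure)"
proof (rule measure_eqI)
  have b: "(borel :: ('a \<times> 'a) measure) = borel \<Otimes>\<^sub>M borel" by (simp add: borel_prod)
  have t[measurable]: "(\<lambda>p. (fst p, snd p + h (fst p))) \<in> borel \<rightarrow>\<^sub>M (borel :: ('a \<times> 'a) measure)"
    unfolding b by measurable
  show "sets (distr lborel borel (\<lambda>p. (fst p, snd p + h (fst p)))) = sets (lborel :: ('a \<times> 'a) measure)" by simp
  fix A assume "A \<in> sets (distr lborel borel (\<lambda>p. (fst p, snd p + h (fst p))))"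
  then have A[measurable]: "A \<in> sets (borel \<Otimes>\<^sub>M borel)" unfolding borel_prod by simp
  have "emeasure (distr lborel borel (\<lambda>p. (fst p, snd p + h (fst p)))) A =
     (\<integral>\<^sup>+p. indicator A (fst p, snd p + h (fst p)) \<partial>(lborel \<Otimes>\<^sub>M lborel))"
  proof -
    have A': "A \<in> sets borel" using A unfolding borel_prod .
    have "emeasure (distr lborel borel (\<lambda>p. (fst p, snd p + h (fst p)))) A =
        (\<integral>\<^sup>+p. indicator A p \<partial>distr lborel borel (\<lambda>p. (fst p, snd p + h (fst p))))"
      using A' by (subst nn_integral_indicator) simp_all
    also have "\<dots> = (\<integral>\<^sup>+p. indicator A (fst p, snd p + h (fst p)) \<partial>lborel)"
      using A' t by (subst nn_integral_distr) auto
    finally show ?thesis unfolding lborel_prod .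
  qed
  also have "\<dots> = (\<integral>\<^sup>+x. (\<integral>\<^sup>+y. indicator A (x, y + h x) \<partial>lborel) \<partial>lborel)"
    by (subst lborel.nn_integral_fst[symmetric]) auto
  also have "\<dots> = (\<integral>\<^sup>+x. (\<integral>\<^sup>+y. indicator A (x, y) \<partial>lborel) \<partial>lborel)"
  proof (rule nn_integral_cong)
    fix x
    have "(\<integral>\<^sup>+y. indicator A (x, y) \<partial>lborel) = (\<integral>\<^sup>+y. indicator A (x, y) \<partial>distr lborel borel ((+) (h x)))"
      by (simp add: lborel_distr_plus)
    also have "\<dots> = (\<integral>\<^sup>+y. indicator A (x, y + h x) \<partial>lborel)"
      by (subst nn_integral_distr) (auto simp: add.commute)
    finally show "(\<integral>\<^sup>+y. indicator A (x, y + h x) \<partial>lborel) = (\<integral>\<^sup>+y. indicator A (x, y) \<partial>lborel)" by simp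
  qed
  also have "\<dots> = (\<integral>\<^sup>+p. indicator A p \<partial>(lborel \<Otimes>\<^sub>M lborel))"
    by (subst lborel.nn_integral_fst[symmetric]) auto
  also have "\<dots> = emeasure lborel A"
    using A unfolding lborel_prod borel_prod by (intro nn_integral_indicator) simp
  finally show "emeasure (distr lborel borel (\<lambda>p. (fst p, snd p + h (fst p)))) A = emeasure lborel A" .
qed

lemma lborel_swap: "distr lborel borel (\<lambda>p. (snd p, fst p)) = (lborel :: ('a::euclidean_space \<times> 'a) measure)"
proof -
  have "distr (lborel \<Otimes>\<^sub>M lborel) (lborel \<Otimes>\<^sub>M lborel) (\<lambda>(x, y). (y, x)) = (lborel \<Otimes>\<^sub>M lborel :: ('a \<times> 'a) measure)"
    by (rule lborel_pair.distr_pair_swap[symmetric])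
  then have "distr lborel lborel (\<lambda>p. (snd p, fst p)) = (lborel :: ('a \<times> 'a) measure)"
    unfolding lborel_prod case_prod_unfold .
  moreover have "distr lborel lborel (\<lambda>p. (snd p, fst p)) = distr lborel borel (\<lambda>p :: 'a \<times> 'a. (snd p, fst p))"
    by (rule distr_cong) auto
  ultimately show ?thesis by simp
qed

lemma lborel_shear_fst:
  fixes h :: "'a::euclidean_space \<Rightarrow> 'a"
  assumes [measurable]: "h \<in> borel_measurable borel"
  shows "distr lborel borel (\<lambda>p. (fst p + h (snd p), snd p)) = (lborel :: ('a \<times> 'a) measure)"
proof -
  have b: "(borel :: ('a \<times> 'a) measure) = borel \<Otimes>\<^sub>M borel" by (simp add: borel_prod)
  have t[measurable]: "(\<lambda>p. (fst p, snd p + h (fst p))) \<in> borel \<rightarrow>\<^sub>M (borel :: ('a \<times> 'a) measure)"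
    "(\<lambda>p. (snd p, fst p)) \<in> borel \<rightarrow>\<^sub>M (borel :: ('a \<times> 'a) measure)"
    unfolding b by measurable
  have "lborel = distr (distr (distr lborel borel (\<lambda>p. (snd p, fst p))) borel (\<lambda>p. (fst p, snd p + h (fst p)))) borel
      (\<lambda>p. (snd p, fst p :: 'a))"
    unfolding lborel_swap lborel_shear_snd[OF assms] ..
  also have "\<dots> = distr lborel borel (\<lambda>p. (fst p + h (snd p), snd p))"
    by (subst distr_distr, measurable, subst distr_distr, measurable) (simp add: o_def)
  finally show ?thesis by simp
qed

text \<open>Multiplication of the j-th complex coordinate by \<open>u\<close>, written as the
  identity plus a correction along one axis to match the shape of the shears.\<close>

definition rotate_coord :: "'n \<Rightarrow> complex \<Rightarrow> 'n phase \<Rightarrow> 'n::finite phase" where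
  "rotate_coord j u p =
     (fst p + ((Re u - 1) * (fst p $ j) - Im u * (snd p $ j)) *\<^sub>R axis j 1,
      snd p + ((Re u - 1) * (snd p $ j) + Im u * (fst p $ j)) *\<^sub>R axis j 1)"

lemma rotate_coord_cpair:
  "cpair (fst (rotate_coord j u p)) (snd (rotate_coord j u p)) $ i =
     (if i = j then u else 1) * cpair (fst p) (snd p) $ i"
  by (simp add: rotate_coord_def cpair_def axis_def complex_eq_iff algebra_simps)

text \<open>A rotation other than the half-turn is a composition of three shears, which preserve the
  measure by translation invariance.\<close>

lemma lborel_rotate_coord:
  assumes u: "cmod u = 1" "Re u \<noteq> -1"
  shows "distr lborel borel (rotate_coord j u) = (lborel :: 'n::finite phase measure)"
    "rotate_coord j u \<in> borel \<rightarrow>\<^sub>M borel"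
proof -
  \<comment> \<open>For u = exp(i\<theta>) this is -tan(\<theta>/2). The rotation is the shear by
    \<open>a\<close> in y, then by sin \<theta> in \<eta>, then by \<open>a\<close> in y again; the
    tangent is infinite exactly at the half-turn.\<close>
  define a where "a = - Im u / (1 + Re u)"
  have n: "(Re u)\<^sup>2 + (Im u)\<^sup>2 = 1" using u by (simp add: cmod_def)
  have u1: "1 + Re u \<noteq> 0" using u(2) by linarith
  have ab: "1 + a * Im u = Re u" "a * (1 + Re u) = - Im u"
  proof -
    show "a * (1 + Re u) = - Im u" using u1 by (simp add: a_def)
    have "(1 + a * Im u - Re u) * (1 + Re u) = 1 - (Re u)\<^sup>2 - (Im u)\<^sup>2"
      using u1 by (simp add: a_def field_simps power2_eq_square)
    also have "\<dots> = 0" using n by simp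
    finally show "1 + a * Im u = Re u" using u1 by simp
  qed
  define hx hy where "hx \<eta> = (a * (\<eta> $ j)) *\<^sub>R axis j (1::real)" and
    "hy \<eta> = (Im u * (\<eta> $ j)) *\<^sub>R axis j (1::real)" for \<eta> :: "real ^ 'n"
  define X where "X p = (fst p + hx (snd p), snd p)" for p
  define Y where "Y p = (fst p, snd p + hy (fst p))" for p
  have hm[measurable]: "hx \<in> borel_measurable borel" "hy \<in> borel_measurable borel"
    unfolding hx_def[abs_def] hy_def[abs_def] by (intro borel_measurable_continuous_onI continuous_intros)+
  have b: "(borel :: 'n phase measure) = borel \<Otimes>\<^sub>M borel" by (simp add: borel_prod)
  have m[measurable]: "X \<in> borel \<rightarrow>\<^sub>M borel" "Y \<in> borel \<rightarrow>\<^sub>M borel"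
    unfolding X_def[abs_def] Y_def[abs_def] b by measurable
  have eq: "rotate_coord j u = X \<circ> (Y \<circ> X)"
  proof
    fix p :: "'n phase"
    let ?y = "fst p $ j" and ?\<eta> = "snd p $ j"
    have ab': "a * Im u = Re u - 1" using ab(1) by simp
    have "Im u * (?y + a * ?\<eta>) = (a * Im u) * ?\<eta> + Im u * ?y" by (simp add: algebra_simps)
    then have 2: "Im u * (?y + a * ?\<eta>) = (Re u - 1) * ?\<eta> + Im u * ?y" unfolding ab' .
    have "a * ?\<eta> + a * (?\<eta> + Im u * (?y + a * ?\<eta>)) = a * (1 + Re u) * ?\<eta> + (a * Im u) * ?y"
      unfolding 2 by (simp add: algebra_simps)
    also have "\<dots> = (Re u - 1) * ?y - Im u * ?\<eta>" unfolding ab(2) ab' by simp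
    finally have 3: "a * ?\<eta> + a * (?\<eta> + Im u * (?y + a * ?\<eta>)) = (Re u - 1) * ?y - Im u * ?\<eta>" .
    show "rotate_coord j u p = (X \<circ> (Y \<circ> X)) p"
    proof -
      have "(X \<circ> (Y \<circ> X)) p = (fst p + (a * ?\<eta> + a * (?\<eta> + Im u * (?y + a * ?\<eta>))) *\<^sub>R axis j 1,
          snd p + (Im u * (?y + a * ?\<eta>)) *\<^sub>R axis j 1)"
        by (simp add: X_def Y_def hx_def hy_def scaleR_add_left add.assoc)
      also have "\<dots> = (fst p + ((Re u - 1) * ?y - Im u * ?\<eta>) *\<^sub>R axis j 1,
          snd p + (Im u * (?y + a * ?\<eta>)) *\<^sub>R axis j 1)" by (simp only: 3)
      also have "\<dots> = rotate_coord j u p" unfolding rotate_coord_def by (simp only: 2)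
      finally show ?thesis by simp
    qed
  qed
  show "distr lborel borel (rotate_coord j u) = (lborel :: 'n phase measure)"
  proof -
    have X: "distr lborel borel X = lborel" unfolding X_def[abs_def] by (rule lborel_shear_fst) measurable
    have Y: "distr lborel borel Y = lborel" unfolding Y_def[abs_def] by (rule lborel_shear_snd) measurable
    have "distr lborel borel (X \<circ> (Y \<circ> X)) = distr (distr (distr lborel borel X) borel Y) borel X"
      by (subst distr_distr, measurable, subst distr_distr, measurable) (simp add: o_assoc)
    then show ?thesis unfolding eq X Y .
  qed
  show "rotate_coord j u \<in> borel \<rightarrow>\<^sub>M borel" unfolding eq by measurable
qed

section \<open>Polydiscs and moments of monomials\<close>

text \<open>The contractions (1 - 1/(k+1)) z of a point of the closed polydisc lie in the open one,
  because all radii are positive, and they converge to z.\<close>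

lemma closure_polydisc:
  fixes r :: "real ^ 'n::finite"
  assumes r: "\<And>j. 0 < r $ j"
  shows "closure (polydisc r) = {z. \<forall>j. cmod (z $ j) \<le> r $ j}"
proof
  have "closed {z :: complex ^ 'n. \<forall>j. cmod (z $ j) \<le> r $ j}"
    by (intro closed_Collect_all closed_Collect_le continuous_intros)
  then show "closure (polydisc r) \<subseteq> {z. \<forall>j. cmod (z $ j) \<le> r $ j}"
    by (intro closure_minimal) (auto simp: polydisc_def less_imp_le)
  show "{z. \<forall>j. cmod (z $ j) \<le> r $ j} \<subseteq> closure (polydisc r)"
  proof
    fix z assume z: "z \<in> {z. \<forall>j. cmod (z $ j) \<le> r $ j}"
    have "(\<lambda>k. (1 - 1 / real (Suc k)) *\<^sub>R z) \<longlonglongrightarrow> (1 - 0) *\<^sub>R z"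
      by (intro tendsto_intros) real_asymp
    moreover have "(1 - 1 / real (Suc k)) *\<^sub>R z \<in> polydisc r" for k
      unfolding polydisc_def
    proof (intro CollectI allI)
      fix j
      have "(1 - 1 / real (Suc k)) * cmod (z $ j) \<le> (1 - 1 / real (Suc k)) * r $ j"
        using z by (intro mult_left_mono) auto
      also have "\<dots> < 1 * r $ j" using r[of j] by (intro mult_strict_right_mono) auto
      finally show "cmod (((1 - 1 / real (Suc k)) *\<^sub>R z) $ j) < r $ j" by simp
    qed
    ultimately show "z \<in> closure (polydisc r)"
      unfolding closure_sequential by (intro exI[of _ "\<lambda>k. (1 - 1 / real (Suc k)) *\<^sub>R z"]) auto
  qed
qed

abbreviation zc :: "'n::finite phase \<Rightarrow> complex ^ 'n" where
  "zc q \<equiv> cpair (fst q) (snd q)"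

lemma continuous_on_zc [continuous_intros]: "continuous_on S zc"
  unfolding cpair_def by (intro continuous_intros)

lemma zc_measurable [measurable]: "zc \<in> borel_measurable borel"
  by (intro borel_measurable_continuous_onI continuous_on_zc)

lemma continuous_on_mpow [continuous_intros]:
  "continuous_on S f \<Longrightarrow> continuous_on S (\<lambda>x. mpow (f x) \<alpha>)"
  unfolding mpow_def by (intro continuous_intros)

lemma mpow_measurable [measurable]: "(\<lambda>z. mpow z \<alpha>) \<in> borel_measurable borel"
  by (intro borel_measurable_continuous_onI continuous_intros)

lemma norm_mpow_le:
  fixes z :: "complex ^ 'n::finite"
  assumes "\<And>j. cmod (z $ j) \<le> r"
  shows "cmod (mpow z \<alpha>) \<le> r ^ (\<Sum>j\<in>UNIV. \<alpha> j)"
proof -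
  have "cmod (mpow z \<alpha>) \<le> (\<Prod>j\<in>UNIV. r ^ \<alpha> j)"
    unfolding mpow_def prod_norm[symmetric] norm_power using assms by (intro prod_mono conjI power_mono) auto
  then show ?thesis by (simp add: power_sum)
qed

lemma cmod_zc: "(cmod (zc q $ j))\<^sup>2 = (fst q $ j)\<^sup>2 + (snd q $ j)\<^sup>2"
  by (simp add: cpair_def cmod_power2)

lemma cnj_measurable [measurable]: "cnj \<in> borel_measurable borel"
  by (intro borel_measurable_continuous_onI continuous_intros)

definition phase_disc :: "real \<Rightarrow> 'n::finite phase set" where
  "phase_disc r = {q. \<forall>j. cmod (zc q $ j) \<le> r}"

lemma compact_phase_disc: "compact (phase_disc r :: 'n::finite phase set)"
proof (rule compact_eq_bounded_closed[THEN iffD2], intro conjI)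
  show "closed (phase_disc r :: 'n phase set)" unfolding phase_disc_def
    by (intro closed_Collect_all closed_Collect_le continuous_intros)
  show "bounded (phase_disc r :: 'n phase set)"
  proof (rule boundedI)
    fix q :: "'n phase" assume q: "q \<in> phase_disc r"
    have "\<bar>fst q $ j\<bar> \<le> r" "\<bar>snd q $ j\<bar> \<le> r" for j
      using q abs_Re_le_cmod[of "zc q $ j"] abs_Im_le_cmod[of "zc q $ j"]
      unfolding phase_disc_def by (auto simp: cpair_def intro: order_trans)
    then have "norm (fst q) \<le> (\<Sum>j\<in>(UNIV :: 'n set). r)" "norm (snd q) \<le> (\<Sum>j\<in>(UNIV :: 'n set). r)"
      using norm_le_l1_cart[of "fst q"] norm_le_l1_cart[of "snd q"]
        sum_mono[of UNIV "\<lambda>j. \<bar>fst q $ j\<bar>" "\<lambda>_. r"] sum_mono[of UNIV "\<lambda>j. \<bar>snd q $ j\<bar>" "\<lambda>_. r"] by auto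
    moreover have "norm q \<le> norm (fst q) + norm (snd q)"
      by (metis norm_Pair_le prod.collapse)
    ultimately show "norm q \<le> 2 * (\<Sum>j\<in>(UNIV :: 'n set). r)" by linarith
  qed
qed

lemma phase_disc_measurable [measurable]: "phase_disc r \<in> sets borel"
  by (rule borel_compact[OF compact_phase_disc])

text \<open>Inner products of monomials in a Bargmann-Fock type weight cut off to a polydisc.
  Cut-off and weight depend only on the moduli of the coordinates.\<close>

definition moment :: "real \<Rightarrow> ('n::finite \<Rightarrow> nat) \<Rightarrow> ('n \<Rightarrow> nat) \<Rightarrow> complex" where
  "moment r \<alpha> \<beta> = (\<integral>q. of_real (indicator (phase_disc r) q * exp (- (norm q)\<^sup>2 / 4)) *
      (mpow (zc q) \<alpha> * cnj (mpow (zc q) \<beta>)) \<partial>lborel)"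

lemma integrable_phase_disc:
  fixes f :: "'n::finite phase \<Rightarrow> complex"
  assumes [measurable]: "f \<in> borel_measurable borel" and bd: "\<And>q. q \<in> phase_disc r \<Longrightarrow> cmod (f q) \<le> B"
  shows "integrable lborel (\<lambda>q. of_real (indicator (phase_disc r) q * exp (- (norm q)\<^sup>2 / 4)) * f q)"
    "(\<integral>q. cmod (of_real (indicator (phase_disc r) q * exp (- (norm q)\<^sup>2 / 4)) * f q) \<partial>lborel) \<le> measure lborel (phase_disc r :: 'n phase set) * B"
proof -
  let ?g = "\<lambda>q. of_real (indicator (phase_disc r) q * exp (- (norm q)\<^sup>2 / 4)) * f q"
  have i: "integrable lborel (\<lambda>q. indicator (phase_disc r :: 'n phase set) q * B)"
    using emeasure_compact_finite[OF compact_phase_disc[of r, where 'n='n]]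
    by (intro integrable_mult_left integrable_real_indicator) auto
  have le: "cmod (?g q) \<le> indicator (phase_disc r) q * B" for q
  proof (cases "q \<in> phase_disc r")
    case True
    have "exp (- (norm q)\<^sup>2 / 4) * cmod (f q) \<le> 1 * B"
      using bd[OF True] by (intro mult_mono) auto
    then show ?thesis using True by (simp add: norm_mult)
  qed simp
  show int: "integrable lborel ?g"
  proof (rule Bochner_Integration.integrable_bound[OF i])
    show "AE q in lborel. cmod (?g q) \<le> norm (indicator (phase_disc r :: 'n phase set) q * B)"
      by (intro AE_I2 order_trans[OF le]) simp
  qed measurable
  have "(\<integral>q. cmod (?g q) \<partial>lborel) \<le> (\<integral>q. indicator (phase_disc r :: 'n phase set) q * B \<partial>lborel)"
    by (rule Bochner_Integration.integral_mono[OF integrable_norm[OF int] i]) (rule le)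
  then show "(\<integral>q. cmod (?g q) \<partial>lborel) \<le> measure lborel (phase_disc r :: 'n phase set) * B" by simp
qed

lemma norm_zc: "(norm q)\<^sup>2 = (\<Sum>j\<in>UNIV. (cmod (zc q $ j))\<^sup>2)"
  unfolding cmod_zc sum.distrib norm_vec_sum[symmetric] by (simp add: norm_prod_def)

text \<open>A rotation of one coordinate multiplies the moment by a unit different from 1.\<close>

lemma moment_orthogonal:
  fixes \<alpha> \<beta> :: "'n::finite \<Rightarrow> nat"
  assumes "\<alpha> \<noteq> \<beta>"
  shows "moment r \<alpha> \<beta> = 0"
proof -
  obtain j where j: "\<alpha> j \<noteq> \<beta> j" using assms by auto
  define k where "k = real (\<alpha> j) - real (\<beta> j)"
  \<comment> \<open>With this angle the factor picked up by the integral is i or -i, hence not 1,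
    while an angle of at most pi/2 stays away from the half-turn.\<close>
  define u where "u = cis (pi / (2 * \<bar>k\<bar>))"
  have k: "\<bar>k\<bar> \<ge> 1" using j unfolding k_def by linarith
  have "pi / (2 * \<bar>k\<bar>) \<le> pi / 2" using k by (intro divide_left_mono) auto
  moreover have "0 < pi / (2 * \<bar>k\<bar>)" using k by simp
  ultimately have "cos (pi / (2 * \<bar>k\<bar>)) \<ge> 0" by (intro cos_ge_zero) auto
  then have u: "cmod u = 1" "Re u \<noteq> -1" by (auto simp: u_def)
  let ?R = "rotate_coord j u"
  let ?f = "\<lambda>q. of_real (indicator (phase_disc r) q * exp (- (norm q)\<^sup>2 / 4)) *
      (mpow (zc q) \<alpha> * cnj (mpow (zc q) \<beta>))"
  have fm: "?f \<in> borel_measurable borel" by measurable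
  have cz: "cmod (zc (?R q) $ i) = cmod (zc q $ i)" for q i
    by (simp add: rotate_coord_cpair norm_mult u)
  have disc: "?R q \<in> phase_disc r \<longleftrightarrow> q \<in> phase_disc r" for q
    unfolding phase_disc_def mem_Collect_eq cz ..
  have nrm: "norm (?R q) ^ 2 = norm q ^ 2" for q unfolding norm_zc cz ..
  have mp: "mpow (zc (?R q)) \<gamma> = u ^ \<gamma> j * mpow (zc q) \<gamma>" for q \<gamma>
  proof -
    have "mpow (zc (?R q)) \<gamma> = (\<Prod>i\<in>UNIV. (if i = j then u ^ \<gamma> j else 1) * zc q $ i ^ \<gamma> i)"
      unfolding mpow_def rotate_coord_cpair by (intro prod.cong) (auto simp: power_mult_distrib)
    then show ?thesis by (simp add: prod.distrib mpow_def)
  qed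
  have "moment r \<alpha> \<beta> = integral\<^sup>L (distr lborel borel ?R) ?f"
    unfolding moment_def lborel_rotate_coord(1)[OF u] ..
  also have "\<dots> = (\<integral>q. ?f (?R q) \<partial>lborel)"
    using lborel_rotate_coord(2)[OF u, of j] fm by (subst integral_distr) auto
  also have "\<dots> = (\<integral>q. (u ^ \<alpha> j * cnj u ^ \<beta> j) * ?f q \<partial>lborel)"
    by (intro Bochner_Integration.integral_cong refl)
      (simp add: mp nrm disc indicator_def)
  also have "\<dots> = (u ^ \<alpha> j * cnj u ^ \<beta> j) * moment r \<alpha> \<beta>"
    unfolding moment_def by (rule integral_mult_right_zero)
  finally have eq: "moment r \<alpha> \<beta> = (u ^ \<alpha> j * cnj u ^ \<beta> j) * moment r \<alpha> \<beta>" .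
  have "u ^ \<alpha> j * cnj u ^ \<beta> j = cis (pi / (2 * \<bar>k\<bar>) * k)"
  proof -
    have "u ^ \<alpha> j * cnj u ^ \<beta> j =
        cis (real (\<alpha> j) * (pi / (2 * \<bar>k\<bar>)) + real (\<beta> j) * - (pi / (2 * \<bar>k\<bar>)))"
      unfolding u_def cis_cnj Complex.DeMoivre cis_mult ..
    also have "real (\<alpha> j) * (pi / (2 * \<bar>k\<bar>)) + real (\<beta> j) * - (pi / (2 * \<bar>k\<bar>)) = pi / (2 * \<bar>k\<bar>) * k"
      unfolding k_def by (simp add: algebra_simps diff_divide_distrib)
    finally show ?thesis .
  qed
  also have "\<dots> \<noteq> 1"
  proof -
    define t where "t = pi / (2 * \<bar>k\<bar>) * k"
    have "t = pi / 2 \<or> t = - (pi / 2)"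
      unfolding t_def using k by (cases "k \<ge> 0") auto
    then have "cos t = 0" by (elim disjE) (simp_all only: cos_pi_half cos_minus)
    then show ?thesis unfolding t_def[symmetric] by (auto simp: complex_eq_iff)
  qed
  finally show ?thesis using eq by simp
qed

text \<open>A lower bound suffices, since moments occur as denominators. The integrand is
  nonnegative and is bounded below on a set \<open>Q\<close> of positive measure where every |z_j|
  is at least r/2; \<open>Q\<close>, and with it the constant, does not depend on \<beta>.\<close>

lemma moment_diagonal:
  fixes r :: real
  assumes r: "r > 0"
  obtains c where "c > 0"
    "\<And>\<beta> :: 'n::finite \<Rightarrow> nat. Re (moment r \<beta> \<beta>) \<ge> c * (r / 2) ^ (2 * (\<Sum>j\<in>UNIV. \<beta> j))"
proof -
  \<comment> \<open>Real parts above r/2 keep the moduli above r/2; the upper limits 3r/4 and r/4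
    add up to r and keep \<open>Q\<close> inside the disc.\<close>
  define Q where "Q = {q :: 'n phase. \<forall>j. fst q $ j \<in> {r / 2<..<3 / 4 * r} \<and> snd q $ j \<in> {0<..<r / 4}}"
  have "Q = (\<Inter>j. {q. r / 2 < fst q $ j \<and> fst q $ j < 3 / 4 * r \<and> 0 < snd q $ j \<and> snd q $ j < r / 4})"
    by (auto simp: Q_def)
  also have "open \<dots>"
    by (intro open_INT ballI open_Collect_conj open_Collect_less continuous_intros) auto
  finally have "open Q" .
  moreover have "((\<chi> j. 5 / 8 * r), (\<chi> j. r / 8)) \<in> Q" using r by (simp add: Q_def)
  ultimately have "\<not> negligible Q" using open_not_negligible by blast
  then have nn: "Q \<notin> null_sets lborel"
    using \<open>open Q\<close> by (simp add: negligible_iff_null_sets null_sets_completion_iff)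
  have Qz: "r / 2 \<le> cmod (zc q $ j)" "cmod (zc q $ j) \<le> r" if "q \<in> Q" for q j
  proof -
    have q: "r / 2 < fst q $ j" "fst q $ j < 3 / 4 * r" "0 < snd q $ j" "snd q $ j < r / 4"
      using that by (auto simp: Q_def)
    have "fst q $ j \<le> cmod (zc q $ j)" using complex_Re_le_cmod[of "zc q $ j"] by (simp add: cpair_def)
    then show "r / 2 \<le> cmod (zc q $ j)" using q by simp
    have "cmod (zc q $ j) \<le> \<bar>fst q $ j\<bar> + \<bar>snd q $ j\<bar>"
      using cmod_le[of "zc q $ j"] by (simp add: cpair_def)
    then show "cmod (zc q $ j) \<le> r" using q by simp
  qed
  have QP: "Q \<subseteq> phase_disc r" using Qz by (auto simp: phase_disc_def)
  have Qm[measurable]: "Q \<in> sets borel" using \<open>open Q\<close> by simp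
  have Qfin: "emeasure lborel Q < \<infinity>"
    using emeasure_mono[OF QP, of lborel] emeasure_compact_finite[OF compact_phase_disc[of r, where 'n='n]]
    by (auto intro: le_less_trans)
  have Qpos: "measure lborel Q > 0"
    using nn Qfin by (simp add: measure_def enn2real_positive_iff null_sets_def zero_less_iff_neq_zero less_top)
  define c where "c = exp (- real CARD('n) * r\<^sup>2 / 4) * measure lborel Q"
  show ?thesis
  proof (rule that[of c])
    show "c > 0" using Qpos by (simp add: c_def)
    fix \<beta> :: "'n \<Rightarrow> nat"
    let ?s = "\<Sum>j\<in>UNIV. \<beta> j"
    let ?g = "\<lambda>q :: 'n phase. indicator (phase_disc r) q * exp (- (norm q)\<^sup>2 / 4) * (cmod (mpow (zc q) \<beta>))\<^sup>2"
    let ?f = "\<lambda>q :: 'n phase. of_real (indicator (phase_disc r) q * exp (- (norm q)\<^sup>2 / 4)) *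
      (mpow (zc q) \<beta> * cnj (mpow (zc q) \<beta>))"
    have fg: "?f q = of_real (?g q)" for q
      by (simp add: complex_norm_square[symmetric])
    have bd: "cmod (mpow (zc q) \<beta> * cnj (mpow (zc q) \<beta>)) \<le> r ^ ?s * r ^ ?s" if "q \<in> phase_disc r" for q :: "'n phase"
      unfolding norm_mult complex_mod_cnj using that r
      by (intro mult_mono norm_mpow_le) (auto simp: phase_disc_def)
    have int: "integrable lborel ?f"
      by (rule integrable_phase_disc(1)[OF _ bd]) measurable
    have intg: "integrable lborel ?g" using integrable_Re[OF int] unfolding fg by simp
    have M: "Re (moment r \<beta> \<beta>) = integral\<^sup>L lborel ?g"
      unfolding moment_def fg integral_complex_of_real by simp
    have "c * (r / 2) ^ (2 * ?s) = (\<integral>q. indicator Q q * (exp (- real CARD('n) * r\<^sup>2 / 4) * (r / 2) ^ (2 * ?s)) \<partial>lborel)"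
      using Qfin by (simp add: c_def)
    also have "\<dots> \<le> integral\<^sup>L lborel ?g"
    proof (rule integral_mono[OF _ intg])
      show "integrable lborel (\<lambda>q. indicator Q q * (exp (- real CARD('n) * r\<^sup>2 / 4) * (r / 2) ^ (2 * ?s)))"
        using Qfin by (intro integrable_mult_left integrable_real_indicator) auto
      fix q :: "'n phase"
      show "indicator Q q * (exp (- real CARD('n) * r\<^sup>2 / 4) * (r / 2) ^ (2 * ?s)) \<le> ?g q"
      proof (cases "q \<in> Q")
        case True
        have "(norm q)\<^sup>2 \<le> (\<Sum>j\<in>(UNIV :: 'n set). r\<^sup>2)"
          unfolding norm_zc using Qz[OF True] by (intro sum_mono power_mono) auto
        then have 1: "exp (- real CARD('n) * r\<^sup>2 / 4) \<le> exp (- (norm q)\<^sup>2 / 4)" by simp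
        have "(r / 2) ^ ?s \<le> cmod (mpow (zc q) \<beta>)"
          unfolding mpow_def prod_norm[symmetric] norm_power power_sum using Qz[OF True] r
          by (intro prod_mono conjI power_mono) auto
        then have "((r / 2) ^ ?s)\<^sup>2 \<le> (cmod (mpow (zc q) \<beta>))\<^sup>2" using r by (intro power_mono) auto
        then have 2: "(r / 2) ^ (2 * ?s) \<le> (cmod (mpow (zc q) \<beta>))\<^sup>2" by (simp add: power_mult[symmetric] mult.commute)
        have "exp (- real CARD('n) * r\<^sup>2 / 4) * (r / 2) ^ (2 * ?s) \<le> exp (- (norm q)\<^sup>2 / 4) * (cmod (mpow (zc q) \<beta>))\<^sup>2"
          using 1 2 r by (intro mult_mono) auto
        then show ?thesis using True subsetD[OF QP True] by simp
      qed simp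
    qed
    finally show "Re (moment r \<beta> \<beta>) \<ge> c * (r / 2) ^ (2 * ?s)" unfolding M by simp
  qed
qed

section \<open>The analytic density\<close>

lemma has_sum_product_abs:
  fixes f :: "'i \<Rightarrow> complex" and g :: "'j \<Rightarrow> complex"
  assumes f: "(\<lambda>i. norm (f i)) summable_on UNIV" and g: "(\<lambda>j. norm (g j)) summable_on UNIV"
  shows "(\<lambda>(i, j). norm (f i * g j)) summable_on UNIV"
    "((\<lambda>(i, j). f i * g j) has_sum (infsum f UNIV * infsum g UNIV)) UNIV"
proof -
  have "(\<lambda>(i, j). norm (f i) * norm (g j)) summable_on (UNIV \<times> UNIV)"
  proof (rule summable_on_SigmaI)
    show "((\<lambda>j. case (i, j) of (i, j) \<Rightarrow> norm (f i) * norm (g j)) has_sum (norm (f i) * infsum (\<lambda>j. norm (g j)) UNIV)) UNIV" for i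
      unfolding prod.case by (intro has_sum_cmult_right has_sum_infsum g)
    show "(\<lambda>i. norm (f i) * infsum (\<lambda>j. norm (g j)) UNIV) summable_on UNIV"
      by (intro summable_on_cmult_left f)
  qed auto
  then show 1: "(\<lambda>(i, j). norm (f i * g j)) summable_on UNIV" by (simp add: norm_mult)
  have "(\<lambda>(i, j). f i * g j) summable_on (UNIV \<times> UNIV)"
    by (rule abs_summable_summable) (use 1 in \<open>simp add: case_prod_unfold\<close>)
  moreover have "((\<lambda>j. case (i, j) of (i, j) \<Rightarrow> f i * g j) has_sum (f i * infsum g UNIV)) UNIV" for i
    unfolding prod.case by (intro has_sum_cmult_right has_sum_infsum abs_summable_summable[OF g])
  moreover have "((\<lambda>i. f i * infsum g UNIV) has_sum (infsum f UNIV * infsum g UNIV)) UNIV"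
    by (intro has_sum_cmult_left has_sum_infsum abs_summable_summable[OF f])
  ultimately have "((\<lambda>(i, j). f i * g j) has_sum (infsum f UNIV * infsum g UNIV)) (UNIV \<times> UNIV)"
    by (intro has_sum_SigmaI) auto
  then show "((\<lambda>(i, j). f i * g j) has_sum (infsum f UNIV * infsum g UNIV)) UNIV" by simp
qed

definition exp_coeff :: "real \<Rightarrow> ('n::finite \<Rightarrow> nat) \<Rightarrow> real" where
  "exp_coeff t \<gamma> = (\<Prod>j\<in>UNIV. t ^ \<gamma> j / fact (\<gamma> j))"

lemma exp_coeff_has_sum:
  fixes w :: "complex ^ 'n::finite"
  shows "(\<lambda>\<gamma>. norm (of_real (exp_coeff t \<gamma>) * mpow w \<gamma>)) summable_on UNIV"
    "((\<lambda>\<gamma>. of_real (exp_coeff t \<gamma>) * mpow w \<gamma>) has_sum exp (\<Sum>j\<in>UNIV. of_real t * w $ j)) UNIV"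
proof -
  define f where "f j n = (of_real t * w $ j) ^ n / fact n" for j n
  have eq: "of_real (exp_coeff t \<gamma>) * mpow w \<gamma> = (\<Prod>j\<in>UNIV. f j (\<gamma> j))" for \<gamma>
    by (simp add: exp_coeff_def mpow_def f_def prod.distrib[symmetric] power_mult_distrib)
  have "(\<lambda>n. z ^ n / fact n) sums exp z" for z :: complex
    using exp_converges[of z] by (simp add: scaleR_conv_of_real divide_inverse mult.commute)
  moreover have "summable (\<lambda>n. norm (z ^ n / fact n))" for z :: complex
    using summable_norm_exp[of z] by (simp add: scaleR_conv_of_real divide_inverse mult.commute)
  ultimately have f: "summable (\<lambda>n. norm (f j n))" "f j sums exp (of_real t * w $ j)" for j
    unfolding f_def by auto
  have n: "(\<lambda>n. norm (f j n)) summable_on UNIV" for j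
    using f(1)[of j] by (intro norm_summable_imp_summable_on) simp
  have i: "infsum (f j) UNIV = exp (of_real t * w $ j)" for j
    using norm_summable_imp_has_sum[OF f(1) f(2)] by (rule infsumI)
  show "(\<lambda>\<gamma>. norm (of_real (exp_coeff t \<gamma>) * mpow w \<gamma>)) summable_on UNIV"
    unfolding eq by (rule has_sum_prod_multi(1)) (rule n)
  have "((\<lambda>\<gamma>. \<Prod>j\<in>UNIV. f j (\<gamma> j)) has_sum (\<Prod>j\<in>UNIV. infsum (f j) UNIV)) UNIV"
    by (rule has_sum_prod_multi(2)) (rule n)
  then show "((\<lambda>\<gamma>. of_real (exp_coeff t \<gamma>) * mpow w \<gamma>) has_sum exp (\<Sum>j\<in>UNIV. of_real t * w $ j)) UNIV"
    unfolding eq i by (simp add: exp_sum)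
qed

lemma exp_coeff_summable:
  "(\<lambda>\<gamma> :: 'n::finite \<Rightarrow> nat. \<bar>exp_coeff t \<gamma>\<bar> * T ^ (\<Sum>j\<in>UNIV. \<gamma> j)) summable_on UNIV" if "T \<ge> 0"
proof -
  have "norm (of_real (exp_coeff t \<gamma>) * mpow (\<chi> j. of_real T) \<gamma>) = \<bar>exp_coeff t \<gamma>\<bar> * T ^ (\<Sum>j\<in>UNIV. \<gamma> j)"
    for \<gamma> :: "'n \<Rightarrow> nat"
    using that by (simp add: mpow_def norm_mult prod_norm[symmetric] norm_power power_sum)
  then show ?thesis
    using exp_coeff_has_sum(1)[of t "\<chi> j::'n. of_real T"] by (simp only:)
qed

text \<open>These are the Taylor coefficients of the product of two reciprocal exponentials; in each
  coordinate the binomial theorem yields (-t + t)^n / n!.\<close>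

lemma exp_coeff_convolution:
  fixes \<kappa> :: "'n::finite \<Rightarrow> nat"
  shows "(\<Sum>\<gamma>\<in>{\<gamma>. \<gamma> \<le> \<kappa>}. exp_coeff (- t) \<gamma> * exp_coeff t (\<lambda>j. \<kappa> j - \<gamma> j)) = (if \<kappa> = (\<lambda>_. 0) then 1 else 0)"
proof -
  have P: "{\<gamma>. \<gamma> \<le> \<kappa>} = PiE UNIV (\<lambda>j. {..\<kappa> j})"
    by (auto simp: le_fun_def PiE_UNIV_domain)
  have "(\<Sum>\<gamma>\<in>{\<gamma>. \<gamma> \<le> \<kappa>}. exp_coeff (- t) \<gamma> * exp_coeff t (\<lambda>j. \<kappa> j - \<gamma> j)) =
    (\<Sum>\<gamma>\<in>PiE UNIV (\<lambda>j. {..\<kappa> j}). \<Prod>j\<in>UNIV. ((- t) ^ \<gamma> j / fact (\<gamma> j)) * (t ^ (\<kappa> j - \<gamma> j) / fact (\<kappa> j - \<gamma> j)))"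
    unfolding P by (simp only: exp_coeff_def prod.distrib)
  also have "\<dots> = (\<Prod>j\<in>UNIV. \<Sum>n\<le>\<kappa> j. ((- t) ^ n / fact n) * (t ^ (\<kappa> j - n) / fact (\<kappa> j - n)))"
    by (rule prod_sum_PiE[symmetric]) auto
  also have "\<dots> = (\<Prod>j\<in>UNIV. if \<kappa> j = 0 then 1 else 0)"
  proof (rule prod.cong[OF refl])
    fix j
    have "(\<Sum>n\<le>\<kappa> j. ((- t) ^ n / fact n) * (t ^ (\<kappa> j - n) / fact (\<kappa> j - n))) =
      (\<Sum>n\<le>\<kappa> j. real (\<kappa> j choose n) * (- t) ^ n * t ^ (\<kappa> j - n)) / fact (\<kappa> j)"
      unfolding sum_divide_distrib by (intro sum.cong) (auto simp: binomial_fact)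
    also have "\<dots> = (- t + t) ^ \<kappa> j / fact (\<kappa> j)" by (simp only: binomial_ring)
    also have "\<dots> = (if \<kappa> j = 0 then 1 else 0)" by simp
    finally show "(\<Sum>n\<le>\<kappa> j. ((- t) ^ n / fact n) * (t ^ (\<kappa> j - n) / fact (\<kappa> j - n))) = (if \<kappa> j = 0 then 1 else 0)" .
  qed
  also have "\<dots> = (if \<kappa> = (\<lambda>_. 0) then 1 else 0)"
    by (auto simp: fun_eq_iff intro!: prod_zero)
  finally show ?thesis .
qed

text \<open>The operators \<open>d \<mapsto> (\<lambda>\<alpha>. \<Sum>\<gamma> t^|\<gamma>| / \<gamma>! d (\<alpha> + 2\<gamma>))\<close> for \<open>t\<close> and \<open>-t\<close> are inverse to each other
  on geometrically bounded sequences: both are exponentials of multiples of a squared shift.\<close>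

definition shift_exp :: "real \<Rightarrow> (('n::finite \<Rightarrow> nat) \<Rightarrow> complex) \<Rightarrow> ('n \<Rightarrow> nat) \<Rightarrow> complex" where
  "shift_exp t d \<alpha> = infsum (\<lambda>\<gamma>. of_real (exp_coeff t \<gamma>) * d (\<lambda>j. \<alpha> j + 2 * \<gamma> j)) UNIV"

text \<open>A shift by 2\<gamma> costs R^(2|\<gamma>|), which the exponential coefficients absorb.
  The geometric rate \<open>R\<close> is preserved and only the constant changes, so the operator
  can be applied again.\<close>

lemma shift_exp_summable:
  fixes d :: "('n::finite \<Rightarrow> nat) \<Rightarrow> complex"
  assumes d: "\<And>\<alpha>. cmod (d \<alpha>) \<le> C * R ^ (\<Sum>j\<in>UNIV. \<alpha> j)" and R: "R > 0"
  shows "(\<lambda>\<gamma>. norm (of_real (exp_coeff t \<gamma>) * d (\<lambda>j. \<alpha> j + 2 * \<gamma> j))) summable_on UNIV"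
    "cmod (shift_exp t d \<alpha>) \<le> C * infsum (\<lambda>\<gamma> :: 'n \<Rightarrow> nat. \<bar>exp_coeff t \<gamma>\<bar> * (R\<^sup>2) ^ (\<Sum>j\<in>UNIV. \<gamma> j)) UNIV * R ^ (\<Sum>j\<in>UNIV. \<alpha> j)"
proof -
  let ?b = "\<lambda>\<gamma> :: 'n \<Rightarrow> nat. \<bar>exp_coeff t \<gamma>\<bar> * (R\<^sup>2) ^ (\<Sum>j\<in>UNIV. \<gamma> j)"
  have b: "?b summable_on UNIV" by (rule exp_coeff_summable) simp
  have le: "norm (of_real (exp_coeff t \<gamma>) * d (\<lambda>j. \<alpha> j + 2 * \<gamma> j)) \<le> C * R ^ (\<Sum>j\<in>UNIV. \<alpha> j) * ?b \<gamma>" for \<gamma>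
  proof -
    have "norm (of_real (exp_coeff t \<gamma>) * d (\<lambda>j. \<alpha> j + 2 * \<gamma> j)) \<le>
        \<bar>exp_coeff t \<gamma>\<bar> * (C * R ^ (\<Sum>j\<in>UNIV. \<alpha> j + 2 * \<gamma> j))"
      unfolding norm_mult norm_of_real by (intro mult_left_mono d) simp
    also have "R ^ (\<Sum>j\<in>UNIV. \<alpha> j + 2 * \<gamma> j) = R ^ (\<Sum>j\<in>UNIV. \<alpha> j) * (R\<^sup>2) ^ (\<Sum>j\<in>UNIV. \<gamma> j)"
      by (simp add: sum.distrib power_add power_mult sum_distrib_left[symmetric])
    finally show ?thesis by (simp add: mult_ac)
  qed
  have cb: "(\<lambda>\<gamma>. C * R ^ (\<Sum>j\<in>UNIV. \<alpha> j) * ?b \<gamma>) summable_on UNIV"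
    by (intro summable_on_cmult_right b)
  show s: "(\<lambda>\<gamma>. norm (of_real (exp_coeff t \<gamma>) * d (\<lambda>j. \<alpha> j + 2 * \<gamma> j))) summable_on UNIV"
    by (rule summable_on_comparison_test[OF cb]) (use le in auto)
  have "cmod (shift_exp t d \<alpha>) \<le> infsum (\<lambda>\<gamma>. C * R ^ (\<Sum>j\<in>UNIV. \<alpha> j) * ?b \<gamma>) UNIV"
    unfolding shift_exp_def
    by (rule norm_infsum_le[OF has_sum_infsum[OF abs_summable_summable[OF s]] has_sum_infsum[OF cb] le])
  also have "\<dots> = C * R ^ (\<Sum>j\<in>UNIV. \<alpha> j) * infsum ?b UNIV" by (rule infsum_cmult_right')
  finally show "cmod (shift_exp t d \<alpha>) \<le> C * infsum ?b UNIV * R ^ (\<Sum>j\<in>UNIV. \<alpha> j)" by (simp add: mult_ac)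
qed

text \<open>The double series over \<gamma> and \<delta> converges absolutely and is regrouped by
  \<kappa> = \<gamma> + \<delta>. Since \<open>d\<close> sees only \<kappa>, the inner sums are
  convolutions that vanish unless \<kappa> = 0.\<close>

lemma shift_exp_inverse:
  fixes d :: "('n::finite \<Rightarrow> nat) \<Rightarrow> complex"
  assumes d: "\<And>\<alpha>. cmod (d \<alpha>) \<le> C * R ^ (\<Sum>j\<in>UNIV. \<alpha> j)" and R: "R > 0"
  shows "shift_exp (- t) (shift_exp t d) \<alpha> = d \<alpha>"
proof -
  let ?p = "\<lambda>t \<gamma>. of_real (exp_coeff t \<gamma>) :: complex"
  let ?F = "\<lambda>(\<gamma>, \<delta>). ?p (- t) \<gamma> * (?p t \<delta> * d (\<lambda>j. \<alpha> j + 2 * \<gamma> j + 2 * \<delta> j))"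
  have "(\<lambda>(\<gamma>, \<delta>). norm ((?p (- t) \<gamma> * of_real ((R\<^sup>2) ^ (\<Sum>j\<in>UNIV. \<gamma> j))) * (?p t \<delta> * of_real ((R\<^sup>2) ^ (\<Sum>j\<in>UNIV. \<delta> j)))))
      summable_on (UNIV :: (('n \<Rightarrow> nat) \<times> ('n \<Rightarrow> nat)) set)"
    by (rule has_sum_product_abs(1)) (simp_all add: norm_mult abs_mult exp_coeff_summable norm_power)
  then have "(\<lambda>q. C * R ^ (\<Sum>j\<in>UNIV. \<alpha> j) * (case q of (\<gamma>, \<delta>) \<Rightarrow>
     norm ((?p (- t) \<gamma> * of_real ((R\<^sup>2) ^ (\<Sum>j\<in>UNIV. \<gamma> j))) * (?p t \<delta> * of_real ((R\<^sup>2) ^ (\<Sum>j\<in>UNIV. \<delta> j))))))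
      summable_on (UNIV :: (('n \<Rightarrow> nat) \<times> ('n \<Rightarrow> nat)) set)"
    by (rule summable_on_cmult_right)
  then have "(\<lambda>q. norm (?F q)) summable_on (UNIV :: (('n \<Rightarrow> nat) \<times> ('n \<Rightarrow> nat)) set)"
  proof (rule summable_on_comparison_test)
    fix q :: "('n \<Rightarrow> nat) \<times> ('n \<Rightarrow> nat)"
    obtain \<gamma> \<delta> where q: "q = (\<gamma>, \<delta>)" by (cases q)
    have "norm (?F q) \<le> \<bar>exp_coeff (- t) \<gamma>\<bar> * (\<bar>exp_coeff t \<delta>\<bar> * (C * R ^ (\<Sum>j\<in>UNIV. \<alpha> j + 2 * \<gamma> j + 2 * \<delta> j)))"
      unfolding q prod.case norm_mult norm_of_real by (intro mult_left_mono d) auto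
    also have "R ^ (\<Sum>j\<in>UNIV. \<alpha> j + 2 * \<gamma> j + 2 * \<delta> j) =
       R ^ (\<Sum>j\<in>UNIV. \<alpha> j) * (R\<^sup>2) ^ (\<Sum>j\<in>UNIV. \<gamma> j) * (R\<^sup>2) ^ (\<Sum>j\<in>UNIV. \<delta> j)"
      by (simp add: sum.distrib power_add power_mult sum_distrib_left[symmetric])
    finally show "norm (?F q) \<le> C * R ^ (\<Sum>j\<in>UNIV. \<alpha> j) * (case q of (\<gamma>, \<delta>) \<Rightarrow>
     norm ((?p (- t) \<gamma> * of_real ((R\<^sup>2) ^ (\<Sum>j\<in>UNIV. \<gamma> j))) * (?p t \<delta> * of_real ((R\<^sup>2) ^ (\<Sum>j\<in>UNIV. \<delta> j)))))"
      unfolding q prod.case norm_mult norm_of_real abs_mult using R by (simp add: mult_ac)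
  qed auto
  then have F: "?F summable_on (UNIV :: (('n \<Rightarrow> nat) \<times> ('n \<Rightarrow> nat)) set)"
    by (rule abs_summable_summable)
  then have FS: "(?F has_sum infsum ?F UNIV) (Sigma UNIV (\<lambda>_. UNIV))"
    by (simp add: has_sum_infsum)
  have "((\<lambda>\<gamma>. ?p (- t) \<gamma> * shift_exp t d (\<lambda>j. \<alpha> j + 2 * \<gamma> j)) has_sum infsum ?F UNIV) UNIV"
  proof (rule has_sum_SigmaD[OF FS])
    fix \<gamma> :: "'n \<Rightarrow> nat"
    show "((\<lambda>\<delta>. ?F (\<gamma>, \<delta>)) has_sum (?p (- t) \<gamma> * shift_exp t d (\<lambda>j. \<alpha> j + 2 * \<gamma> j))) UNIV"
      unfolding prod.case shift_exp_def
      by (intro has_sum_cmult_right has_sum_infsum abs_summable_summable[OF shift_exp_summable(1)[OF d R]])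
  qed
  then have 1: "shift_exp (- t) (shift_exp t d) \<alpha> = infsum ?F UNIV"
    unfolding shift_exp_def[of "- t"] by (rule infsumI)
  \<comment> \<open>Pairs (\<kappa>, \<gamma>) with \<gamma> \<le> \<kappa> correspond to pairs
    (\<gamma>, \<kappa> - \<gamma>); on this domain truncated subtraction is exact.\<close>
  let ?h = "\<lambda>(\<kappa>, \<gamma>). (\<gamma>, \<lambda>j. \<kappa> j - \<gamma> j) :: ('n \<Rightarrow> nat) \<times> ('n \<Rightarrow> nat)"
  let ?A = "Sigma UNIV (\<lambda>\<kappa>. {\<gamma>. \<gamma> \<le> \<kappa>}) :: (('n \<Rightarrow> nat) \<times> ('n \<Rightarrow> nat)) set"
  have bij: "bij_betw ?h ?A UNIV"
  proof (rule bij_betwI[where g = "\<lambda>(\<gamma>, \<delta>). (\<lambda>j. \<gamma> j + \<delta> j, \<gamma>)"])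
  qed (auto simp: le_fun_def fun_eq_iff)
  have "((\<lambda>q. ?F (?h q)) has_sum infsum ?F UNIV) ?A"
    using has_sum_reindex_bij_betw[OF bij, of ?F] F by (simp add: has_sum_infsum)
  then have "((\<lambda>\<kappa>. \<Sum>\<gamma>\<in>{\<gamma>. \<gamma> \<le> \<kappa>}. ?F (?h (\<kappa>, \<gamma>))) has_sum infsum ?F UNIV) UNIV"
  proof (rule has_sum_SigmaD)
    fix \<kappa> :: "'n \<Rightarrow> nat"
    have "{\<gamma>. \<gamma> \<le> \<kappa>} = PiE UNIV (\<lambda>j. {..\<kappa> j})" by (auto simp: le_fun_def PiE_UNIV_domain)
    then have "finite {\<gamma>. \<gamma> \<le> \<kappa>}" by (simp add: finite_PiE)
    then show "((\<lambda>\<gamma>. ?F (?h (\<kappa>, \<gamma>))) has_sum (\<Sum>\<gamma>\<in>{\<gamma>. \<gamma> \<le> \<kappa>}. ?F (?h (\<kappa>, \<gamma>)))) {\<gamma>. \<gamma> \<le> \<kappa>}"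
      by (rule has_sum_finite)
  qed
  moreover have "(\<Sum>\<gamma>\<in>{\<gamma>. \<gamma> \<le> \<kappa>}. ?F (?h (\<kappa>, \<gamma>))) = (if \<kappa> = (\<lambda>_. 0) then d \<alpha> else 0)" for \<kappa>
  proof -
    have "(\<Sum>\<gamma>\<in>{\<gamma>. \<gamma> \<le> \<kappa>}. ?F (?h (\<kappa>, \<gamma>))) =
       (\<Sum>\<gamma>\<in>{\<gamma>. \<gamma> \<le> \<kappa>}. of_real (exp_coeff (- t) \<gamma> * exp_coeff t (\<lambda>j. \<kappa> j - \<gamma> j)) * d (\<lambda>j. \<alpha> j + 2 * \<kappa> j))"
    proof (rule sum.cong[OF refl])
      fix \<gamma> assume "\<gamma> \<in> {\<gamma>. \<gamma> \<le> \<kappa>}"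
      then have "\<gamma> j \<le> \<kappa> j" for j by (simp add: le_fun_def)
      then have "\<alpha> j + 2 * \<gamma> j + 2 * (\<kappa> j - \<gamma> j) = \<alpha> j + 2 * \<kappa> j" for j
        by (metis add.assoc add_mult_distrib2 le_add_diff_inverse)
      then have "(\<lambda>j. \<alpha> j + 2 * \<gamma> j + 2 * (\<kappa> j - \<gamma> j)) = (\<lambda>j. \<alpha> j + 2 * \<kappa> j)"
        by (rule ext)
      then show "?F (?h (\<kappa>, \<gamma>)) = of_real (exp_coeff (- t) \<gamma> * exp_coeff t (\<lambda>j. \<kappa> j - \<gamma> j)) * d (\<lambda>j. \<alpha> j + 2 * \<kappa> j)"
        by (simp add: mult.assoc)
    qed
    also have "\<dots> = of_real (\<Sum>\<gamma>\<in>{\<gamma>. \<gamma> \<le> \<kappa>}. exp_coeff (- t) \<gamma> * exp_coeff t (\<lambda>j. \<kappa> j - \<gamma> j)) * d (\<lambda>j. \<alpha> j + 2 * \<kappa> j)"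
      by (simp only: sum_distrib_right of_real_sum)
    also have "\<dots> = (if \<kappa> = (\<lambda>_. 0) then d \<alpha> else 0)"
      unfolding exp_coeff_convolution by auto
    finally show ?thesis .
  qed
  ultimately have "((\<lambda>\<kappa>. if \<kappa> = (\<lambda>_. 0) then d \<alpha> else 0) has_sum infsum ?F UNIV) (UNIV :: ('n \<Rightarrow> nat) set)"
    by (simp only:)
  moreover have "((\<lambda>\<kappa>. if \<kappa> = (\<lambda>_. 0) then d \<alpha> else 0) has_sum d \<alpha>) (UNIV :: ('n \<Rightarrow> nat) set)"
    by (rule has_sum_finite_neutralI[where B = "{\<lambda>_. 0}"]) auto
  ultimately have "infsum ?F UNIV = d \<alpha>" by (rule has_sum_unique)
  then show ?thesis using 1 by simp
qed

section \<open>Power series in several complex variables\<close>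

lemma geometric_multi_summable:
  fixes q :: real
  assumes "0 \<le> q" "q < 1"
  shows "(\<lambda>\<alpha> :: 'n::finite \<Rightarrow> nat. q ^ (\<Sum>j\<in>UNIV. \<alpha> j)) summable_on UNIV"
proof -
  have "summable (\<lambda>n. norm (norm (of_real q ^ n :: complex)))"
    using assms by (simp add: norm_power)
  then have "(\<lambda>n. norm (of_real q ^ n :: complex)) summable_on UNIV"
    by (rule norm_summable_imp_summable_on)
  from has_sum_prod_multi(1)[of "\<lambda>_ n. of_real q ^ n", OF this]
  have "(\<lambda>\<alpha> :: 'n \<Rightarrow> nat. norm (\<Prod>j\<in>UNIV. of_real q ^ \<alpha> j :: complex)) summable_on UNIV" .
  moreover have "norm (\<Prod>j\<in>UNIV. of_real q ^ \<alpha> j :: complex) = q ^ (\<Sum>j\<in>UNIV. \<alpha> j)" for \<alpha> :: "'n \<Rightarrow> nat"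
    using assms by (simp add: prod_norm[symmetric] norm_power power_sum)
  ultimately show ?thesis by simp
qed

text \<open>When an exponent is 0 the truncated subtraction is harmless, because the factor
  \<open>of_nat\<close> in front vanishes.\<close>

definition mpow_deriv :: "('n::finite \<Rightarrow> nat) \<Rightarrow> complex ^ 'n \<Rightarrow> complex ^ 'n \<Rightarrow> complex" where
  "mpow_deriv \<beta> w v = (\<Sum>i\<in>UNIV. of_nat (\<beta> i) * w $ i ^ (\<beta> i - 1) * v $ i * (\<Prod>j\<in>UNIV - {i}. w $ j ^ \<beta> j))"

lemma has_derivative_mpow: "((\<lambda>w. mpow w \<beta>) has_derivative mpow_deriv \<beta> w) (at w within S)"
proof -
  have "((\<lambda>w. w $ i ^ \<beta> i) has_derivative (\<lambda>v. of_nat (\<beta> i) * w $ i ^ (\<beta> i - 1) * v $ i)) (at w within S)" for i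
    by (auto intro!: derivative_eq_intros bounded_linear.has_derivative[OF bounded_linear_vec_nth] simp: mult_ac)
  from has_derivative_prod[where I = UNIV, OF this]
  show ?thesis unfolding mpow_def mpow_deriv_def by simp
qed

lemma mpow_deriv_scale: "mpow_deriv \<beta> w (c *s v) = c * mpow_deriv \<beta> w v"
  unfolding mpow_deriv_def sum_distrib_left by (intro sum.cong) (auto simp: mult_ac)

text \<open>\<rho> \<ge> 1 pays for the power lost in differentiation, so the bound keeps the full
  exponent |\<beta>|.\<close>

lemma norm_mpow_deriv_le:
  fixes w :: "complex ^ 'n::finite"
  assumes w: "\<And>j. cmod (w $ j) \<le> \<rho>" and \<rho>: "\<rho> \<ge> 1"
  shows "cmod (mpow_deriv \<beta> w v) \<le> real (\<Sum>j\<in>UNIV. \<beta> j) * \<rho> ^ (\<Sum>j\<in>UNIV. \<beta> j) * norm v"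
proof -
  have "cmod (mpow_deriv \<beta> w v) \<le> (\<Sum>i\<in>UNIV. real (\<beta> i) * (\<rho> ^ (\<Sum>j\<in>UNIV. \<beta> j) * norm v))"
    unfolding mpow_deriv_def
  proof (rule sum_norm_le)
    fix i :: 'n
    have 1: "cmod (w $ i) ^ (\<beta> i - 1) \<le> \<rho> ^ \<beta> i"
    proof -
      have "cmod (w $ i) ^ (\<beta> i - 1) \<le> \<rho> ^ (\<beta> i - 1)" using w by (intro power_mono) auto
      also have "\<dots> \<le> \<rho> ^ \<beta> i" using \<rho> by (intro power_increasing) auto
      finally show ?thesis .
    qed
    have 2: "(\<Prod>j\<in>UNIV - {i}. cmod (w $ j) ^ \<beta> j) \<le> (\<Prod>j\<in>UNIV - {i}. \<rho> ^ \<beta> j)"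
      using w by (intro prod_mono conjI power_mono) auto
    have 3: "\<rho> ^ \<beta> i * (\<Prod>j\<in>UNIV - {i}. \<rho> ^ \<beta> j) = \<rho> ^ (\<Sum>j\<in>UNIV. \<beta> j)"
      by (simp add: power_sum prod.remove[of UNIV i])
    have 4: "cmod (v $ i) \<le> norm v" by (rule Finite_Cartesian_Product.norm_nth_le)
    have "cmod (w $ i) ^ (\<beta> i - 1) * (\<Prod>j\<in>UNIV - {i}. cmod (w $ j) ^ \<beta> j) \<le> \<rho> ^ (\<Sum>j\<in>UNIV. \<beta> j)"
      unfolding 3[symmetric] using \<rho> by (intro mult_mono 1 2) (auto intro!: prod_nonneg)
    then have "real (\<beta> i) * ((cmod (w $ i) ^ (\<beta> i - 1) * (\<Prod>j\<in>UNIV - {i}. cmod (w $ j) ^ \<beta> j)) * cmod (v $ i))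
      \<le> real (\<beta> i) * (\<rho> ^ (\<Sum>j\<in>UNIV. \<beta> j) * norm v)"
      using \<rho> by (intro mult_left_mono mult_mono 4) auto
    then show "cmod (of_nat (\<beta> i) * w $ i ^ (\<beta> i - 1) * v $ i * (\<Prod>j\<in>UNIV - {i}. w $ j ^ \<beta> j)) \<le>
      real (\<beta> i) * (\<rho> ^ (\<Sum>j\<in>UNIV. \<beta> j) * norm v)"
      by (simp add: norm_mult norm_power prod_norm[symmetric] mult_ac)
  qed
  then show ?thesis by (simp add: sum_distrib_right mult.assoc)
qed

text \<open>The base is chosen so that (7/6)(3/4) = 7/8 < 1: the factor |\<beta>| produced by
  differentiation is absorbed into the rate 3/4.\<close>

lemma real_le_power_7_6: "real n \<le> 6 * (7 / 6) ^ n"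
proof -
  have "1 + real n * (1 / 6) \<le> (1 + 1 / 6) ^ n" by (rule Bernoulli_inequality) simp
  then have "1 + real n / 6 \<le> (7 / 6) ^ n" by simp
  then show ?thesis by linarith
qed

text \<open>The coefficients permit convergence up to radius 2r, and on the polydisc of radius 3r/2
  the terms decay like (3/4)^|\<beta>|. The series is differentiated termwise along an enumeration
  of the multi-indices; tails of the majorant bound the error uniformly in the point and the
  direction.\<close>

lemma power_series_differentiable:
  fixes b :: "('n::finite \<Rightarrow> nat) \<Rightarrow> complex" and r :: real
  assumes b: "\<And>\<beta>. cmod (b \<beta>) \<le> C * (1 / (2 * r)) ^ (\<Sum>j\<in>UNIV. \<beta> j)" and C: "C \<ge> 0" and r: "r \<ge> 1"
    and w: "w \<in> polydisc (\<chi> j. 3 / 2 * r)"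
  shows "(\<lambda>\<beta>. norm (b \<beta> * mpow w \<beta>)) summable_on UNIV"
    "\<exists>L. ((\<lambda>w. infsum (\<lambda>\<beta>. b \<beta> * mpow w \<beta>) UNIV) has_derivative L) (at w) \<and> (\<forall>c v. L (c *s v) = c * L v)"
proof -
  let ?U = "polydisc (\<chi> j. 3 / 2 * r) :: (complex ^ 'n) set"
  let ?s = "\<lambda>\<beta> :: 'n \<Rightarrow> nat. \<Sum>j\<in>UNIV. \<beta> j"
  have U: "cmod (w $ j) \<le> 3 / 2 * r" if "w \<in> ?U" for w :: "complex ^ 'n" and j
    using that by (auto simp: polydisc_def less_imp_le)
  have openU: "open ?U"
  proof -
    have "?U = (\<Inter>j. {z. cmod (z $ j) < 3 / 2 * r})" by (auto simp: polydisc_def)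
    also have "open \<dots>" by (intro open_INT ballI open_Collect_less continuous_intros) auto
    finally show ?thesis .
  qed
  have convU: "convex ?U"
  proof -
    have "?U = (\<Inter>j. (\<lambda>z. z $ j) -` ball 0 (3 / 2 * r))" by (auto simp: polydisc_def)
    also have "convex \<dots>"
      by (intro convex_INT convex_linear_vimage convex_ball bounded_linear.linear bounded_linear_vec_nth)
    finally show ?thesis .
  qed
  \<comment> \<open>One majorant for the terms and for their derivatives, which explains the factor
    6 and the rate 7/8.\<close>
  define M where "M \<beta> = C * 6 * (7 / 8) ^ ?s \<beta>" for \<beta>
  have M: "M summable_on UNIV" unfolding M_def[abs_def] by (intro summable_on_cmult_right geometric_multi_summable) auto
  have "(1 / (2 * r)) * (3 / 2 * r) = 3 / 4" using r by (simp add: field_simps)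
  then have q: "(1 / (2 * r)) ^ n * (3 / 2 * r) ^ n = (3 / 4) ^ n" for n
    unfolding power_mult_distrib[symmetric] by (simp only:)
  have le: "norm (b \<beta> * mpow w \<beta>) \<le> M \<beta>" if "w \<in> ?U" for w \<beta>
  proof -
    have "norm (b \<beta> * mpow w \<beta>) \<le> (C * (1 / (2 * r)) ^ ?s \<beta>) * (3 / 2 * r) ^ ?s \<beta>"
      unfolding norm_mult using C r U[OF that] by (intro mult_mono b norm_mpow_le) auto
    also have "\<dots> = C * (3 / 4) ^ ?s \<beta>" unfolding mult.assoc q ..
    also have "\<dots> \<le> C * (6 * (7 / 8) ^ ?s \<beta>)"
    proof (intro mult_left_mono C)
      have "(3 / 4 :: real) ^ ?s \<beta> \<le> (7 / 8) ^ ?s \<beta>" by (intro power_mono) auto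
      then show "(3 / 4 :: real) ^ ?s \<beta> \<le> 6 * (7 / 8) ^ ?s \<beta>" by (simp add: order_trans)
    qed
    finally show ?thesis by (simp add: M_def mult.assoc)
  qed
  have led: "norm (b \<beta> * mpow_deriv \<beta> w v) \<le> M \<beta> * norm v" if "w \<in> ?U" for w \<beta> v
  proof -
    have "norm (b \<beta> * mpow_deriv \<beta> w v) \<le> (C * (1 / (2 * r)) ^ ?s \<beta>) * (real (?s \<beta>) * (3 / 2 * r) ^ ?s \<beta> * norm v)"
      unfolding norm_mult using C r U[OF that] by (intro mult_mono b norm_mpow_deriv_le) auto
    also have "\<dots> = C * (real (?s \<beta>) * ((1 / (2 * r)) ^ ?s \<beta> * (3 / 2 * r) ^ ?s \<beta>)) * norm v" by (simp only: mult_ac)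
    also have "\<dots> \<le> C * ((6 * (7 / 6) ^ ?s \<beta>) * (3 / 4) ^ ?s \<beta>) * norm v"
      unfolding q using C by (intro mult_left_mono mult_right_mono real_le_power_7_6) auto
    also have "(6 * (7 / 6) ^ ?s \<beta>) * (3 / 4) ^ ?s \<beta> = 6 * (7 / 8 :: real) ^ ?s \<beta>"
    proof -
      have "(7 / 6 :: real) * (3 / 4) = 7 / 8" by simp
      then show ?thesis unfolding mult.assoc power_mult_distrib[symmetric] by (simp only:)
    qed
    finally show ?thesis by (simp add: M_def mult.assoc)
  qed
  have ns: "(\<lambda>\<beta>. norm (b \<beta> * mpow w \<beta>)) summable_on UNIV" if w: "w \<in> ?U" for w
    by (rule summable_on_comparison_test[OF M]) (use le[OF w] in auto)
  show "(\<lambda>\<beta>. norm (b \<beta> * mpow w \<beta>)) summable_on UNIV" by (rule ns[OF w])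
  let ?e = "from_nat_into (UNIV :: ('n \<Rightarrow> nat) set)"
  have e: "bij_betw ?e UNIV UNIV" by (intro bij_betw_from_nat_into infinite_multi_indices) auto
  have Ms: "summable (\<lambda>n. M (?e n))"
    using summable_on_reindex_bij_betw[OF e, of M] M by (intro summable_on_imp_summable) simp
  have sums: "(\<lambda>n. b (?e n) * mpow w (?e n)) sums infsum (\<lambda>\<beta>. b \<beta> * mpow w \<beta>) UNIV" if "w \<in> ?U" for w
    using has_sum_reindex_bij_betw[OF e, of "\<lambda>\<beta>. b \<beta> * mpow w \<beta>"] has_sum_infsum[OF abs_summable_summable[OF ns[OF that]]]
    by (intro has_sum_imp_sums) simp
  define L where "L x v = (\<Sum>n. b (?e n) * mpow_deriv (?e n) x v)" for x v
  have Lsum: "summable (\<lambda>n. norm (b (?e n) * mpow_deriv (?e n) x v))" if "x \<in> ?U" for x v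
    by (rule summable_comparison_test'[OF summable_mult2[OF Ms, of "norm v"]]) (use led[OF that] in auto)
  have "\<exists>g. \<forall>x\<in>?U. (\<lambda>n. b (?e n) * mpow x (?e n)) sums (g x) \<and> (g has_derivative L x) (at x within ?U)"
  proof (rule has_derivative_series[where f = "\<lambda>n x. b (?e n) * mpow x (?e n)"
        and f' = "\<lambda>n x v. b (?e n) * mpow_deriv (?e n) x v" and g' = L, OF convU _ _ w sums[OF w]])
    show "((\<lambda>x. b (?e n) * mpow x (?e n)) has_derivative (\<lambda>v. b (?e n) * mpow_deriv (?e n) x v)) (at x within ?U)" for n x
      by (intro has_derivative_mult_right has_derivative_mpow)
    fix \<epsilon> :: real assume \<epsilon>: "\<epsilon> > 0"
    obtain N where N: "\<And>n. n \<ge> N \<Longrightarrow> norm (\<Sum>i. M (?e (i + n))) < \<epsilon>"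
      using suminf_exist_split[OF \<epsilon> Ms] by blast
    show "\<forall>\<^sub>F n in sequentially. \<forall>x\<in>?U. \<forall>h. norm ((\<Sum>i<n. b (?e i) * mpow_deriv (?e i) x h) - L x h) \<le> \<epsilon> * norm h"
    proof (rule eventually_sequentiallyI[of N], intro ballI allI)
      fix n x and h :: "complex ^ 'n" assume n: "N \<le> n" and x: "x \<in> ?U"
      let ?t = "\<lambda>i. b (?e i) * mpow_deriv (?e i) x h"
      have "L x h = (\<Sum>i. ?t (i + n)) + (\<Sum>i<n. ?t i)"
        unfolding L_def by (rule suminf_split_initial_segment[OF summable_norm_cancel[OF Lsum[OF x]]])
      then have "norm ((\<Sum>i<n. ?t i) - L x h) = norm (\<Sum>i. ?t (i + n))"
        by (simp add: norm_minus_commute)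
      also have "\<dots> \<le> (\<Sum>i. norm (?t (i + n)))"
        by (rule summable_norm) (rule summable_ignore_initial_segment[OF Lsum[OF x]])
      also have "\<dots> \<le> (\<Sum>i. M (?e (i + n)) * norm h)"
        by (intro suminf_le led[OF x] summable_ignore_initial_segment[OF Lsum[OF x]]
            summable_mult2 summable_ignore_initial_segment[OF Ms])
      also have "\<dots> = (\<Sum>i. M (?e (i + n))) * norm h"
        by (intro suminf_mult2[symmetric] summable_ignore_initial_segment[OF Ms])
      also have "\<dots> \<le> \<epsilon> * norm h" using N[OF n] by (intro mult_right_mono) auto
      finally show "norm ((\<Sum>i<n. ?t i) - L x h) \<le> \<epsilon> * norm h" .
    qed
  qed
  then obtain g where g: "\<And>x. x \<in> ?U \<Longrightarrow> (\<lambda>n. b (?e n) * mpow x (?e n)) sums (g x)"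
    "\<And>x. x \<in> ?U \<Longrightarrow> (g has_derivative L x) (at x within ?U)" by blast
  have "infsum (\<lambda>\<beta>. b \<beta> * mpow x \<beta>) UNIV = g x" if "x \<in> ?U" for x
    using sums[OF that] g(1)[OF that] by (rule sums_unique2)
  then have "((\<lambda>w. infsum (\<lambda>\<beta>. b \<beta> * mpow w \<beta>) UNIV) has_derivative L w) (at w within ?U)"
    by (rule has_derivative_transform[OF w _ g(2)[OF w]])
  then have "((\<lambda>w. infsum (\<lambda>\<beta>. b \<beta> * mpow w \<beta>) UNIV) has_derivative L w) (at w)"
    unfolding at_within_open[OF w openU] .
  moreover have "L w (c *s v) = c * L w v" for c v
    unfolding L_def mpow_deriv_scale mult.left_commute[of _ c]
    by (rule suminf_mult[OF summable_norm_cancel[OF Lsum[OF w]]])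
  ultimately show "\<exists>L. ((\<lambda>w. infsum (\<lambda>\<beta>. b \<beta> * mpow w \<beta>) UNIV) has_derivative L) (at w) \<and> (\<forall>c v. L (c *s v) = c * L v)"
    by blast
qed

section \<open>Construction of the density\<close>

text \<open>The left side collects the exponents of F_0, of the prescribed phase and of the
  coefficient function. Since z^2 minus its conjugate is 4iy\<eta>, the terms with the conjugate
  cancel, leaving a part in z and a part in |z|.\<close>

lemma disc_weight_identity:
  fixes y \<eta> :: real
  defines "z \<equiv> of_real y + \<i> * of_real \<eta>"
  shows "- ((of_real y - \<i> * of_real \<eta>)\<^sup>2) * (1 / 8) - \<i> * of_real (y * \<eta>) + (z\<^sup>2 * (1 / 4) - (of_real y)\<^sup>2 * (1 / 2))
    = of_real (- (1 / 8)) * z\<^sup>2 + of_real (- (y\<^sup>2 + \<eta>\<^sup>2) / 4)"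
  unfolding z_def by (simp add: complex_eq_iff power2_eq_square field_simps)

lemma sum_double: "(\<Sum>j\<in>UNIV. 2 * \<gamma> j) = 2 * (\<Sum>j\<in>UNIV. \<gamma> j)" for \<gamma> :: "'n::finite \<Rightarrow> nat"
  by (simp add: sum_distrib_left)

text \<open>Solves a moment problem that is triangular: after orthogonality, the integral against
  the \<alpha>-th function sees the coefficients with index \<alpha> + 2\<gamma>, weighted as in
  \<open>shift_exp\<close> with parameter -1/8. The factor 8 in the radius makes the Taylor
  coefficients of H decay like (1/(2r))^|\<beta>|, so that H converges up to radius 2r.\<close>

lemma analytic_density:
  fixes d :: "('n::finite \<Rightarrow> nat) \<Rightarrow> complex"
  assumes d: "\<And>\<alpha>. cmod (d \<alpha>) \<le> C * R ^ (\<Sum>j\<in>UNIV. \<alpha> j)" and C: "C \<ge> 0" and R: "R \<ge> 1"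
  defines "r \<equiv> 8 * R"
  obtains F0 where "F0 \<in> analytic_near (closure (polydisc (\<chi> j. r)))"
    "\<And>\<alpha>. (\<integral>q. (F0 (cpair (fst q) (- snd q)) * exp (- \<i> * of_real (fst q \<bullet> snd q)) *
       indicator (closure (polydisc (\<chi> j. r))) (zc q)) * coeff_fun \<alpha> (q, 0) \<partial>lborel) = d \<alpha> / of_real (herm_norm \<alpha>)"
proof -
  have Rpos: "R > 0" and rpos: "r > 0" and r1: "r \<ge> 1" using R by (auto simp: r_def)
  let ?s = "\<lambda>\<beta> :: 'n \<Rightarrow> nat. \<Sum>j\<in>UNIV. \<beta> j"
  let ?P = "closure (polydisc (\<chi> j. r)) :: (complex ^ 'n) set"
  have cl: "?P = {z. \<forall>j. cmod (z $ j) \<le> r}" using rpos by (subst closure_polydisc) auto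
  obtain c0 where c0: "c0 > 0" "\<And>\<beta> :: 'n \<Rightarrow> nat. Re (moment r \<beta> \<beta>) \<ge> c0 * (r / 2) ^ (2 * ?s \<beta>)"
    using moment_diagonal[OF rpos] by metis
  \<comment> \<open>Undoes in advance the multiplication by exp(-<z,z>/8) that the integral
    performs.\<close>
  define B where "B = shift_exp (1 / 8) d"
  define K where "K = infsum (\<lambda>\<gamma> :: 'n \<Rightarrow> nat. \<bar>exp_coeff (1 / 8) \<gamma>\<bar> * (R\<^sup>2) ^ ?s \<gamma>) UNIV"
  have K0: "K \<ge> 0" unfolding K_def by (rule infsum_nonneg) simp
  have Bb: "cmod (B \<beta>) \<le> C * K * R ^ ?s \<beta>" for \<beta>
    unfolding B_def K_def by (rule shift_exp_summable(2)[OF d Rpos])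
  have inv: "shift_exp (- (1 / 8)) B \<alpha> = d \<alpha>" for \<alpha>
    unfolding B_def by (rule shift_exp_inverse[OF d Rpos])
  \<comment> \<open>Normalised so that multiplication by the diagonal moment returns
    \<open>B\<close>.\<close>
  define b where "b \<beta> = B \<beta> / moment r \<beta> \<beta>" for \<beta>
  define C' where "C' = C * K / c0"
  have C': "C' \<ge> 0" using C K0 c0 by (simp add: C'_def)
  have mpos: "Re (moment r \<beta> \<beta>) > 0" for \<beta> :: "'n \<Rightarrow> nat"
    using c0(2)[of \<beta>] c0(1) rpos by (meson less_le_trans mult_pos_pos zero_less_power half_gt_zero)
  then have mnz: "moment r \<beta> \<beta> \<noteq> 0" for \<beta> :: "'n \<Rightarrow> nat" by (metis less_irrefl zero_complex.sel(1))
  have bb: "cmod (b \<beta>) \<le> C' * (1 / (2 * r)) ^ ?s \<beta>" for \<beta>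
  proof -
    have "c0 * (r / 2) ^ (2 * ?s \<beta>) \<le> cmod (moment r \<beta> \<beta>)"
      using c0(2)[of \<beta>] complex_Re_le_cmod order_trans by blast
    then have "cmod (b \<beta>) \<le> (C * K * R ^ ?s \<beta>) / (c0 * (r / 2) ^ (2 * ?s \<beta>))"
      unfolding b_def norm_divide using Bb[of \<beta>] C K0 Rpos c0(1) rpos by (intro frac_le) auto
    also have "\<dots> = C' * (R ^ ?s \<beta> / ((r / 2)\<^sup>2) ^ ?s \<beta>)"
      by (simp add: C'_def power_mult)
    also have "R ^ ?s \<beta> / ((r / 2)\<^sup>2) ^ ?s \<beta> = (R / (r / 2)\<^sup>2) ^ ?s \<beta>" by (simp only: power_divide)
    also have "R / (r / 2)\<^sup>2 = 1 / (2 * r)" using Rpos by (simp add: r_def power2_eq_square field_simps)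
    finally show ?thesis .
  qed
  define H where "H w = infsum (\<lambda>\<beta>. b \<beta> * mpow w \<beta>) UNIV" for w
  define F0 where "F0 w = exp (\<Sum>j\<in>UNIV. - ((w $ j)\<^sup>2 * (1 / 8))) * H w" for w
  \<comment> \<open>A radius strictly between r, where analyticity is wanted, and 2r, where the
    coefficient bound stops giving convergence.\<close>
  let ?U = "polydisc (\<chi> j. 3 / 2 * r) :: (complex ^ 'n) set"
  have PU: "?P \<subseteq> ?U"
  proof
    fix z :: "complex ^ 'n" assume "z \<in> ?P"
    then have "cmod (z $ j) \<le> r" for j unfolding cl by simp
    moreover have "r < 3 / 2 * r" using rpos by simp
    ultimately have "cmod (z $ j) < 3 / 2 * r" for j by (rule le_less_trans)
    then show "z \<in> ?U" unfolding polydisc_def by simp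
  qed
  have openU: "open ?U"
  proof -
    have "?U = (\<Inter>j. {z. cmod (z $ j) < 3 / 2 * r})" by (auto simp: polydisc_def)
    also have "open \<dots>" by (intro open_INT ballI open_Collect_less continuous_intros) auto
    finally show ?thesis .
  qed
  have Hs: "(\<lambda>\<beta>. norm (b \<beta> * mpow w \<beta>)) summable_on UNIV"
    and HL: "\<exists>L. (H has_derivative L) (at w) \<and> (\<forall>c v. L (c *s v) = c * L v)" if "w \<in> ?U" for w
    unfolding H_def[abs_def] using power_series_differentiable[OF bb C' r1 that] by blast+
  have FL: "\<exists>L. (F0 has_derivative L) (at w) \<and> (\<forall>c v. L (c *s v) = c * L v)" if w: "w \<in> ?U" for w
  proof -
    obtain L where L: "(H has_derivative L) (at w)" "\<And>c v. L (c *s v) = c * L v" using HL[OF w] by blast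
    let ?E = "\<lambda>w :: complex ^ 'n. exp (\<Sum>j\<in>UNIV. - ((w $ j)\<^sup>2 * (1 / 8)))"
    let ?D = "\<lambda>v. ?E w * (\<Sum>j\<in>UNIV. - (2 * w $ j * v $ j * (1 / 8)))"
    have E: "(?E has_derivative ?D) (at w)"
    proof -
      have "((\<lambda>w. (w $ j)\<^sup>2) has_derivative (\<lambda>v. 2 * w $ j * v $ j)) (at w)" for j
      proof -
        have n: "((\<lambda>w :: complex ^ 'n. w $ j) has_derivative (\<lambda>v. v $ j)) (at w)"
          by (rule bounded_linear_imp_has_derivative[OF bounded_linear_vec_nth])
        show ?thesis unfolding power2_eq_square
          by (rule has_derivative_eq_rhs[OF has_derivative_mult[OF n n]]) (simp add: fun_eq_iff)
      qed
      then have "((\<lambda>w. \<Sum>j\<in>UNIV. - ((w $ j)\<^sup>2 * (1 / 8))) has_derivative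
          (\<lambda>v. \<Sum>j\<in>UNIV. - (2 * w $ j * v $ j * (1 / 8)))) (at w)"
        by (intro has_derivative_sum has_derivative_minus has_derivative_mult_left)
      from has_derivative_compose[OF this DERIV_exp[unfolded has_field_derivative_def]] show ?thesis .
    qed
    have "(F0 has_derivative (\<lambda>v. ?E w * L v + ?D v * H w)) (at w)"
      unfolding F0_def[abs_def] by (rule has_derivative_mult[OF E L(1)])
    moreover have "?E w * L (c *s v) + ?D (c *s v) * H w = c * (?E w * L v + ?D v * H w)" for c v
    proof -
      have "?D (c *s v) = c * ?D v"
        by (simp add: sum_distrib_left sum_negf mult_ac)
      then show ?thesis unfolding L(2) by (simp add: algebra_simps)
    qed
    ultimately show ?thesis by blast
  qed
  have "F0 \<in> analytic_near ?P"
    unfolding analytic_near_def using openU PU FL by blast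
  moreover have "(\<integral>q. (F0 (cpair (fst q) (- snd q)) * exp (- \<i> * of_real (fst q \<bullet> snd q)) *
       indicator ?P (zc q)) * coeff_fun \<alpha> (q, 0) \<partial>lborel) = d \<alpha> / of_real (herm_norm \<alpha>)" for \<alpha>
  proof -
    let ?W = "\<lambda>q :: 'n phase. of_real (indicator (phase_disc r) q * exp (- (norm q)\<^sup>2 / 4)) :: complex"
    let ?e = "\<lambda>\<gamma>. of_real (exp_coeff (- (1 / 8)) \<gamma>) :: complex"
    let ?f = "\<lambda>p q. (?e (fst p) * b (snd p)) * (?W q * (mpow (zc q) (\<lambda>j. \<alpha> j + 2 * fst p j) * cnj (mpow (zc q) (snd p))))"
    let ?g = "\<lambda>q. ?W q * (mpow (zc q) \<alpha> * exp (\<Sum>j\<in>UNIV. of_real (- (1 / 8)) * (zc q $ j)\<^sup>2) * H (\<chi> j. cnj (zc q $ j)))"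
    \<comment> \<open>Regroups the integrand into a weight depending on moduli, a holomorphic factor
      in z and the series H in the conjugate of z.\<close>
    have pt: "(F0 (cpair (fst q) (- snd q)) * exp (- \<i> * of_real (fst q \<bullet> snd q)) *
       indicator ?P (zc q)) * coeff_fun \<alpha> (q, 0) = ?g q / of_real (herm_norm \<alpha>)" for q :: "'n phase"
    proof -
      have I: "indicator ?P (zc q) = (of_real (indicator (phase_disc r) q) :: complex)"
        unfolding cl phase_disc_def by (simp add: indicator_def)
      have Hc: "cpair (fst q) (- snd q) = (\<chi> j. cnj (zc q $ j))"
        by (simp add: cpair_def vec_eq_iff complex_eq_iff)
      have Z: "Zcoord (q, 0) j = zc q $ j" "Ycoord (q, 0) j = of_real (fst q $ j)" for j
        by (simp_all add: Zcoord_def Ycoord_def cpair_def)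
      have key: "exp (\<Sum>j\<in>UNIV. - ((cpair (fst q) (- snd q) $ j)\<^sup>2 * (1 / 8))) * exp (- \<i> * of_real (fst q \<bullet> snd q)) *
          exp (\<Sum>j\<in>UNIV. (zc q $ j)\<^sup>2 * (1 / 4) - (of_real (fst q $ j))\<^sup>2 * (1 / 2)) =
        exp (\<Sum>j\<in>UNIV. of_real (- (1 / 8)) * (zc q $ j)\<^sup>2) * of_real (exp (- (norm q)\<^sup>2 / 4))"
      proof -
        have "- \<i> * of_real (fst q \<bullet> snd q) = (\<Sum>j\<in>UNIV. - \<i> * of_real (fst q $ j * snd q $ j))"
          by (simp add: inner_vec_def sum_distrib_left)
        moreover have "complex_of_real (- (norm q)\<^sup>2 / 4) = (\<Sum>j\<in>UNIV. of_real (- ((fst q $ j)\<^sup>2 + (snd q $ j)\<^sup>2) / 4))"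
          unfolding norm_zc cmod_zc sum_negf[symmetric] sum_divide_distrib of_real_sum ..
        moreover have "- ((cpair (fst q) (- snd q) $ j)\<^sup>2 * (1 / 8)) + - \<i> * of_real (fst q $ j * snd q $ j) +
           ((zc q $ j)\<^sup>2 * (1 / 4) - (of_real (fst q $ j))\<^sup>2 * (1 / 2)) =
           of_real (- (1 / 8)) * (zc q $ j)\<^sup>2 + of_real (- ((fst q $ j)\<^sup>2 + (snd q $ j)\<^sup>2) / 4)" for j
          using disc_weight_identity[of "fst q $ j" "snd q $ j"] by (simp add: cpair_def)
        ultimately show ?thesis
          unfolding exp_of_real[symmetric] exp_add[symmetric] by (simp only: sum.distrib[symmetric])
      qed
      have "(F0 (cpair (fst q) (- snd q)) * exp (- \<i> * of_real (fst q \<bullet> snd q)) *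
          indicator ?P (zc q)) * coeff_fun \<alpha> (q, 0) =
        (exp (\<Sum>j\<in>UNIV. - ((cpair (fst q) (- snd q) $ j)\<^sup>2 * (1 / 8))) * exp (- \<i> * of_real (fst q \<bullet> snd q)) *
          exp (\<Sum>j\<in>UNIV. (zc q $ j)\<^sup>2 * (1 / 4) - (of_real (fst q $ j))\<^sup>2 * (1 / 2))) *
        (of_real (indicator (phase_disc r) q) * (mpow (zc q) \<alpha> * (H (cpair (fst q) (- snd q)) * of_real (1 / herm_norm \<alpha>))))"
        unfolding F0_def coeff_fun_def Z I mpow_def by (simp only: mult_ac)
      also have "\<dots> = (exp (\<Sum>j\<in>UNIV. of_real (- (1 / 8)) * (zc q $ j)\<^sup>2) * of_real (exp (- (norm q)\<^sup>2 / 4))) *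
        (of_real (indicator (phase_disc r) q) * (mpow (zc q) \<alpha> * (H (cpair (fst q) (- snd q)) * of_real (1 / herm_norm \<alpha>))))"
        unfolding key ..
      also have "\<dots> = ?g q / of_real (herm_norm \<alpha>)"
      proof -
        have h: "of_real (1 / herm_norm \<alpha>) = inverse (of_real (herm_norm \<alpha>) :: complex)"
          by (simp add: divide_inverse)
        show ?thesis
          unfolding Hc of_real_mult h divide_inverse[of _ "of_real (herm_norm \<alpha>)"] by (simp only: mult_ac)
      qed
      finally show ?thesis .
    qed
    have zsum: "((\<lambda>\<gamma>. ?e \<gamma> * mpow (zc q) (\<lambda>j. 2 * \<gamma> j)) has_sum exp (\<Sum>j\<in>UNIV. of_real (- (1 / 8)) * (zc q $ j)\<^sup>2)) UNIV"
      and znorm: "(\<lambda>\<gamma>. norm (?e \<gamma> * mpow (zc q) (\<lambda>j. 2 * \<gamma> j))) summable_on UNIV" for q :: "'n phase"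
    proof -
      have "mpow (zc q) (\<lambda>j. 2 * \<gamma> j) = mpow (\<chi> j. (zc q $ j)\<^sup>2) \<gamma>" for \<gamma>
        by (simp add: mpow_def power_mult)
      then show "((\<lambda>\<gamma>. ?e \<gamma> * mpow (zc q) (\<lambda>j. 2 * \<gamma> j)) has_sum exp (\<Sum>j\<in>UNIV. of_real (- (1 / 8)) * (zc q $ j)\<^sup>2)) UNIV"
        "(\<lambda>\<gamma>. norm (?e \<gamma> * mpow (zc q) (\<lambda>j. 2 * \<gamma> j))) summable_on UNIV"
        using exp_coeff_has_sum[of "- (1 / 8)" "\<chi> j. (zc q $ j)\<^sup>2"] by simp_all
    qed
    have mp: "mpow z (\<lambda>j. \<alpha> j + 2 * \<gamma> j) = mpow z \<alpha> * mpow z (\<lambda>j. 2 * \<gamma> j)" for z :: "complex ^ 'n" and \<gamma>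
      by (simp add: mpow_def power_add prod.distrib)
    have mc: "cnj (mpow z \<beta>) = mpow (\<chi> j. cnj (z $ j)) \<beta>" for z :: "complex ^ 'n" and \<beta>
      by (simp add: mpow_def)
    define V where "V = measure lborel (phase_disc r :: 'n phase set)"
    \<comment> \<open>On the disc the coefficient bound (1/(2r))^|\<beta>| meets monomials of size
      r^|\<beta>|, which leaves the summable rate 1/2; the exponential series converges at every
      rate.\<close>
    have fint: "integrable lborel (?f p)" and fnorm: "(\<integral>q. norm (?f p q) \<partial>lborel) \<le>
      V * (r ^ ?s \<alpha> * ((\<bar>exp_coeff (- (1 / 8)) (fst p)\<bar> * (r\<^sup>2) ^ ?s (fst p)) * (C' * (1 / 2) ^ ?s (snd p))))" for p
    proof -
      have bd: "cmod (mpow (zc q) (\<lambda>j. \<alpha> j + 2 * fst p j) * cnj (mpow (zc q) (snd p))) \<le>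
         r ^ ?s (\<lambda>j. \<alpha> j + 2 * fst p j) * r ^ ?s (snd p)" if "q \<in> phase_disc r" for q
        unfolding norm_mult complex_mod_cnj using that rpos
        by (intro mult_mono norm_mpow_le) (auto simp: phase_disc_def)
      note ip = integrable_phase_disc[OF _ bd]
      show "integrable lborel (?f p)" by (intro integrable_mult_right ip(1)) measurable
      have "(\<integral>q. norm (?f p q) \<partial>lborel) = cmod (?e (fst p) * b (snd p)) *
        (\<integral>q. norm (?W q * (mpow (zc q) (\<lambda>j. \<alpha> j + 2 * fst p j) * cnj (mpow (zc q) (snd p)))) \<partial>lborel)"
        unfolding norm_mult[of "_ * b _"] by (rule integral_mult_right_zero)
      also have "\<dots> \<le> (\<bar>exp_coeff (- (1 / 8)) (fst p)\<bar> * (C' * (1 / (2 * r)) ^ ?s (snd p))) *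
        (V * (r ^ ?s (\<lambda>j. \<alpha> j + 2 * fst p j) * r ^ ?s (snd p)))"
      proof (intro mult_mono)
        show "cmod (?e (fst p) * b (snd p)) \<le> \<bar>exp_coeff (- (1 / 8)) (fst p)\<bar> * (C' * (1 / (2 * r)) ^ ?s (snd p))"
          unfolding norm_mult norm_of_real by (intro mult_left_mono bb) simp
        show "(\<integral>q. norm (?W q * (mpow (zc q) (\<lambda>j. \<alpha> j + 2 * fst p j) * cnj (mpow (zc q) (snd p)))) \<partial>lborel) \<le>
          V * (r ^ ?s (\<lambda>j. \<alpha> j + 2 * fst p j) * r ^ ?s (snd p))"
          unfolding V_def by (rule ip(2)) measurable
      qed (use C' rpos in auto)
      also have "\<dots> = V * (r ^ ?s \<alpha> * ((\<bar>exp_coeff (- (1 / 8)) (fst p)\<bar> * (r\<^sup>2) ^ ?s (fst p)) *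
         (C' * ((1 / (2 * r)) ^ ?s (snd p) * r ^ ?s (snd p)))))"
        by (simp only: sum.distrib power_add sum_double power_mult mult_ac)
      also have "(1 / (2 * r)) ^ ?s (snd p) * r ^ ?s (snd p) = (1 / 2) ^ ?s (snd p)"
        unfolding power_mult_distrib[symmetric] using rpos by simp
      finally show "(\<integral>q. norm (?f p q) \<partial>lborel) \<le>
        V * (r ^ ?s \<alpha> * ((\<bar>exp_coeff (- (1 / 8)) (fst p)\<bar> * (r\<^sup>2) ^ ?s (fst p)) * (C' * (1 / 2) ^ ?s (snd p))))" .
    qed
    have ptw: "((\<lambda>p. ?f p q) has_sum ?g q) UNIV" "(\<lambda>p. norm (?f p q)) summable_on UNIV" for q
    proof -
      have "((\<lambda>p. ?f p q) has_sum ?g q) UNIV \<and> (\<lambda>p. norm (?f p q)) summable_on UNIV"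
      \<comment> \<open>The series for H is controlled only on \<open>?U\<close>. Inside the disc
        the conjugate point lies there, and outside the disc all terms and the limit vanish through
        the weight.\<close>
      proof (cases "q \<in> phase_disc r")
        case True
        let ?w = "(\<chi> j. cnj (zc q $ j)) :: complex ^ 'n"
        have "?w \<in> ?P" using True by (simp add: cl phase_disc_def)
        then have w: "?w \<in> ?U" using PU by blast
        note pr = has_sum_product_abs[OF znorm[of q] Hs[OF w]]
        have e: "?f p q = (?W q * mpow (zc q) \<alpha>) * (case p of (\<gamma>, \<beta>) \<Rightarrow> (?e \<gamma> * mpow (zc q) (\<lambda>j. 2 * \<gamma> j)) * (b \<beta> * mpow ?w \<beta>))" for p
          unfolding mp mc by (simp add: case_prod_unfold mult_ac)
        have "((\<lambda>p. ?f p q) has_sum (?W q * mpow (zc q) \<alpha>) *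
            (infsum (\<lambda>\<gamma>. ?e \<gamma> * mpow (zc q) (\<lambda>j. 2 * \<gamma> j)) UNIV * infsum (\<lambda>\<beta>. b \<beta> * mpow ?w \<beta>) UNIV)) UNIV"
          unfolding e by (rule has_sum_cmult_right[OF pr(2)])
        then have "((\<lambda>p. ?f p q) has_sum ?g q) UNIV"
          unfolding infsumI[OF zsum] H_def[symmetric] by (simp only: mult.assoc)
        moreover have "(\<lambda>p. norm (?f p q)) summable_on UNIV"
          unfolding e norm_mult[of "?W q * mpow (zc q) \<alpha>"] using pr(1)
          by (intro summable_on_cmult_right) (simp add: case_prod_unfold)
        ultimately show ?thesis ..
      qed simp
      then show "((\<lambda>p. ?f p q) has_sum ?g q) UNIV" "(\<lambda>p. norm (?f p q)) summable_on UNIV" by auto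
    qed
    have "((\<lambda>p. integral\<^sup>L lborel (?f p)) has_sum integral\<^sup>L lborel ?g) UNIV"
    proof (rule has_sum_lebesgue_integral(2)[OF _ fint _ ptw(2) ptw(1)])
      show "infinite (UNIV :: (('n \<Rightarrow> nat) \<times> ('n \<Rightarrow> nat)) set)"
        using infinite_multi_indices[where 'n='n] by (simp add: finite_prod)
      have "(\<lambda>p. case p of (\<gamma>, \<beta>) \<Rightarrow> norm (of_real (\<bar>exp_coeff (- (1 / 8)) \<gamma>\<bar> * (r\<^sup>2) ^ ?s \<gamma>) * (of_real (C' * (1 / 2) ^ ?s \<beta>) :: complex))) summable_on UNIV"
      proof (rule has_sum_product_abs(1))
        have "norm (of_real (C' * (1 / 2) ^ ?s \<beta>) :: complex) = C' * (1 / 2) ^ ?s \<beta>" for \<beta>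
          unfolding norm_of_real using C' by (intro abs_of_nonneg) simp
        then show "(\<lambda>\<beta>. norm (of_real (C' * (1 / 2) ^ ?s \<beta>) :: complex)) summable_on UNIV"
          by (simp only:) (intro summable_on_cmult_right geometric_multi_summable, auto)
        have "norm (of_real (\<bar>exp_coeff (- (1 / 8)) \<gamma>\<bar> * (r\<^sup>2) ^ ?s \<gamma>) :: complex) = \<bar>exp_coeff (- (1 / 8)) \<gamma>\<bar> * (r\<^sup>2) ^ ?s \<gamma>" for \<gamma>
          unfolding norm_of_real by (intro abs_of_nonneg) simp
        then show "(\<lambda>\<gamma>. norm (of_real (\<bar>exp_coeff (- (1 / 8)) \<gamma>\<bar> * (r\<^sup>2) ^ ?s \<gamma>) :: complex)) summable_on UNIV"
          by (simp only:) (rule exp_coeff_summable, simp)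
      qed
      moreover have "(case p of (\<gamma>, \<beta>) \<Rightarrow> norm (of_real (\<bar>exp_coeff (- (1 / 8)) \<gamma>\<bar> * (r\<^sup>2) ^ ?s \<gamma>) * (of_real (C' * (1 / 2) ^ ?s \<beta>) :: complex))) =
        (\<bar>exp_coeff (- (1 / 8)) (fst p)\<bar> * (r\<^sup>2) ^ ?s (fst p)) * (C' * (1 / 2) ^ ?s (snd p))" for p :: "('n \<Rightarrow> nat) \<times> ('n \<Rightarrow> nat)"
        unfolding case_prod_unfold norm_mult norm_of_real using C' by (simp add: abs_mult)
      ultimately have s: "(\<lambda>p :: ('n \<Rightarrow> nat) \<times> ('n \<Rightarrow> nat). V * (r ^ ?s \<alpha> * ((\<bar>exp_coeff (- (1 / 8)) (fst p)\<bar> * (r\<^sup>2) ^ ?s (fst p)) * (C' * (1 / 2) ^ ?s (snd p))))) summable_on UNIV"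
        by (intro summable_on_cmult_right) simp
      show "(\<lambda>p. \<integral>q. norm (?f p q) \<partial>lborel) summable_on UNIV"
        by (rule summable_on_comparison_test[OF s]) (use fnorm in auto)
    qed
    moreover have "integral\<^sup>L lborel (?f p) = ?e (fst p) * b (snd p) * moment r (\<lambda>j. \<alpha> j + 2 * fst p j) (snd p)" for p
      unfolding moment_def by (rule integral_mult_right_zero)
    ultimately have "((\<lambda>p. ?e (fst p) * b (snd p) * moment r (\<lambda>j. \<alpha> j + 2 * fst p j) (snd p)) has_sum integral\<^sup>L lborel ?g) UNIV"
      by (simp only:)
    then have "((\<lambda>p. ?e (fst p) * b (snd p) * moment r (\<lambda>j. \<alpha> j + 2 * fst p j) (snd p)) has_sum integral\<^sup>L lborel ?g) (Sigma UNIV (\<lambda>_. UNIV))"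
      unfolding UNIV_Times_UNIV .
    \<comment> \<open>For fixed \<gamma> only \<beta> = \<alpha> + 2\<gamma> survives, and its
      moment cancels against the denominator of \<open>b\<close>.\<close>
    then have "((\<lambda>\<gamma>. ?e \<gamma> * B (\<lambda>j. \<alpha> j + 2 * \<gamma> j)) has_sum integral\<^sup>L lborel ?g) UNIV"
    proof (rule has_sum_SigmaD)
      fix \<gamma> :: "'n \<Rightarrow> nat"
      show "((\<lambda>\<beta>. ?e (fst (\<gamma>, \<beta>)) * b (snd (\<gamma>, \<beta>)) * moment r (\<lambda>j. \<alpha> j + 2 * fst (\<gamma>, \<beta>) j) (snd (\<gamma>, \<beta>))) has_sum
          ?e \<gamma> * B (\<lambda>j. \<alpha> j + 2 * \<gamma> j)) UNIV"
        unfolding fst_conv snd_conv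
        by (rule has_sum_finite_neutralI[where B = "{\<lambda>j. \<alpha> j + 2 * \<gamma> j}"])
          (auto simp: b_def mnz intro: moment_orthogonal)
    qed
    then have "integral\<^sup>L lborel ?g = shift_exp (- (1 / 8)) B \<alpha>"
      unfolding shift_exp_def by (rule infsumI[symmetric])
    then have "integral\<^sup>L lborel ?g = d \<alpha>" by (simp only: inv)
    then show ?thesis unfolding pt by simp
  qed
  ultimately show ?thesis by (rule that)
qed

section \<open>The equivalences\<close>

lemma stft_adjoint_gevrey_dual:
  fixes u :: "('n::finite phase \<Rightarrow> complex) \<Rightarrow> complex"
  assumes u: "u \<in> gevrey_dual s" and s: "s \<ge> 1"
  shows "stft_adjoint gaussian u \<in> H_flat1"
    "(\<integral>x. stft_adjoint gaussian u x * of_real (hermiten \<beta> x) \<partial>lborel) = u (\<lambda>q. coeff_fun \<beta> (q, 0))"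
proof -
  obtain C R where CR: "C > 0" "R > 0"
    "\<And>\<alpha>. cmod (u (\<lambda>q. coeff_fun \<alpha> (q, 0))) \<le> C * (R ^ (\<Sum>j\<in>UNIV. \<alpha> j) / herm_norm \<alpha>)"
    using gevrey_dual_stft_adjoint(1)[OF u s] by blast
  obtain D where D: "\<And>x. cmod (stft_adjoint gaussian u x) \<le> D * exp (- (norm x)\<^sup>2 / 4)"
    using gevrey_dual_stft_adjoint(2)[OF u s] by blast
  note h = hermite_series_coefficients[OF CR(3,1,2) gevrey_dual_stft_adjoint(3)[OF u s] D]
  show "stft_adjoint gaussian u \<in> H_flat1"
    "(\<integral>x. stft_adjoint gaussian u x * of_real (hermiten \<beta> x) \<partial>lborel) = u (\<lambda>q. coeff_fun \<beta> (q, 0))"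
    by (rule h)+
qed

text \<open>Multiplication by \<open>herm_norm\<close> cancels \<alpha>!^(-1/2) up to a power of
  sqrt 2, so a purely geometric bound remains. \<open>R\<close> takes up this power, dominates all
  radii and is at least 1.\<close>

lemma H_flat1_hermiten_bound:
  fixes f :: "real ^ 'n::finite \<Rightarrow> complex"
  assumes "f \<in> H_flat1"
  obtains C R where "C \<ge> 0" "R \<ge> 1"
    "\<And>\<beta>. cmod ((\<integral>x. f x * of_real (hermiten \<beta> x) \<partial>lborel) * of_real (herm_norm \<beta>)) \<le> C * R ^ (\<Sum>j\<in>UNIV. \<beta> j)"
proof -
  obtain r C where r: "\<forall>b\<in>Basis. 0 < r \<bullet> b" and C: "C > 0"
    and bd: "\<And>\<alpha>. cmod (hermite_coeff f \<alpha>) \<le> C * (mi_power r \<alpha> * mi_fact \<alpha> powr (- (1 / 2)))"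
    using assms unfolding H_flat1_def by blast
  define R where "R = (1 + norm r) * sqrt 2"
  have "1 * 1 \<le> R" unfolding R_def by (intro mult_mono) auto
  then have R: "R \<ge> 1" by simp
  show ?thesis
  proof (rule that[of C R])
    fix \<beta> :: "'n \<Rightarrow> nat"
    \<comment> \<open>A function on the whole space with the given values at the basis vectors;
      elsewhere its values are arbitrary.\<close>
    define \<alpha> where "\<alpha> b = \<beta> (SOME j. axis j 1 = b)" for b :: "real ^ 'n"
    have \<alpha>: "\<alpha> (axis j 1) = \<beta> j" for j
    proof -
      have "(SOME i. axis i (1::real) = axis j 1) = j" by (rule some_equality) (auto simp: axis_eq_axis)
      then show ?thesis by (simp add: \<alpha>_def)
    qed
    have "(\<integral>x. f x * of_real (hermiten \<beta> x) \<partial>lborel) = hermite_coeff f \<alpha>"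
      unfolding hermite_coeff_def hermite_eq_hermiten \<alpha> by simp
    then have "cmod (\<integral>x. f x * of_real (hermiten \<beta> x) \<partial>lborel) * herm_norm \<beta> \<le>
       (C * (mi_power r \<alpha> * mi_fact \<alpha> powr (- (1 / 2)))) * herm_norm \<beta>"
      using bd[of \<alpha>] herm_norm_pos[of \<beta>] by (intro mult_right_mono) auto
    also have "\<dots> \<le> C * R ^ (\<Sum>j\<in>UNIV. \<beta> j)"
    proof -
      have f0: "mi_fact \<alpha> > 0" using mi_fact_ge_1[of \<alpha>] by simp
      have "mi_fact \<alpha> powr (- (1 / 2)) = 1 / sqrt (mi_fact \<alpha>)"
        using f0 unfolding powr_minus_divide by (subst powr_half_sqrt) auto
      moreover have "herm_norm \<beta> = sqrt 2 ^ (\<Sum>j\<in>UNIV. \<beta> j) * sqrt (mi_fact \<alpha>)"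
        unfolding herm_norm_def mi_fact_def prod_Basis_vec \<alpha> sqrt_prod power_sum prod.distrib[symmetric]
        by (simp add: real_sqrt_mult real_sqrt_power)
      ultimately have "mi_fact \<alpha> powr (- (1 / 2)) * herm_norm \<beta> = sqrt 2 ^ (\<Sum>j\<in>UNIV. \<beta> j)"
        using f0 by simp
      moreover have "mi_power r \<alpha> \<le> (1 + norm r) ^ (\<Sum>j\<in>UNIV. \<beta> j)"
      proof -
        have "0 < r $ j" for j using r by (auto simp: Basis_vec_def inner_axis)
        moreover have "r $ j \<le> 1 + norm r" for j
          using component_le_norm_cart[of r j] by linarith
        ultimately show ?thesis
          unfolding mi_power_def prod_Basis_vec \<alpha> power_sum
          by (intro prod_mono conjI power_mono) (auto simp: inner_axis less_imp_le)
      qed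
      ultimately have "mi_power r \<alpha> * (mi_fact \<alpha> powr (- (1 / 2)) * herm_norm \<beta>) \<le> R ^ (\<Sum>j\<in>UNIV. \<beta> j)"
        unfolding R_def power_mult_distrib by (simp add: mult_right_mono)
      then show ?thesis using C by (simp add: mult.assoc)
    qed
    finally show "cmod ((\<integral>x. f x * of_real (hermiten \<beta> x) \<partial>lborel) * of_real (herm_norm \<beta>)) \<le> C * R ^ (\<Sum>j\<in>UNIV. \<beta> j)"
      using herm_norm_pos[of \<beta>] by (simp add: norm_mult)
  qed (use C R in auto)
qed

text \<open>Conjugation preserves the moduli of the coordinates, so on the disc F_0 is evaluated in
  the closed polydisc, where it is continuous. The cut-off confines the support to a compact
  set.\<close>

lemma analytic_density_Linf_compact:
  fixes F0 :: "complex ^ 'n::finite \<Rightarrow> complex"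
  assumes r: "r > 0" and F0: "F0 \<in> analytic_near (closure (polydisc (\<chi> j. r)))"
  shows "(\<lambda>q :: 'n phase. F0 (cpair (fst q) (- snd q)) * exp (- \<i> * of_real (fst q \<bullet> snd q)) *
       indicator (closure (polydisc (\<chi> j. r))) (zc q)) \<in> Linf_compact"
    (is "?F \<in> _")
proof -
  let ?P = "closure (polydisc (\<chi> j. r)) :: (complex ^ 'n) set"
  let ?G = "\<lambda>q :: 'n phase. F0 (cpair (fst q) (- snd q)) * exp (- \<i> * of_real (fst q \<bullet> snd q))"
  have cl: "?P = {z. \<forall>j. cmod (z $ j) \<le> r}" using r by (subst closure_polydisc) auto
  have I: "indicator ?P (zc q) = (of_real (indicator (phase_disc r) q) :: complex)" for q
    unfolding cl phase_disc_def by (simp add: indicator_def)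
  have F: "?F q = indicator (phase_disc r) q *\<^sub>R ?G q" for q
    unfolding I by (simp add: scaleR_conv_of_real)
  have cF0: "continuous_on ?P F0"
  proof (rule continuous_at_imp_continuous_on, rule ballI)
    fix z assume "z \<in> ?P"
    then show "isCont F0 z" using F0 has_derivative_continuous unfolding analytic_near_def by blast
  qed
  have "cmod (cpair (fst q) (- snd q) $ j) = cmod (zc q $ j)" for q :: "'n phase" and j
    by (simp add: cpair_def cmod_def)
  then have "cpair (fst q) (- snd q) \<in> ?P" if "q \<in> phase_disc r" for q :: "'n phase"
    using that by (simp add: cl phase_disc_def)
  then have cG: "continuous_on (phase_disc r) ?G"
    by (intro continuous_intros continuous_on_compose2[OF cF0])
      (auto simp: cpair_def[abs_def] intro!: continuous_intros)
  have "(\<lambda>q. indicator (phase_disc r) q *\<^sub>R ?G q) \<in> borel_measurable borel"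
    by (rule borel_measurable_continuous_on_indicator[OF _ cG]) measurable
  then have m: "?F \<in> borel_measurable lborel" unfolding F by simp
  have "compact (?G ` phase_disc r)" by (rule compact_continuous_image[OF cG compact_phase_disc])
  then obtain B where B: "\<And>q. q \<in> phase_disc r \<Longrightarrow> cmod (?G q) \<le> B"
    using compact_imp_bounded bounded_iff by (metis (no_types, lifting) image_eqI)
  have "cmod (?F q) \<le> max B 0" for q
    unfolding F using B[of q] by (auto simp: indicator_def)
  then have b: "\<exists>C. AE q in lborel. cmod (?F q) \<le> C" by blast
  have sub: "ess_support ?F \<subseteq> phase_disc r"
  proof -
    have "open (- phase_disc r :: 'n phase set)"
      by (rule open_Compl[OF compact_imp_closed[OF compact_phase_disc]])
    moreover have "AE q in lborel. q \<in> - phase_disc r \<longrightarrow> ?F q = 0" unfolding F by simp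
    ultimately show ?thesis unfolding ess_support_def by blast
  qed
  have "closed (ess_support ?F)" unfolding ess_support_def by (intro closed_Compl open_Union) auto
  then have "compact (phase_disc r \<inter> ess_support ?F)" by (rule compact_Int_closed[OF compact_phase_disc])
  then have "compact (ess_support ?F)" unfolding Int_absorb1[OF sub] .
  then show ?thesis using m b by (simp add: Linf_compact_def)
qed

lemma L2_diff:
  assumes "f \<in> L2" "g \<in> L2"
  shows "(\<lambda>x. f x - g x) \<in> L2"
proof -
  have [measurable]: "f \<in> borel_measurable borel" "g \<in> borel_measurable borel"
    and i: "integrable lborel (\<lambda>x. 2 * (cmod (f x))\<^sup>2 + 2 * (cmod (g x))\<^sup>2)"
    using assms by (auto simp: L2_def)
  have le: "(cmod (f x - g x))\<^sup>2 \<le> 2 * (cmod (f x))\<^sup>2 + 2 * (cmod (g x))\<^sup>2" for x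
  proof -
    have "(cmod (f x - g x))\<^sup>2 \<le> (cmod (f x) + cmod (g x))\<^sup>2"
      by (intro power_mono norm_triangle_ineq4) simp
    also have "\<dots> \<le> 2 * (cmod (f x))\<^sup>2 + 2 * (cmod (g x))\<^sup>2"
      using zero_le_power2[of "cmod (f x) - cmod (g x)"] by (simp add: power2_eq_square algebra_simps)
    finally show ?thesis .
  qed
  have "integrable lborel (\<lambda>x. (cmod (f x - g x))\<^sup>2)"
    by (rule Bochner_Integration.integrable_bound[OF i]) (use le in \<open>auto intro: order_trans\<close>)
  then show ?thesis by (simp add: L2_def)
qed

lemma L2_eq_AE_by_hermiten:
  fixes f g :: "real ^ 'n::finite \<Rightarrow> complex"
  assumes f: "f \<in> L2" and g: "g \<in> L2"
    and eq: "\<And>\<beta>. (\<integral>x. f x * of_real (hermiten \<beta> x) \<partial>lborel) = (\<integral>x. g x * of_real (hermiten \<beta> x) \<partial>lborel)"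
  shows "AE x in lborel. f x = g x"
proof -
  have int: "integrable lborel (\<lambda>x. h x * of_real (hermiten \<beta> x))" if "h \<in> L2" for h :: "real ^ 'n \<Rightarrow> complex" and \<beta>
    by (intro L2_times_real_integrable(1)[OF that] hermiten_orthonormal) measurable
  have "AE x in lborel. f x - g x = 0"
  proof (rule hermiten_complete[OF L2_diff[OF f g]])
    show "(\<integral>x. (f x - g x) * of_real (hermiten \<beta> x) \<partial>lborel) = 0" for \<beta>
      unfolding left_diff_distrib using Bochner_Integration.integral_diff[OF int[OF f] int[OF g]] eq[of \<beta>] by simp
  qed
  then show ?thesis by simp
qed

text \<open>Completeness gives equality almost everywhere only; this carries it over to
  distributions, which see nothing but integrals.\<close>

lemma tempered_eq_cong_AE:
  assumes eq: "tempered_eq u f" and AE: "AE x in lborel. f x = g x"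
    and [measurable]: "f \<in> borel_measurable borel" "g \<in> borel_measurable borel"
  shows "tempered_eq u g"
  unfolding tempered_eq_def regular_def
proof (intro ballI conjI)
  fix k :: "'a \<Rightarrow> complex" assume k: "k \<in> schwartz"
  then have "iter_partial [] k differentiable_on UNIV"
    unfolding schwartz_def smooth_def by (metis (mono_tags, lifting) empty_subsetI list.set(1) mem_Collect_eq)
  then have [measurable]: "k \<in> borel_measurable borel"
    by (simp add: differentiable_imp_continuous_on borel_measurable_continuous_onI)
  have AE': "AE x in lborel. f x * k x = g x * k x" using AE by eventually_elim simp
  have fk: "integrable lborel (\<lambda>x. f x * k x)" "u k = (\<integral>x. f x * k x \<partial>lborel)"
    using eq k unfolding tempered_eq_def regular_def by auto
  show "integrable lborel (\<lambda>x. g x * k x)"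
    using fk(1) by (subst (asm) integrable_cong_AE[OF _ _ AE']) auto
  show "u k = (\<integral>x. g x * k x \<partial>lborel)"
    unfolding fk(2) by (rule integral_cong_AE[OF _ _ AE']) auto
qed

theorem proposition4p1:
  fixes s :: real and f :: "(real ^ 'n::finite \<Rightarrow> complex) \<Rightarrow> complex"
  assumes "s > 1" and "f \<in> tempered_distributions"
  defines "cond1 \<equiv> \<exists>f\<^sub>0\<in>H_flat1. tempered_eq f f\<^sub>0"
    and "cond2 \<equiv> \<exists>F\<in>gevrey_dual s. tempered_eq f (stft_adjoint gaussian F)"
    and "cond3 \<equiv> \<exists>F\<in>Linf_compact. tempered_eq f (stft_adjoint gaussian (regular F))"
    and "cond4 \<equiv> \<exists>F\<in>Linf_compact. tempered_eq f (stft_adjoint gaussian (regular F)) \<and>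
           (\<exists>r. (\<forall>j. 0 < r $ j) \<and> (\<exists>F\<^sub>0\<in>analytic_near (closure (polydisc r)).
             AE (x, \<xi>) in lborel. F (x, \<xi>) =
               F\<^sub>0 (cpair x (- \<xi>)) * exp (- \<i> * complex_of_real (x \<bullet> \<xi>)) *
               indicator (closure (polydisc r)) (cpair x \<xi>)))"
  shows "(cond1 \<longleftrightarrow> cond2) \<and> (cond1 \<longleftrightarrow> cond3) \<and> (cond1 \<longleftrightarrow> cond4)"
proof -
  have s: "s \<ge> 1" using assms(1) by simp
  have "cond2 \<Longrightarrow> cond1"
    unfolding cond1_def cond2_def using stft_adjoint_gevrey_dual(1)[OF _ s] by blast
  moreover have "cond3 \<Longrightarrow> cond2"
    unfolding cond2_def cond3_def using regular_in_gevrey_dual by blast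
  moreover have "cond4 \<Longrightarrow> cond3"
    unfolding cond3_def cond4_def by blast
  \<comment> \<open>The coefficients are multiplied by \<open>herm_norm\<close> because only the
    rescaled sequence is geometrically bounded, as the construction of the density requires; the
    division there restores them. The transform of the density then has the Hermite coefficients of
    \<open>f0\<close>, and completeness identifies the two functions.\<close>
  moreover have "cond4" if c1: cond1
  proof -
    obtain f0 where f0: "f0 \<in> H_flat1" "tempered_eq f f0" using c1 unfolding cond1_def by blast
    let ?c = "\<lambda>\<beta>. \<integral>x. f0 x * of_real (hermiten \<beta> x) \<partial>lborel"
    obtain C R where CR: "C \<ge> 0" "R \<ge> 1"
      "\<And>\<beta>. cmod (?c \<beta> * of_real (herm_norm \<beta>)) \<le> C * R ^ (\<Sum>j\<in>UNIV. \<beta> j)"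
      using H_flat1_hermiten_bound[OF f0(1)] by blast
    let ?r = "\<chi> j. 8 * R"
    obtain F0 where F0: "F0 \<in> analytic_near (closure (polydisc ?r))"
      "\<And>\<alpha>. (\<integral>q. (F0 (cpair (fst q) (- snd q)) * exp (- \<i> * of_real (fst q \<bullet> snd q)) *
         indicator (closure (polydisc ?r)) (zc q)) * coeff_fun \<alpha> (q, 0) \<partial>lborel) = ?c \<alpha> * of_real (herm_norm \<alpha>) / of_real (herm_norm \<alpha>)"
      using analytic_density[OF CR(3,1,2)] by blast
    define F where "F q = F0 (cpair (fst q) (- snd q)) * exp (- \<i> * complex_of_real (fst q \<bullet> snd q)) *
       indicator (closure (polydisc ?r)) (zc q)" for q
    have F: "F \<in> Linf_compact"
      unfolding F_def[abs_def] using CR(2) by (intro analytic_density_Linf_compact F0(1)) simp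
    let ?f1 = "stft_adjoint gaussian (regular F)"
    note f1 = stft_adjoint_gevrey_dual[OF regular_in_gevrey_dual[OF F, of s] s]
    have L2: "f0 \<in> L2" "?f1 \<in> L2" using f0(1) f1(1) by (auto simp: H_flat1_def)
    have "?c \<beta> = (\<integral>x. ?f1 x * of_real (hermiten \<beta> x) \<partial>lborel)" for \<beta>
    proof -
      have "regular F (\<lambda>q. coeff_fun \<beta> (q, 0)) = ?c \<beta> * of_real (herm_norm \<beta>) / of_real (herm_norm \<beta>)"
        unfolding regular_def F_def by (rule F0(2))
      also have "\<dots> = ?c \<beta>" using herm_norm_pos[of \<beta>] by simp
      finally show ?thesis unfolding f1(2) ..
    qed
    then have ae: "AE x in lborel. f0 x = ?f1 x" by (rule L2_eq_AE_by_hermiten[OF L2])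
    have m: "h \<in> borel_measurable borel" if "h \<in> L2" for h :: "real ^ 'n \<Rightarrow> complex"
      using that unfolding L2_def by simp
    have "tempered_eq f ?f1"
      by (rule tempered_eq_cong_AE[OF f0(2) ae m[OF L2(1)] m[OF L2(2)]])
    moreover have "\<forall>j. 0 < ?r $ j" using CR(2) by simp
    moreover have "AE (x, \<xi>) in lborel. F (x, \<xi>) =
       F0 (cpair x (- \<xi>)) * exp (- \<i> * complex_of_real (x \<bullet> \<xi>)) * indicator (closure (polydisc ?r)) (cpair x \<xi>)"
      by (simp add: F_def)
    ultimately show cond4 unfolding cond4_def using F F0(1) by blast
  qed
  ultimately show ?thesis by blast
qed

end
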